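(* Let $\Omega_0\subseteq\mathbb{R}^N$ be nonempty, open, bounded with Lipschitz boundary, $T>0$, and let $B\in C^{0,1}([0,T]\times\overline{\Omega_0};\mathbb{R}^{N\times N}_{\rm sym})$ be uniformly elliptic, i.e. $(B(t,y)w)\cdot w\ge c_B|w|^2$ for some $c_B>0$, all $w\in\mathbb{R}^N$, all $(t,y)$; $a\in L^\infty([0,T]\times\overline{\Omega_0};\mathbb{R}^N)$; $b\in C^{0,1}([0,T]\times\overline{\Omega_0};\mathbb{R}^N)$; $g\in L^2((0,T)\times\Omega_0)$; $v_0\in H^1_0(\Omega_0)$; $v_1\in L^2(\Omega_0)$. Then there exists a strong-weak solution $v$ of $$\ddot v-\operatorname{div}(B\nabla v)+a\cdot\nabla v-2b\cdot\nabla\dot v=g\ \text{in }(0,T)\times\Omega_0,\quad v=0\ \text{on }(0,T)\times\partial\Omega_0,\quad v(0)=v_0,\ \dot v(0)=v_1,$$ which satisfies $v\in C^0_w([0,T];H^1_0(\Omega_0))$ and $\dot v\in C^0_w([0,T];L^2(\Omega_0))$.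
   Context: A strong-weak solution is $v:[0,T]\times\overline{\Omega_0}\to\mathbb{R}$ such that: (i) $v\in L^2(0,T;H^1_0(\Omega_0))$, $\dot v\in L^2(0,T;L^2(\Omega_0))$, $\ddot v\in L^2(0,T;H^{-1}(\Omega_0))$; (ii) $v\in C^0([0,T];L^2(\Omega_0))$ with $v(0)=v_0$ and $\dot v\in C^0([0,T];H^{-1}(\Omega_0))$ with $\dot v(0)=v_1$; (iii) for a.e. $t$ and every $\phi\in H^1_0(\Omega_0)$: $\langle\ddot v(t),\phi\rangle_{H^{-1},H^1_0}+\langle B(t)\nabla v(t),\nabla\phi\rangle_{L^2}+\langle a(t)\cdot\nabla v(t),\phi\rangle_{L^2}+2\langle\dot v(t),\operatorname{div}(b(t)\phi)\rangle_{L^2}=\langle g(t),\phi\rangle_{L^2}$. $C^0_w([0,T];X)$ denotes maps continuous into $X$ endowed with its weak topology. *)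

theory Defs
  imports "HOL-Analysis.Analysis"
begin

fun dderiv :: "'a list \<Rightarrow> ('a::real_normed_vector \<Rightarrow> real) \<Rightarrow> 'a \<Rightarrow> real" where
  "dderiv [] f = f"
| "dderiv (e # es) f = (\<lambda>x. frechet_derivative (dderiv es f) (at x) e)"

definition smooth_fun :: "('a::real_normed_vector \<Rightarrow> real) \<Rightarrow> bool" where
  "smooth_fun f \<longleftrightarrow> (\<forall>es x. dderiv es f differentiable (at x))"

definition test_fun :: "'a::euclidean_space set \<Rightarrow> ('a \<Rightarrow> real) \<Rightarrow> bool" where
  "test_fun U \<phi> \<longleftrightarrow> smooth_fun \<phi> \<and> compact (closure {x. \<phi> x \<noteq> 0})
      \<and> closure {x. \<phi> x \<noteq> 0} \<subseteq> U"

definition L2 :: "'a::euclidean_space set \<Rightarrow> ('a \<Rightarrow> real) \<Rightarrow> bool" where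
  "L2 U f \<longleftrightarrow> f \<in> borel_measurable (lebesgue_on U)
      \<and> integrable (lebesgue_on U) (\<lambda>x. (f x)^2)"

definition L2v :: "'a::euclidean_space set \<Rightarrow> ('a \<Rightarrow> 'b::euclidean_space) \<Rightarrow> bool" where
  "L2v U F \<longleftrightarrow> F \<in> borel_measurable (lebesgue_on U)
      \<and> integrable (lebesgue_on U) (\<lambda>x. (norm (F x))^2)"

definition L2norm :: "'a::euclidean_space set \<Rightarrow> ('a \<Rightarrow> real) \<Rightarrow> real" where
  "L2norm U f = sqrt (\<integral>x. (f x)^2 \<partial>lebesgue_on U)"

text \<open>The L2 pairing; also the embedding of L2 into H^{-1}.\<close>
definition l2pair :: "'a::euclidean_space set \<Rightarrow> ('a \<Rightarrow> real) \<Rightarrow> ('a \<Rightarrow> real) \<Rightarrow> real" where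
  "l2pair U f g = (\<integral>x. f x * g x \<partial>lebesgue_on U)"

definition cgrad :: "(real^'n \<Rightarrow> real) \<Rightarrow> real^'n \<Rightarrow> real^'n" where
  "cgrad \<phi> x = (\<chi> i. frechet_derivative \<phi> (at x) (axis i 1))"

definition is_weak_grad :: "(real^'n) set \<Rightarrow> (real^'n \<Rightarrow> real) \<Rightarrow> (real^'n \<Rightarrow> real^'n) \<Rightarrow> bool" where
  "is_weak_grad U u G \<longleftrightarrow> (\<forall>\<phi>. test_fun U \<phi> \<longrightarrow> (\<forall>i.
      (\<integral>x. u x * cgrad \<phi> x $ i \<partial>lebesgue_on U) = - (\<integral>x. G x $ i * \<phi> x \<partial>lebesgue_on U)))"

definition H1 :: "(real^'n) set \<Rightarrow> (real^'n \<Rightarrow> real) \<Rightarrow> bool" where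
  "H1 U u \<longleftrightarrow> L2 U u \<and> (\<exists>G. L2v U G \<and> is_weak_grad U u G)"

text \<open>The weak gradient (unique up to null sets; only used inside integrals).\<close>
definition wgrad :: "(real^'n) set \<Rightarrow> (real^'n \<Rightarrow> real) \<Rightarrow> real^'n \<Rightarrow> real^'n" where
  "wgrad U u = (SOME G. L2v U G \<and> is_weak_grad U u G)"

definition H1norm :: "(real^'n) set \<Rightarrow> (real^'n \<Rightarrow> real) \<Rightarrow> real" where
  "H1norm U u = sqrt ((\<integral>x. (u x)^2 \<partial>lebesgue_on U) + (\<integral>x. (norm (wgrad U u x))^2 \<partial>lebesgue_on U))"

definition H10 :: "(real^'n) set \<Rightarrow> (real^'n \<Rightarrow> real) \<Rightarrow> bool" where
  "H10 U u \<longleftrightarrow> H1 U u \<and> (\<exists>\<phi>s. (\<forall>k. test_fun U (\<phi>s k))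
      \<and> (\<lambda>k. H1norm U (\<lambda>x. u x - \<phi>s k x)) \<longlonglongrightarrow> 0)"

definition Hm1 :: "(real^'n) set \<Rightarrow> ((real^'n \<Rightarrow> real) \<Rightarrow> real) \<Rightarrow> bool" where
  "Hm1 U F \<longleftrightarrow> (\<forall>u w c. H10 U u \<longrightarrow> H10 U w \<longrightarrow> F (\<lambda>x. u x + c * w x) = F u + c * F w)
      \<and> (\<exists>C. \<forall>u. H10 U u \<longrightarrow> \<bar>F u\<bar> \<le> C * H1norm U u)"

definition Hm1norm :: "(real^'n) set \<Rightarrow> ((real^'n \<Rightarrow> real) \<Rightarrow> real) \<Rightarrow> real" where
  "Hm1norm U F = Sup {\<bar>F u\<bar> | u. H10 U u \<and> H1norm U u \<le> 1}"

definition is_weak_div :: "(real^'n) set \<Rightarrow> (real^'n \<Rightarrow> real^'n) \<Rightarrow> (real^'n \<Rightarrow> real) \<Rightarrow> bool" where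
  "is_weak_div U F d \<longleftrightarrow> (\<forall>\<phi>. test_fun U \<phi> \<longrightarrow>
      (\<integral>x. d x * \<phi> x \<partial>lebesgue_on U) = - (\<integral>x. F x \<bullet> cgrad \<phi> x \<partial>lebesgue_on U))"

definition wdiv :: "(real^'n) set \<Rightarrow> (real^'n \<Rightarrow> real^'n) \<Rightarrow> real^'n \<Rightarrow> real" where
  "wdiv U F = (SOME d. L2 U d \<and> is_weak_div U F d)"

text \<open>Locally, U is the region below the graph of a Lipschitz function, in suitable
  orthonormal coordinates (\<nu> is the "vertical" direction; \<gamma> does not depend on it).\<close>
definition lipschitz_boundary :: "(real^'n) set \<Rightarrow> bool" where
  "lipschitz_boundary U \<longleftrightarrow> (\<forall>x0\<in>frontier U. \<exists>r>0. \<exists>\<nu> \<gamma> L. norm \<nu> = 1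
      \<and> L-lipschitz_on UNIV \<gamma> \<and> (\<forall>x s. \<gamma> (x + s *\<^sub>R \<nu>) = \<gamma> x)
      \<and> U \<inter> ball x0 r = {x \<in> ball x0 r. x \<bullet> \<nu> < \<gamma> x})"

text \<open>Measurability is weak measurability (equivalent to strong measurability by Pettis'
  theorem, the spaces being separable).\<close>
definition L2_H10 :: "real \<Rightarrow> (real^'n) set \<Rightarrow> (real \<Rightarrow> real^'n \<Rightarrow> real) \<Rightarrow> bool" where
  "L2_H10 T U v \<longleftrightarrow> (AE t in lebesgue_on {0..T}. H10 U (v t))
     \<and> (\<forall>\<psi> \<Psi>. L2 U \<psi> \<longrightarrow> L2v U \<Psi> \<longrightarrow>
          (\<lambda>t. l2pair U (v t) \<psi> + (\<integral>x. wgrad U (v t) x \<bullet> \<Psi> x \<partial>lebesgue_on U))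
            \<in> borel_measurable (lebesgue_on {0..T}))
     \<and> (\<integral>\<^sup>+t. ennreal ((H1norm U (v t))^2) \<partial>lebesgue_on {0..T}) < \<infinity>"

definition L2_L2 :: "real \<Rightarrow> (real^'n) set \<Rightarrow> (real \<Rightarrow> real^'n \<Rightarrow> real) \<Rightarrow> bool" where
  "L2_L2 T U w \<longleftrightarrow> (AE t in lebesgue_on {0..T}. L2 U (w t))
     \<and> (\<forall>\<psi>. L2 U \<psi> \<longrightarrow> (\<lambda>t. l2pair U (w t) \<psi>) \<in> borel_measurable (lebesgue_on {0..T}))
     \<and> (\<integral>\<^sup>+t. ennreal ((L2norm U (w t))^2) \<partial>lebesgue_on {0..T}) < \<infinity>"

definition L2_Hm1 :: "real \<Rightarrow> (real^'n) set \<Rightarrow> (real \<Rightarrow> (real^'n \<Rightarrow> real) \<Rightarrow> real) \<Rightarrow> bool" where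
  "L2_Hm1 T U F \<longleftrightarrow> (AE t in lebesgue_on {0..T}. Hm1 U (F t))
     \<and> (\<forall>\<psi>. H10 U \<psi> \<longrightarrow> (\<lambda>t. F t \<psi>) \<in> borel_measurable (lebesgue_on {0..T}))
     \<and> (\<integral>\<^sup>+t. ennreal ((Hm1norm U (F t))^2) \<partial>lebesgue_on {0..T}) < \<infinity>"

definition time_deriv_L2 :: "real \<Rightarrow> (real^'n) set \<Rightarrow> (real \<Rightarrow> real^'n \<Rightarrow> real)
    \<Rightarrow> (real \<Rightarrow> real^'n \<Rightarrow> real) \<Rightarrow> bool" where
  "time_deriv_L2 T U v w \<longleftrightarrow> (\<forall>\<phi> \<psi>. test_fun {0<..<T} \<phi> \<longrightarrow> L2 U \<psi> \<longrightarrow>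
      (\<integral>t. l2pair U (v t) \<psi> * deriv \<phi> t \<partial>lebesgue_on {0<..<T})
        = - (\<integral>t. l2pair U (w t) \<psi> * \<phi> t \<partial>lebesgue_on {0<..<T}))"

definition time_deriv_Hm1 :: "real \<Rightarrow> (real^'n) set \<Rightarrow> (real \<Rightarrow> real^'n \<Rightarrow> real)
    \<Rightarrow> (real \<Rightarrow> (real^'n \<Rightarrow> real) \<Rightarrow> real) \<Rightarrow> bool" where
  "time_deriv_Hm1 T U w F \<longleftrightarrow> (\<forall>\<phi> \<psi>. test_fun {0<..<T} \<phi> \<longrightarrow> H10 U \<psi> \<longrightarrow>
      (\<integral>t. F t \<psi> * \<phi> t \<partial>lebesgue_on {0<..<T})
        = - (\<integral>t. l2pair U (w t) \<psi> * deriv \<phi> t \<partial>lebesgue_on {0<..<T}))"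

text \<open>v is the solution, vd its first and vdd its second time derivative
  (vd(t) represented by an L2 function, acting on H^1_0 through the L2 pairing).\<close>
definition strong_weak_solution_with ::
  "real \<Rightarrow> (real^'n) set \<Rightarrow> (real \<Rightarrow> real^'n \<Rightarrow> real^'n^'n) \<Rightarrow> (real \<Rightarrow> real^'n \<Rightarrow> real^'n)
   \<Rightarrow> (real \<Rightarrow> real^'n \<Rightarrow> real^'n) \<Rightarrow> (real \<Rightarrow> real^'n \<Rightarrow> real) \<Rightarrow> (real^'n \<Rightarrow> real)
   \<Rightarrow> (real^'n \<Rightarrow> real) \<Rightarrow> (real \<Rightarrow> real^'n \<Rightarrow> real) \<Rightarrow> (real \<Rightarrow> real^'n \<Rightarrow> real)
   \<Rightarrow> (real \<Rightarrow> (real^'n \<Rightarrow> real) \<Rightarrow> real) \<Rightarrow> bool" where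
  "strong_weak_solution_with T U B a b g v0 v1 v vd vdd \<longleftrightarrow>
     \<comment> \<open>(i)\<close>
     L2_H10 T U v \<and> time_deriv_L2 T U v vd \<and> L2_L2 T U vd
     \<and> time_deriv_Hm1 T U vd vdd \<and> L2_Hm1 T U vdd
     \<comment> \<open>(ii)\<close>
     \<and> (\<forall>t\<in>{0..T}. L2 U (v t))
     \<and> (\<forall>t\<in>{0..T}. ((\<lambda>s. L2norm U (\<lambda>x. v s x - v t x)) \<longlongrightarrow> 0) (at t within {0..T}))
     \<and> (AE x in lebesgue_on U. v 0 x = v0 x)
     \<and> (\<forall>t\<in>{0..T}. Hm1 U (l2pair U (vd t)))
     \<and> (\<forall>t\<in>{0..T}. ((\<lambda>s. Hm1norm U (l2pair U (\<lambda>x. vd s x - vd t x))) \<longlongrightarrow> 0)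
                      (at t within {0..T}))
     \<and> (\<forall>\<psi>. H10 U \<psi> \<longrightarrow> l2pair U (vd 0) \<psi> = l2pair U v1 \<psi>)
     \<comment> \<open>(iii)\<close>
     \<and> (AE t in lebesgue_on {0..T}. \<forall>\<phi>. H10 U \<phi> \<longrightarrow>
          vdd t \<phi>
          + (\<integral>x. (B t x *v wgrad U (v t) x) \<bullet> wgrad U \<phi> x \<partial>lebesgue_on U)
          + (\<integral>x. (a t x \<bullet> wgrad U (v t) x) * \<phi> x \<partial>lebesgue_on U)
          + 2 * l2pair U (vd t) (wdiv U (\<lambda>x. \<phi> x *\<^sub>R b t x))
          = l2pair U (g t) \<phi>)"

definition strong_weak_solution where
  "strong_weak_solution T U B a b g v0 v1 v \<longleftrightarrow>
     (\<exists>vd vdd. strong_weak_solution_with T U B a b g v0 v1 v vd vdd)"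

definition weakly_cont_H10 :: "real \<Rightarrow> (real^'n) set \<Rightarrow> (real \<Rightarrow> real^'n \<Rightarrow> real) \<Rightarrow> bool" where
  "weakly_cont_H10 T U v \<longleftrightarrow> (\<forall>t\<in>{0..T}. H10 U (v t))
     \<and> (\<forall>\<Lambda>. Hm1 U \<Lambda> \<longrightarrow> continuous_on {0..T} (\<lambda>t. \<Lambda> (v t)))"

definition weakly_cont_L2 :: "real \<Rightarrow> (real^'n) set \<Rightarrow> (real \<Rightarrow> real^'n \<Rightarrow> real) \<Rightarrow> bool" where
  "weakly_cont_L2 T U w \<longleftrightarrow> (\<forall>t\<in>{0..T}. L2 U (w t))
     \<and> (\<forall>\<psi>. L2 U \<psi> \<longrightarrow> continuous_on {0..T} (\<lambda>t. l2pair U (w t) \<psi>))"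

end

theory Submission
  imports Defs "HOL-Complex_Analysis.Great_Picard"
begin

text \<open>The equation is discretised in time by implicit Euler steps. Each step is an elliptic problem,
  solved by Lax--Milgram in \<open>H\<^sup>1\<^sub>0\<close>. Testing with the discrete velocity gives an energy inequality: the
  transport term \<open>2 \<langle>v', div (b v')\<rangle>\<close> loses no derivative, because \<open>v \<mapsto> div (b v)\<close> is skew up to a bounded
  operator, and the first order term is absorbed by a discrete Gronwall argument. Weak compactness along a
  diagonal subsequence yields a weakly continuous limit, and the equation passes to the limit in its
  time-integrated form because all terms are linear. The coefficients \<open>a\<close> and \<open>g\<close>, given up to null sets of the
  space-time cylinder, are replaced by Borel versions, for which the time slices are well behaved.\<close>

section \<open>Hilbert spaces\<close>

subsection \<open>Linear forms on subspaces\<close>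

definition linear_form_on :: "'a::real_vector set \<Rightarrow> ('a \<Rightarrow> real) \<Rightarrow> bool" where
  "linear_form_on V f \<longleftrightarrow> (\<forall>x\<in>V. \<forall>y\<in>V. \<forall>c. f (x + c *\<^sub>R y) = f x + c * f y)"

lemma linear_form_onI:
  "(\<And>x y c. x \<in> V \<Longrightarrow> y \<in> V \<Longrightarrow> f (x + c *\<^sub>R y) = f x + c * f y) \<Longrightarrow> linear_form_on V f"
  by (simp add: linear_form_on_def)

lemma linear_form_onD:
  "linear_form_on V f \<Longrightarrow> x \<in> V \<Longrightarrow> y \<in> V \<Longrightarrow> f (x + c *\<^sub>R y) = f x + c * f y"
  by (simp add: linear_form_on_def)

lemma linear_form_on_diff:
  "linear_form_on V f \<Longrightarrow> x \<in> V \<Longrightarrow> y \<in> V \<Longrightarrow> f (x - y) = f x - f y"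
  using linear_form_onD[of V f x y "-1"] by simp

lemma linear_form_on_zero: "linear_form_on V f \<Longrightarrow> subspace V \<Longrightarrow> f 0 = 0"
  using linear_form_on_diff[of V f 0 0] by (simp add: subspace_0)

lemma linear_form_on_scale:
  "linear_form_on V f \<Longrightarrow> subspace V \<Longrightarrow> x \<in> V \<Longrightarrow> f (c *\<^sub>R x) = c * f x"
  using linear_form_onD[of V f 0 x c] linear_form_on_zero[of V f] by (simp add: subspace_0)

lemma linear_form_on_plus:
  "linear_form_on V f \<Longrightarrow> linear_form_on V h \<Longrightarrow> linear_form_on V (\<lambda>x. f x + h x)"
  by (auto simp: linear_form_on_def algebra_simps)

lemma linear_form_on_cmult: "linear_form_on V f \<Longrightarrow> linear_form_on V (\<lambda>x. r * f x)"
  by (auto simp: linear_form_on_def algebra_simps)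

lemma linear_form_on_inner_left: "linear_form_on V (\<lambda>x. x \<bullet> h)"
  by (simp add: linear_form_on_def inner_add_left)

lemma linear_form_on_inner_linear:
  "linear L \<Longrightarrow> linear_form_on V (\<lambda>x. h \<bullet> L x)" "linear L \<Longrightarrow> linear_form_on V (\<lambda>x. L x \<bullet> h)"
  by (auto simp: linear_form_on_def linear_add linear_scale inner_add_right inner_add_left)

lemma linear_form_on_integral:
  fixes f :: "'a::real_vector \<Rightarrow> real \<Rightarrow> real"
  assumes integrable: "\<And>x. x \<in> V \<Longrightarrow> f x integrable_on I"
    and linear: "\<And>s. s \<in> I \<Longrightarrow> linear_form_on V (\<lambda>x. f x s)"
  shows "linear_form_on V (\<lambda>x. integral I (f x))"
proof (rule linear_form_onI)
  fix x y c assume xy: "x \<in> V" "y \<in> V"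
  have "integral I (f (x + c *\<^sub>R y)) = integral I (\<lambda>s. f x s + c * f y s)"
    using linear_form_onD[OF linear xy] by (intro integral_cong) auto
  also have "\<dots> = integral I (f x) + c * integral I (f y)"
    using integrable[OF xy(1)] integrable[OF xy(2)]
    by (subst Henstock_Kurzweil_Integration.integral_add) (auto intro: integrable_on_mult_right)
  finally show "integral I (f (x + c *\<^sub>R y)) = integral I (f x) + c * integral I (f y)" .
qed

lemma subspace_closure:
  fixes S :: "'a::real_normed_vector set"
  assumes "subspace S"
  shows "subspace (closure S)"
proof (rule subspaceI)
  show "0 \<in> closure S" using subspace_0[OF assms] closure_subset by blast
next
  fix x y assume "x \<in> closure S" "y \<in> closure S"
  then obtain a b where "\<And>n. a n \<in> S" "a \<longlonglongrightarrow> x" "\<And>n. b n \<in> S" "b \<longlonglongrightarrow> y"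
    by (auto simp: closure_sequential)
  then show "x + y \<in> closure S"
    unfolding closure_sequential using subspace_add[OF assms]
    by (intro exI[of _ "\<lambda>n. a n + b n"]) (auto intro: tendsto_intros)
next
  fix x c assume "x \<in> closure S"
  then obtain a where "\<And>n. a n \<in> S" "a \<longlonglongrightarrow> x" by (auto simp: closure_sequential)
  then show "c *\<^sub>R x \<in> closure S"
    unfolding closure_sequential using subspace_scale[OF assms]
    by (intro exI[of _ "\<lambda>n. c *\<^sub>R a n"]) (auto intro: tendsto_intros)
qed

lemma norm_le_if_norm_sq_le_mult:
  assumes "norm x * norm x \<le> K * norm x" "0 \<le> K"
  shows "norm x \<le> K"
  using assms by (cases "x = 0") auto

subsection \<open>The Riesz representation theorem and the Lax--Milgram theorem\<close>

definition quadratic_functional :: "('a::real_inner \<Rightarrow> real) \<Rightarrow> 'a \<Rightarrow> real" where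
  "quadratic_functional f x = x \<bullet> x - 2 * f x"

lemma quadratic_functional_parallelogram:
  assumes "subspace V" "linear_form_on V f" "x \<in> V" "y \<in> V"
  shows "(norm (x - y))\<^sup>2 = 2 * quadratic_functional f x + 2 * quadratic_functional f y
    - 4 * quadratic_functional f (midpoint x y)"
proof -
  have "f (midpoint x y) = (f x + f y) / 2"
    using linear_form_on_scale[OF assms(2,1) subspace_add[OF assms(1,3,4)], of "1/2"]
      linear_form_onD[OF assms(2-4), of 1] by (simp add: midpoint_def)
  then show ?thesis
    unfolding quadratic_functional_def power2_norm_eq_inner
    by (simp add: midpoint_def inner_diff_left inner_diff_right inner_add_left inner_add_right
        inner_commute algebra_simps)
qed

lemma quadratic_functional_bounded_below:
  assumes "\<bar>f x\<bar> \<le> K * norm x"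
  shows "- K\<^sup>2 \<le> quadratic_functional f x"
proof -
  have "0 \<le> (norm x - K)\<^sup>2" by simp
  moreover have "f x \<le> K * norm x" using assms by linarith
  ultimately show ?thesis
    unfolding quadratic_functional_def
    by (simp add: power2_eq_square algebra_simps flip: power2_norm_eq_inner)
qed

lemma Cauchy_if_dist_sq_le:
  fixes X :: "nat \<Rightarrow> 'a::metric_space"
  assumes dist_sq: "\<And>i j. (dist (X i) (X j))\<^sup>2 \<le> \<epsilon> i + \<epsilon> j" and null: "\<epsilon> \<longlonglongrightarrow> 0"
  shows "Cauchy X"
proof (rule metric_CauchyI)
  fix e :: real assume "e > 0"
  then obtain N where N: "\<And>n. n \<ge> N \<Longrightarrow> \<epsilon> n < e\<^sup>2 / 2"
    using order_tendstoD(2)[OF null, of "e\<^sup>2 / 2"] by (auto simp: eventually_sequentially)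
  have "dist (X i) (X j) < e" if "i \<ge> N" "j \<ge> N" for i j
  proof (rule power_less_imp_less_base)
    show "(dist (X i) (X j))\<^sup>2 < e\<^sup>2" using dist_sq[of i j] N[OF that(1)] N[OF that(2)] by linarith
  qed (use \<open>e > 0\<close> in simp)
  then show "\<exists>N. \<forall>i\<ge>N. \<forall>j\<ge>N. dist (X i) (X j) < e" by blast
qed

lemma quadratic_functional_minimizing_sequence:
  fixes V :: "'a::{real_inner,banach} set"
  assumes V: "subspace V" and f: "linear_form_on V f"
    and bounded: "\<And>x. x \<in> V \<Longrightarrow> \<bar>f x\<bar> \<le> K * norm x"
  obtains X z m where "\<And>n. X n \<in> V" "X \<longlonglongrightarrow> z" "(\<lambda>n. quadratic_functional f (X n)) \<longlonglongrightarrow> m"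
    "\<And>x. x \<in> V \<Longrightarrow> m \<le> quadratic_functional f x"
proof -
  let ?q = "quadratic_functional f"
  define m where "m = Inf (?q ` V)"
  have "bdd_below (?q ` V)"
    using quadratic_functional_bounded_below[of f _ K, OF bounded] by (intro bdd_belowI2)
  then have m_le: "m \<le> ?q x" if "x \<in> V" for x unfolding m_def using that by (intro cInf_lower) auto
  have "\<exists>x\<in>V. ?q x < m + 1 / real (Suc n)" for n
    using cInf_lessD[of "?q ` V" "m + 1 / real (Suc n)"] subspace_0[OF V] by (auto simp: m_def)
  then obtain X where X_in: "\<And>n. X n \<in> V" and X_less: "\<And>n. ?q (X n) < m + 1 / real (Suc n)"
    by metis
  have q_limit: "(\<lambda>n. ?q (X n)) \<longlonglongrightarrow> m"
  proof (rule real_tendsto_sandwich)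
    show "\<forall>\<^sub>F n in sequentially. m \<le> ?q (X n)" using m_le[OF X_in] by simp
    show "\<forall>\<^sub>F n in sequentially. ?q (X n) \<le> m + 1 / real (Suc n)"
      using X_less by (intro always_eventually allI less_imp_le)
    show "(\<lambda>n. m + 1 / real (Suc n)) \<longlonglongrightarrow> m"
      using tendsto_add[OF tendsto_const LIMSEQ_Suc[OF lim_1_over_n], of m] by simp
  qed simp
  have "(dist (X i) (X j))\<^sup>2 \<le> 2 * (?q (X i) - m) + 2 * (?q (X j) - m)" for i j
  proof -
    have "midpoint (X i) (X j) \<in> V"
      unfolding midpoint_def using X_in V by (intro subspace_scale subspace_add) auto
    from m_le[OF this] show ?thesis
      unfolding dist_norm quadratic_functional_parallelogram[OF V f X_in X_in]
      by (simp add: right_diff_distrib)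
  qed
  moreover have "(\<lambda>n. 2 * (?q (X n) - m)) \<longlonglongrightarrow> 0"
    using tendsto_mult_right_zero[OF LIM_zero[OF q_limit]] .
  ultimately have "Cauchy X" by (rule Cauchy_if_dist_sq_le)
  then obtain z where "X \<longlonglongrightarrow> z" using Cauchy_convergent convergent_def by blast
  with X_in q_limit m_le show thesis by (intro that)
qed

lemma linear_coeff_zero_if_quadratic_nonneg:
  fixes a b :: real
  assumes nonneg: "\<And>t. 0 \<le> t * a + t * t * b" and b: "b > 0"
  shows "a = 0"
proof -
  have "0 \<le> (- a / (2 * b)) * a + (- a / (2 * b)) * (- a / (2 * b)) * b" by (rule nonneg)
  also have "\<dots> = - (a\<^sup>2 / (4 * b))" using b by (simp add: field_simps power2_eq_square)
  finally show ?thesis using b by (simp add: divide_le_0_iff)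
qed

text \<open>The representer is the limit of a minimising sequence of \<open>\<parallel>x\<parallel>\<^sup>2 - 2 f x\<close>; the parallelogram law
  makes such a sequence Cauchy.\<close>
theorem riesz_representation_dense:
  fixes V :: "'a::{real_inner,banach} set"
  assumes V: "subspace V" and f: "linear_form_on V f"
    and bounded: "\<And>x. x \<in> V \<Longrightarrow> \<bar>f x\<bar> \<le> K * norm x"
  obtains z where "z \<in> closure V" "\<And>x. x \<in> V \<Longrightarrow> f x = x \<bullet> z"
proof -
  let ?q = "quadratic_functional f"
  obtain X z m where X: "\<And>n. X n \<in> V" "X \<longlonglongrightarrow> z" "(\<lambda>n. ?q (X n)) \<longlonglongrightarrow> m"
    and m_le: "\<And>x. x \<in> V \<Longrightarrow> m \<le> ?q x"
    using quadratic_functional_minimizing_sequence[OF assms] by metis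
  have "f x = x \<bullet> z" if x: "x \<in> V" for x
  proof (cases "x = 0")
    case False
    have "0 \<le> t * (2 * (x \<bullet> z - f x)) + t * t * (x \<bullet> x)" for t
    proof -
      have "m \<le> ?q (X n) + 2 * t * (x \<bullet> X n - f x) + t * t * (x \<bullet> x)" for n
      proof -
        have "m \<le> ?q (X n + t *\<^sub>R x)" using m_le x X(1) V by (meson subspace_add subspace_scale)
        then show ?thesis
          unfolding quadratic_functional_def linear_form_onD[OF f X(1) x]
          by (simp add: inner_add_left inner_add_right inner_commute algebra_simps)
      qed
      moreover have "(\<lambda>n. ?q (X n) + 2 * t * (x \<bullet> X n - f x) + t * t * (x \<bullet> x))
          \<longlonglongrightarrow> m + 2 * t * (x \<bullet> z - f x) + t * t * (x \<bullet> x)"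
        by (intro tendsto_intros X)
      ultimately have "m \<le> m + 2 * t * (x \<bullet> z - f x) + t * t * (x \<bullet> x)"
        using LIMSEQ_le_const by blast
      then show ?thesis by (simp add: algebra_simps)
    qed
    from linear_coeff_zero_if_quadratic_nonneg[OF this] False show ?thesis by simp
  qed (use linear_form_on_zero[OF f V] in simp)
  moreover have "z \<in> closure V" unfolding closure_sequential using X by blast
  ultimately show thesis using that by blast
qed

corollary riesz_representation_on:
  fixes V :: "'a::{real_inner,banach} set"
  assumes V: "subspace V" "closed V" and f: "linear_form_on V f"
    and bounded: "\<And>x. x \<in> V \<Longrightarrow> \<bar>f x\<bar> \<le> K * norm x"
  obtains z where "z \<in> V" "\<And>x. x \<in> V \<Longrightarrow> f x = x \<bullet> z"
proof (rule riesz_representation_dense[OF V(1) f bounded])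
  fix z assume "z \<in> closure V" "\<And>x. x \<in> V \<Longrightarrow> f x = x \<bullet> z"
  then show thesis using closure_closed[OF V(2)] by (intro that) auto
qed

lemma subspace_image_of_function_space:
  fixes E :: "('a \<Rightarrow> real) \<Rightarrow> 'b::real_vector"
  assumes nonempty: "P \<phi>\<^sub>0"
    and P_add: "\<And>\<phi> \<psi> c. P \<phi> \<Longrightarrow> P \<psi> \<Longrightarrow> P (\<lambda>x. \<phi> x + c * \<psi> x)"
    and E_add: "\<And>\<phi> \<psi> c. P \<phi> \<Longrightarrow> P \<psi> \<Longrightarrow> E (\<lambda>x. \<phi> x + c * \<psi> x) = E \<phi> + c *\<^sub>R E \<psi>"
  shows "subspace (E ` Collect P)"
proof -
  let ?S = "E ` Collect P"
  have add_in: "E \<phi> + c *\<^sub>R E \<psi> \<in> ?S" if "P \<phi>" "P \<psi>" for \<phi> \<psi> c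
    using P_add[OF that, of c] by (auto simp flip: E_add[OF that])
  have zero_in: "0 \<in> ?S" using add_in[OF nonempty nonempty, of "-1"] by simp
  then obtain \<phi>\<^sub>1 where zero: "P \<phi>\<^sub>1" "E \<phi>\<^sub>1 = 0" by auto
  show ?thesis
  proof (rule subspaceI[OF zero_in])
    show "x + y \<in> ?S" if "x \<in> ?S" "y \<in> ?S" for x y using that add_in[of _ _ 1] by auto
    show "c *\<^sub>R x \<in> ?S" if "x \<in> ?S" for x c using that add_in[OF zero(1), of _ c] zero(2) by auto
  qed
qed

text \<open>The functionals to be represented, on test functions or on \<open>H\<^sup>1\<^sub>0\<close>, act on functions and not on
  classes modulo null sets; their boundedness makes them descend to the image of \<open>E\<close>.\<close>
lemma riesz_representation_of_function_space:
  fixes E :: "('a \<Rightarrow> real) \<Rightarrow> 'b::{real_inner,banach}"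
  assumes nonempty: "P \<phi>\<^sub>0"
    and P_add: "\<And>\<phi> \<psi> c. P \<phi> \<Longrightarrow> P \<psi> \<Longrightarrow> P (\<lambda>x. \<phi> x + c * \<psi> x)"
    and E_add: "\<And>\<phi> \<psi> c. P \<phi> \<Longrightarrow> P \<psi> \<Longrightarrow> E (\<lambda>x. \<phi> x + c * \<psi> x) = E \<phi> + c *\<^sub>R E \<psi>"
    and F_add: "\<And>\<phi> \<psi> c. P \<phi> \<Longrightarrow> P \<psi> \<Longrightarrow> F (\<lambda>x. \<phi> x + c * \<psi> x) = F \<phi> + c * F \<psi>"
    and bounded: "\<And>\<phi>. P \<phi> \<Longrightarrow> \<bar>F \<phi>\<bar> \<le> K * norm (E \<phi>)"
  shows "\<exists>z\<in>closure (E ` Collect P). \<forall>\<phi>. P \<phi> \<longrightarrow> F \<phi> = E \<phi> \<bullet> z"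
proof -
  let ?S = "E ` Collect P"
  have subspace: "subspace ?S"
    using nonempty P_add E_add by (rule subspace_image_of_function_space[of P \<phi>\<^sub>0 E])
  have F_cong: "F \<phi> = F \<psi>" if "P \<phi>" "P \<psi>" "E \<phi> = E \<psi>" for \<phi> \<psi>
    using bounded[OF P_add[OF that(1,2), of "-1"]] E_add[OF that(1,2), of "-1"]
      F_add[OF that(1,2), of "-1"] that(3) by simp
  define f where "f x = F (SOME \<phi>. P \<phi> \<and> E \<phi> = x)" for x
  have f_E: "f (E \<phi>) = F \<phi>" if "P \<phi>" for \<phi>
    unfolding f_def using someI[of "\<lambda>\<psi>. P \<psi> \<and> E \<psi> = E \<phi>" \<phi>] that by (intro F_cong) auto
  have "linear_form_on ?S f"
  proof (rule linear_form_onI)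
    fix x y c assume "x \<in> ?S" "y \<in> ?S"
    then obtain \<phi> \<psi> where "P \<phi>" "x = E \<phi>" "P \<psi>" "y = E \<psi>" by blast
    then show "f (x + c *\<^sub>R y) = f x + c * f y"
      using f_E[OF P_add[of \<phi> \<psi> c]] by (simp add: f_E E_add F_add)
  qed
  moreover have "\<bar>f x\<bar> \<le> K * norm x" if "x \<in> ?S" for x using that bounded f_E by auto
  ultimately obtain z where "z \<in> closure ?S" "\<And>x. x \<in> ?S \<Longrightarrow> f x = x \<bullet> z"
    using riesz_representation_dense[OF subspace] by metis
  then show "\<exists>z\<in>closure ?S. \<forall>\<phi>. P \<phi> \<longrightarrow> F \<phi> = E \<phi> \<bullet> z" using f_E by fastforce
qed

lemma orthogonal_projection_on:
  fixes V :: "'a::{real_inner,banach} set"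
  assumes "subspace V" "closed V"
  obtains z where "z \<in> V" "\<And>x. x \<in> V \<Longrightarrow> x \<bullet> y = x \<bullet> z"
proof -
  have "\<bar>x \<bullet> y\<bar> \<le> norm y * norm x" for x
    using Cauchy_Schwarz_ineq2[of x y] by (simp add: mult.commute)
  from riesz_representation_on[OF assms linear_form_on_inner_left this] that show thesis by metis
qed

lemma coercive_operator_surj_on:
  fixes A :: "'a::{real_inner,banach} \<Rightarrow> 'a"
  assumes V: "subspace V" "closed V" and A_in: "\<And>u. u \<in> V \<Longrightarrow> A u \<in> V"
    and A_diff: "\<And>u w. u \<in> V \<Longrightarrow> w \<in> V \<Longrightarrow> A u - A w = A (u - w)"
    and A_bounded: "\<And>u. u \<in> V \<Longrightarrow> norm (A u) \<le> M * norm u" and "M > 0"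
    and A_coercive: "\<And>u. u \<in> V \<Longrightarrow> c * (norm u)\<^sup>2 \<le> u \<bullet> A u" and c: "0 < c" "c \<le> M"
    and F: "F \<in> V"
  obtains u where "u \<in> V" "A u = F"
proof -
  define \<rho> where "\<rho> = c / M\<^sup>2"
  define k where "k = sqrt (1 - c\<^sup>2 / M\<^sup>2)"
  define \<Phi> where "\<Phi> u = u - \<rho> *\<^sub>R (A u - F)" for u
  have "c\<^sup>2 / M\<^sup>2 \<le> 1" "0 < c\<^sup>2 / M\<^sup>2" using c \<open>M > 0\<close> by (auto simp: divide_le_eq power_mono)
  then have k: "0 \<le> k" "k < 1" "k\<^sup>2 = 1 - c\<^sup>2 / M\<^sup>2" by (auto simp: k_def real_sqrt_lt_1_iff)
  have contraction: "dist (\<Phi> u) (\<Phi> w) \<le> k * dist u w" if "u \<in> V" "w \<in> V" for u w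
  proof -
    let ?d = "u - w"
    have d: "?d \<in> V" using that V(1) by (simp add: subspace_diff)
    have \<Phi>_diff: "\<Phi> u - \<Phi> w = ?d - \<rho> *\<^sub>R A ?d"
      unfolding \<Phi>_def A_diff[OF that, symmetric] by (simp add: scaleR_diff_right)
    have "(norm (\<Phi> u - \<Phi> w))\<^sup>2 = (norm ?d)\<^sup>2 - 2 * \<rho> * (?d \<bullet> A ?d) + \<rho>\<^sup>2 * (norm (A ?d))\<^sup>2"
      unfolding \<Phi>_diff power2_norm_eq_inner
      by (simp add: inner_diff_left inner_diff_right inner_commute power2_eq_square algebra_simps)
    also have "\<dots> \<le> (norm ?d)\<^sup>2 - 2 * \<rho> * (c * (norm ?d)\<^sup>2) + \<rho>\<^sup>2 * (M * norm ?d)\<^sup>2"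
      using A_coercive[OF d] A_bounded[OF d] c(1) \<open>M > 0\<close>
      by (intro add_mono diff_mono mult_left_mono power_mono) (auto simp: \<rho>_def)
    also have "\<dots> = (1 - c\<^sup>2 / M\<^sup>2) * (norm ?d)\<^sup>2"
      unfolding \<rho>_def using \<open>M > 0\<close> by (simp add: field_simps power2_eq_square)
    also have "\<dots> = (k * norm ?d)\<^sup>2" by (simp add: k power_mult_distrib)
    finally show ?thesis unfolding dist_norm by (rule power2_le_imp_le) (use k in auto)
  qed
  have "\<exists>!u\<in>V. \<Phi> u = u"
  proof (rule Banach_fix[OF _ _ k(1,2)])
    show "complete V" using V(2) by (simp add: complete_eq_closed)
    show "\<Phi> ` V \<subseteq> V" using A_in F V(1) by (auto simp: \<Phi>_def intro!: subspace_diff subspace_scale)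
  qed (use F contraction in auto)
  then obtain u where "u \<in> V" "\<Phi> u = u" by blast
  moreover have "\<rho> \<noteq> 0" using c \<open>M > 0\<close> by (auto simp: \<rho>_def)
  ultimately show thesis using that by (simp add: \<Phi>_def)
qed

theorem lax_milgram_on:
  fixes V :: "'a::{real_inner,banach} set"
  assumes V: "subspace V" "closed V"
    and linear_left: "\<And>v. v \<in> V \<Longrightarrow> linear_form_on V (\<lambda>u. a u v)"
    and linear_right: "\<And>u. u \<in> V \<Longrightarrow> linear_form_on V (a u)"
    and bounded: "\<And>u v. u \<in> V \<Longrightarrow> v \<in> V \<Longrightarrow> \<bar>a u v\<bar> \<le> K * norm u * norm v"
    and coercive: "\<And>u. u \<in> V \<Longrightarrow> c * (norm u)\<^sup>2 \<le> a u u" "c > 0"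
    and f: "linear_form_on V f" "\<And>x. x \<in> V \<Longrightarrow> \<bar>f x\<bar> \<le> L * norm x"
  obtains u where "u \<in> V" "\<And>v. v \<in> V \<Longrightarrow> a u v = f v"
proof -
  have "\<exists>z\<in>V. \<forall>v\<in>V. a u v = v \<bullet> z" if "u \<in> V" for u
    by (rule riesz_representation_on[OF V linear_right[OF that] bounded[OF that]]) auto
  then obtain A where A_in: "\<And>u. u \<in> V \<Longrightarrow> A u \<in> V"
    and A: "\<And>u v. u \<in> V \<Longrightarrow> v \<in> V \<Longrightarrow> a u v = v \<bullet> A u" by metis
  obtain F where F: "F \<in> V" "\<And>v. v \<in> V \<Longrightarrow> f v = v \<bullet> F" using riesz_representation_on[OF V f] by metis
  define M where "M = max K c"
  have M: "M > 0" "K \<le> M" "c \<le> M" using coercive(2) by (auto simp: M_def)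
  have A_diff: "A u - A w = A (u - w)" if uw: "u \<in> V" "w \<in> V" for u w
  proof -
    let ?d = "A u - A w - A (u - w)"
    have d: "?d \<in> V" "u - w \<in> V" using A_in uw V(1) by (simp_all add: subspace_diff)
    have "?d \<bullet> ?d = a u ?d - a w ?d - a (u - w) ?d"
      using uw d A by (simp add: inner_diff_right)
    also have "\<dots> = 0" using linear_form_on_diff[OF linear_left[OF d(1)] uw] by simp
    finally show ?thesis by simp
  qed
  have A_bounded: "norm (A u) \<le> M * norm u" if u: "u \<in> V" for u
  proof (rule norm_le_if_norm_sq_le_mult)
    have "norm (A u) * norm (A u) = a u (A u)"
      using A[OF u A_in[OF u]] by (simp add: power2_norm_eq_inner flip: power2_eq_square)
    also have "\<dots> \<le> K * norm u * norm (A u)" using bounded[OF u A_in[OF u]] by linarith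
    also have "\<dots> \<le> (M * norm u) * norm (A u)" using M by (intro mult_right_mono) auto
    finally show "norm (A u) * norm (A u) \<le> (M * norm u) * norm (A u)" .
  qed (use M in simp)
  have A_coercive: "c * (norm u)\<^sup>2 \<le> u \<bullet> A u" if "u \<in> V" for u
    using coercive(1)[OF that] A[OF that that] by simp
  show thesis
  proof (rule coercive_operator_surj_on[OF V A_in A_diff A_bounded M(1) A_coercive coercive(2) M(3) F(1)])
    fix u assume "u \<in> V" "A u = F"
    then show thesis using A F(2) by (intro that) auto
  qed
qed

subsection \<open>Total sets and weak convergence\<close>

definition total_in :: "'a::real_inner set \<Rightarrow> 'a set \<Rightarrow> bool" where
  "total_in V D \<longleftrightarrow> D \<subseteq> V \<and> (\<forall>x\<in>V. (\<forall>y\<in>D. x \<bullet> y = 0) \<longrightarrow> x = 0)"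

definition weakly_tendsto :: "(nat \<Rightarrow> 'a::real_inner) \<Rightarrow> 'a \<Rightarrow> bool" where
  "weakly_tendsto x z \<longleftrightarrow> (\<forall>y. (\<lambda>n. x n \<bullet> y) \<longlonglongrightarrow> z \<bullet> y)"

lemma weakly_tendstoD: "weakly_tendsto x z \<Longrightarrow> (\<lambda>n. x n \<bullet> y) \<longlonglongrightarrow> z \<bullet> y"
  by (simp add: weakly_tendsto_def)

lemma total_in_closure:
  fixes S :: "'a::real_inner set"
  shows "total_in (closure S) S"
  unfolding total_in_def
proof (intro conjI ballI impI)
  fix x assume x: "x \<in> closure S" and "\<forall>y\<in>S. x \<bullet> y = 0"
  then have "closure S \<subseteq> {y. x \<bullet> y = 0}" by (intro closure_minimal closed_hyperplane) auto
  with x show "x = 0" by auto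
qed (rule closure_subset)

lemma eq_if_inner_eq_on_total:
  assumes "subspace V" "total_in V D" "u \<in> V" "v \<in> V" "\<And>y. y \<in> D \<Longrightarrow> u \<bullet> y = v \<bullet> y"
  shows "u = v"
  using assms subspace_diff[of V u v] unfolding total_in_def
  by (metis eq_iff_diff_eq_0 inner_diff_left)

lemma subset_if_total_in:
  fixes V :: "'a::{real_inner,banach} set"
  assumes V: "subspace V" "closed V" and D: "total_in V D"
    and W: "subspace W" "closed W" and "D \<subseteq> W"
  shows "V \<subseteq> W"
proof
  fix y assume y: "y \<in> V"
  obtain p where p: "p \<in> V \<inter> W" "\<And>x. x \<in> V \<inter> W \<Longrightarrow> x \<bullet> y = x \<bullet> p"
    using orthogonal_projection_on[of "V \<inter> W"] V W by (metis closed_Int subspace_inter)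
  have "D \<subseteq> V \<inter> W" using D \<open>D \<subseteq> W\<close> by (simp add: total_in_def)
  then have "y = p" using p y by (intro eq_if_inner_eq_on_total[OF V(1) D]) (auto simp: inner_commute)
  then show "y \<in> W" using p by simp
qed

lemma convergent_if_approximable:
  fixes h :: "nat \<Rightarrow> 'a::complete_space"
  assumes "\<And>e. e > 0 \<Longrightarrow> \<exists>f. convergent f \<and> (\<forall>\<^sub>F n in sequentially. dist (h n) (f n) < e)"
  shows "convergent h"
proof -
  have "Cauchy h"
  proof (rule metric_CauchyI)
    fix e :: real assume "e > 0"
    then obtain f where "convergent f" and near: "\<forall>\<^sub>F n in sequentially. dist (h n) (f n) < e / 3"
      using assms[of "e / 3"] by auto
    then have "Cauchy f" using convergent_Cauchy by blast
    then obtain M where M: "\<And>m n. m \<ge> M \<Longrightarrow> n \<ge> M \<Longrightarrow> dist (f m) (f n) < e / 3"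
      using metric_CauchyD[of f "e / 3"] \<open>e > 0\<close> by auto
    obtain N where N: "\<And>n. n \<ge> N \<Longrightarrow> dist (h n) (f n) < e / 3"
      using near by (auto simp: eventually_sequentially)
    have "dist (h m) (h n) < e" if "m \<ge> max M N" "n \<ge> max M N" for m n
      using dist_triangle_third[of "h m" "f m" e "f n" "h n"] M[of m n] N[of m] N[of n] that
      by (auto simp: dist_commute)
    then show "\<exists>N. \<forall>m\<ge>N. \<forall>n\<ge>N. dist (h m) (h n) < e" by blast
  qed
  then show ?thesis by (rule Cauchy_convergent)
qed

lemma convergent_at_limit_of_equicontinuous:
  fixes f \<theta> :: "nat \<Rightarrow> real \<Rightarrow> real"
  assumes increment: "\<And>n s t. s \<in> I \<Longrightarrow> t \<in> I \<Longrightarrow> \<bar>f n t - f n s\<bar> \<le> \<bar>\<theta> n t - \<theta> n s\<bar>"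
    and \<theta>_limit: "\<And>t. t \<in> I \<Longrightarrow> (\<lambda>n. \<theta> n t) \<longlonglongrightarrow> \<theta>' t" and \<theta>'_cont: "continuous_on I \<theta>'"
    and dense: "S \<subseteq> I" "I \<subseteq> closure S" and conv: "\<And>s. s \<in> S \<Longrightarrow> convergent (\<lambda>n. f n s)"
    and t: "t \<in> I"
  shows "convergent (\<lambda>n. f n t)"
proof (rule convergent_if_approximable)
  fix e :: real assume "e > 0"
  then obtain d where d: "d > 0" "\<And>s. s \<in> I \<Longrightarrow> dist s t < d \<Longrightarrow> dist (\<theta>' s) (\<theta>' t) < e"
    using \<theta>'_cont t unfolding continuous_on_iff by metis
  obtain s where s: "s \<in> S" "dist s t < d" using dense(2) t d(1) by (metis closure_approachable subsetD)
  then have s_in: "s \<in> I" using dense(1) by blast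
  have "(\<lambda>n. \<bar>\<theta> n t - \<theta> n s\<bar>) \<longlonglongrightarrow> \<bar>\<theta>' t - \<theta>' s\<bar>" by (intro tendsto_intros \<theta>_limit s_in t)
  moreover have "\<bar>\<theta>' t - \<theta>' s\<bar> < e" using d(2)[OF s_in s(2)] by (simp add: dist_real_def abs_minus_commute)
  ultimately have "\<forall>\<^sub>F n in sequentially. \<bar>\<theta> n t - \<theta> n s\<bar> < e" by (rule order_tendstoD)
  then have "\<forall>\<^sub>F n in sequentially. dist (f n t) (f n s) < e"
    by eventually_elim (use increment[OF s_in t] in \<open>auto simp: dist_real_def intro: le_less_trans\<close>)
  with conv[OF s(1)] show "\<exists>h. convergent h \<and> (\<forall>\<^sub>F n in sequentially. dist (f n t) (h n) < e)" by blast
qed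

lemma uniform_limit_inner_right:
  fixes x :: "'i \<Rightarrow> 'a::real_inner"
  assumes bounded: "\<And>i. i \<in> I \<Longrightarrow> norm (x i) \<le> K" and Y: "(Y \<longlongrightarrow> l) F"
  shows "uniform_limit I (\<lambda>n i. x i \<bullet> Y n) (\<lambda>i. x i \<bullet> l) F"
proof (rule uniform_limitI)
  fix e :: real assume "e > 0"
  have "((\<lambda>n. \<bar>K\<bar> * norm (Y n - l)) \<longlongrightarrow> 0) F"
    using tendsto_mult_right_zero[OF tendsto_norm_zero[OF LIM_zero[OF Y]]] .
  from order_tendstoD(2)[OF this \<open>e > 0\<close>]
  show "\<forall>\<^sub>F n in F. \<forall>i\<in>I. dist (x i \<bullet> Y n) (x i \<bullet> l) < e"
  proof eventually_elim
    case (elim n)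
    have "\<bar>x i \<bullet> (Y n - l)\<bar> \<le> \<bar>K\<bar> * norm (Y n - l)" if "i \<in> I" for i
      using bounded[OF that] by (intro order_trans[OF Cauchy_Schwarz_ineq2] mult_right_mono) auto
    with elim show ?case by (auto simp: dist_real_def inner_diff_right intro: le_less_trans)
  qed
qed

lemma convergent_inner_closed_subspace:
  fixes x :: "nat \<Rightarrow> 'a::real_inner"
  assumes bounded: "\<And>n. norm (x n) \<le> K"
  shows "subspace {y. convergent (\<lambda>n. x n \<bullet> y)}" "closed {y. convergent (\<lambda>n. x n \<bullet> y)}"
proof -
  show "subspace {y. convergent (\<lambda>n. x n \<bullet> y)}"
    by (intro subspaceI)
      (auto simp: inner_add_right convergent_const intro: convergent_add convergent_mult)
  show "closed {y. convergent (\<lambda>n. x n \<bullet> y)}"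
    unfolding closed_sequential_limits
  proof (intro allI impI, elim conjE)
    fix Y l assume Y: "\<forall>m. Y m \<in> {y. convergent (\<lambda>n. x n \<bullet> y)}" "Y \<longlonglongrightarrow> l"
    have "convergent (\<lambda>n. x n \<bullet> l)"
    proof (rule convergent_if_approximable)
      fix e :: real assume "e > 0"
      from uniform_limitD[OF uniform_limit_inner_right[of UNIV x K, OF bounded Y(2)] this]
      obtain m where "\<forall>n. dist (x n \<bullet> Y m) (x n \<bullet> l) < e"
        unfolding eventually_sequentially by blast
      then show "\<exists>f. convergent f \<and> (\<forall>\<^sub>F n in sequentially. dist (x n \<bullet> l) (f n) < e)"
        using Y(1) by (intro exI[of _ "\<lambda>n. x n \<bullet> Y m"]) (auto simp: dist_commute)
    qed
    then show "l \<in> {y. convergent (\<lambda>n. x n \<bullet> y)}" by simp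
  qed
qed

lemma continuous_inner_closed_subspace:
  fixes x :: "'i::topological_space \<Rightarrow> 'a::real_inner"
  assumes bounded: "\<And>t. t \<in> I \<Longrightarrow> norm (x t) \<le> K"
  shows "subspace {y. continuous_on I (\<lambda>t. x t \<bullet> y)}" "closed {y. continuous_on I (\<lambda>t. x t \<bullet> y)}"
proof -
  show "subspace {y. continuous_on I (\<lambda>t. x t \<bullet> y)}"
    by (intro subspaceI) (auto simp: inner_add_right intro: continuous_intros)
  show "closed {y. continuous_on I (\<lambda>t. x t \<bullet> y)}"
    unfolding closed_sequential_limits
  proof (intro allI impI, elim conjE)
    fix Y l assume Y: "\<forall>m. Y m \<in> {y. continuous_on I (\<lambda>t. x t \<bullet> y)}" "Y \<longlonglongrightarrow> l"
    have "continuous_on I (\<lambda>t. x t \<bullet> l)"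
      by (rule uniform_limit_theorem[OF _ uniform_limit_inner_right[OF bounded Y(2)]]) (use Y(1) in auto)
    then show "l \<in> {y. continuous_on I (\<lambda>t. x t \<bullet> y)}" by simp
  qed
qed

lemma weakly_continuous_if_continuous_on_total:
  fixes x :: "'i::topological_space \<Rightarrow> 'a::{real_inner,banach}"
  assumes V: "subspace V" "closed V" and D: "total_in V D"
    and x: "\<And>t. t \<in> I \<Longrightarrow> x t \<in> V" "\<And>t. t \<in> I \<Longrightarrow> norm (x t) \<le> K"
    and cont: "\<And>y. y \<in> D \<Longrightarrow> continuous_on I (\<lambda>t. x t \<bullet> y)"
  shows "continuous_on I (\<lambda>t. x t \<bullet> y)"
proof -
  have V_subset: "V \<subseteq> {y. continuous_on I (\<lambda>t. x t \<bullet> y)}"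
    using cont by (intro subset_if_total_in[OF V D continuous_inner_closed_subspace[OF x(2)]]) auto
  obtain p where "p \<in> V" "\<And>x. x \<in> V \<Longrightarrow> x \<bullet> y = x \<bullet> p" using orthogonal_projection_on[OF V] by metis
  then show ?thesis using V_subset x(1) by (auto cong: continuous_on_cong)
qed

lemma weakly_convergent_if_inner_convergent:
  fixes x :: "nat \<Rightarrow> 'a::{real_inner,banach}"
  assumes V: "subspace V" "closed V" and x: "\<And>n. x n \<in> V" "\<And>n. norm (x n) \<le> K"
    and conv: "\<And>y. y \<in> V \<Longrightarrow> convergent (\<lambda>n. x n \<bullet> y)"
  obtains z where "z \<in> V" "norm z \<le> K" "weakly_tendsto x z"
proof -
  define f where "f y = lim (\<lambda>n. x n \<bullet> y)" for y
  have f_limit: "(\<lambda>n. x n \<bullet> y) \<longlonglongrightarrow> f y" if "y \<in> V" for y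
    using conv[OF that] by (simp add: f_def convergent_LIMSEQ_iff)
  have f_bounded: "\<bar>f y\<bar> \<le> K * norm y" if "y \<in> V" for y
  proof (rule tendsto_upperbound[OF tendsto_rabs[OF f_limit[OF that]]])
    show "\<forall>\<^sub>F n in sequentially. \<bar>x n \<bullet> y\<bar> \<le> K * norm y"
      using x(2)
      by (intro always_eventually allI order_trans[OF Cauchy_Schwarz_ineq2] mult_right_mono) auto
  qed simp
  have "linear_form_on V f"
  proof (rule linear_form_onI)
    fix y w c assume yw: "y \<in> V" "w \<in> V"
    have "(\<lambda>n. x n \<bullet> (y + c *\<^sub>R w)) \<longlonglongrightarrow> f y + c * f w"
      unfolding inner_add_right inner_scaleR_right by (intro tendsto_intros f_limit yw)
    then show "f (y + c *\<^sub>R w) = f y + c * f w"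
      using yw V(1) by (intro LIMSEQ_unique[OF f_limit]) (auto intro: subspace_add subspace_scale)
  qed
  then obtain z where z: "z \<in> V" "\<And>y. y \<in> V \<Longrightarrow> f y = y \<bullet> z"
    using riesz_representation_on[OF V _ f_bounded] by metis
  have "(\<lambda>n. x n \<bullet> y) \<longlonglongrightarrow> z \<bullet> y" for y
  proof -
    obtain p where p: "p \<in> V" "\<And>x. x \<in> V \<Longrightarrow> x \<bullet> y = x \<bullet> p" using orthogonal_projection_on[OF V] by metis
    then show ?thesis
      using f_limit[OF p(1)] p(2)[OF x(1)] p(2)[OF z(1)] z(2)[OF p(1)] by (simp add: inner_commute)
  qed
  moreover have "norm z \<le> K"
  proof (rule norm_le_if_norm_sq_le_mult)
    show "norm z * norm z \<le> K * norm z"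
      using f_bounded[OF z(1)] z by (simp add: power2_norm_eq_inner flip: power2_eq_square)
    show "0 \<le> K" using x(2) norm_ge_zero order_trans by blast
  qed
  ultimately show thesis using that z(1) by (simp add: weakly_tendsto_def)
qed

lemma weakly_convergent_if_convergent_on_total:
  fixes x :: "nat \<Rightarrow> 'a::{real_inner,banach}"
  assumes V: "subspace V" "closed V" and D: "total_in V D"
    and x: "\<And>n. x n \<in> V" "\<And>n. norm (x n) \<le> K"
    and conv: "\<And>y. y \<in> D \<Longrightarrow> convergent (\<lambda>n. x n \<bullet> y)"
  obtains z where "z \<in> V" "norm z \<le> K" "weakly_tendsto x z"
proof -
  have "V \<subseteq> {y. convergent (\<lambda>n. x n \<bullet> y)}"
    using conv by (intro subset_if_total_in[OF V D convergent_inner_closed_subspace[OF x(2)]]) auto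
  then show thesis using weakly_convergent_if_inner_convergent[of V x K, OF V x] that by blast
qed

text \<open>A diagonal sequence makes the inner products with all members of the sequences converge; the
  closed span of the members is all that matters for weak convergence.\<close>
lemma weakly_Cauchy_subsequence_countable:
  fixes x :: "nat \<Rightarrow> 'i \<Rightarrow> 'a::{real_inner,banach}"
  assumes S: "countable S" and bounded: "\<And>n i. i \<in> S \<Longrightarrow> norm (x n i) \<le> K"
  obtains r where "strict_mono (r :: nat \<Rightarrow> nat)"
    "\<And>i y. i \<in> S \<Longrightarrow> convergent (\<lambda>n. x (r n) i \<bullet> y)"
proof -
  define D where "D = (\<lambda>(n, i). x n i) ` (UNIV \<times> S)"
  have "norm (x n i \<bullet> d) \<le> K * K" if "i \<in> S" "d \<in> D" for n i d
  proof -
    have "norm d \<le> K" using that bounded by (auto simp: D_def)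
    moreover have "norm (x n i) \<le> K" by (rule bounded[OF that(1)])
    ultimately show ?thesis unfolding real_norm_def
      by (intro order_trans[OF Cauchy_Schwarz_ineq2] mult_mono) (auto intro: order_trans[OF norm_ge_zero])
  qed
  then have "norm (case p of (i, d) \<Rightarrow> x n i \<bullet> d) \<le> K * K" if "p \<in> S \<times> D" for n p using that by auto
  moreover have "countable (S \<times> D)" using S by (auto simp: D_def)
  ultimately obtain r :: "nat \<Rightarrow> nat" where r: "strict_mono r"
    and inner_limits: "\<And>p. p \<in> S \<times> D \<Longrightarrow> \<exists>l. (\<lambda>n. case p of (i, d) \<Rightarrow> x (r n) i \<bullet> d) \<longlonglongrightarrow> l"
    using function_convergent_subsequence[of "S \<times> D" "\<lambda>n (i, d). x n i \<bullet> d" "K * K"] by metis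
  have "convergent (\<lambda>n. x (r n) i \<bullet> y)" if i: "i \<in> S" for i y
  proof -
    let ?Y = "{y. convergent (\<lambda>n. x (r n) i \<bullet> y)}"
    have "subspace ?Y" "closed ?Y"
      using convergent_inner_closed_subspace[of "\<lambda>n. x (r n) i" K] bounded[OF i] by auto
    then obtain p where p: "p \<in> ?Y" "\<And>x. x \<in> ?Y \<Longrightarrow> x \<bullet> y = x \<bullet> p" using orthogonal_projection_on by metis
    have "x (r n) i \<in> ?Y" for n using inner_limits[of "(i, x (r n) i)"] i by (auto simp: D_def convergent_def)
    then show ?thesis using p by simp
  qed
  with r show thesis using that by blast
qed

section \<open>The abstract Cauchy problem\<close>

lemma inner_abs_le_if_norm_le: "norm y \<le> K \<Longrightarrow> \<bar>x \<bullet> y\<bar> \<le> norm x * K"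
  by (rule order_trans[OF Cauchy_Schwarz_ineq2 mult_left_mono]) auto

lemma weighted_young:
  fixes x y \<alpha> M :: real
  assumes "\<alpha> > 0"
  shows "M * x * y \<le> \<alpha> / 2 * x\<^sup>2 + M\<^sup>2 / (2 * \<alpha>) * y\<^sup>2"
proof -
  have "0 \<le> (\<alpha> * x - M * y)\<^sup>2 / (2 * \<alpha>)" using assms by simp
  also have "\<dots> = \<alpha> / 2 * x\<^sup>2 + M\<^sup>2 / (2 * \<alpha>) * y\<^sup>2 - M * x * y"
    using assms by (simp add: field_simps power2_eq_square)
  finally show ?thesis by simp
qed

lemma le_one_plus_square: "x \<le> 1 + x\<^sup>2" for x :: real
  using zero_le_power2[of "x - 1/2"] by (simp add: power2_eq_square algebra_simps)

text \<open>\<open>V\<close> plays the role of \<open>H\<^sup>1\<^sub>0\<close>, \<open>\<iota>\<close> that of its embedding into \<open>L\<^sup>2\<close>. The operators act on the test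
  function: the forms are \<open>u \<bullet> B t \<phi>\<close> (principal part), \<open>u \<bullet> C t \<phi>\<close> (first order in space) and
  \<open>w \<bullet> D t \<phi>\<close> (the mixed derivative, with \<open>w\<close> the velocity), so that each of them passes to weak limits.\<close>
locale hyperbolic_system =
  fixes V :: "'x::{real_inner,banach} set" and \<iota> :: "'x \<Rightarrow> 'h::{real_inner,banach}"
    and B C :: "real \<Rightarrow> 'x \<Rightarrow> 'x" and D :: "real \<Rightarrow> 'x \<Rightarrow> 'h" and g :: "real \<Rightarrow> 'h"
    and T M \<alpha> :: real and u\<^sub>0 :: 'x and w\<^sub>0 :: 'h
  assumes T_pos: "T > 0" and M_nonneg: "M \<ge> 0" and \<alpha>_pos: "\<alpha> > 0"
    and subspace_V: "subspace V" and closed_V: "closed V"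
    and \<iota>_linear: "linear \<iota>" and \<iota>_norm: "\<And>x. norm (\<iota> x) \<le> norm x"
    and \<iota>_inj: "\<And>x. x \<in> V \<Longrightarrow> \<iota> x = 0 \<Longrightarrow> x = 0"
    and B_linear: "\<And>s x. s \<in> {0..T} \<Longrightarrow> linear_form_on V (\<lambda>y. x \<bullet> B s y)"
    and B_norm: "\<And>s y. s \<in> {0..T} \<Longrightarrow> y \<in> V \<Longrightarrow> norm (B s y) \<le> M * norm y"
    and B_sym: "\<And>s x y. s \<in> {0..T} \<Longrightarrow> x \<in> V \<Longrightarrow> y \<in> V \<Longrightarrow> x \<bullet> B s y = y \<bullet> B s x"
    and B_coercive: "\<And>s x. s \<in> {0..T} \<Longrightarrow> x \<in> V \<Longrightarrow> \<alpha> * (norm x)\<^sup>2 \<le> x \<bullet> B s x"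
    and B_lipschitz: "\<And>s r x y. s \<in> {0..T} \<Longrightarrow> r \<in> {0..T} \<Longrightarrow> x \<in> V \<Longrightarrow> y \<in> V \<Longrightarrow>
        \<bar>x \<bullet> B s y - x \<bullet> B r y\<bar> \<le> M * \<bar>s - r\<bar> * norm x * norm y"
    and C_linear: "\<And>s x. s \<in> {0..T} \<Longrightarrow> linear_form_on V (\<lambda>y. x \<bullet> C s y)"
    and C_norm: "\<And>s y. s \<in> {0..T} \<Longrightarrow> y \<in> V \<Longrightarrow> norm (C s y) \<le> M * norm (\<iota> y)"
    and C_measurable: "\<And>x y. x \<in> V \<Longrightarrow> y \<in> V \<Longrightarrow>
        (\<lambda>s. x \<bullet> C s y) \<in> borel_measurable (lebesgue_on {0..T})"
    and D_linear: "\<And>s h. s \<in> {0..T} \<Longrightarrow> linear_form_on V (\<lambda>y. h \<bullet> D s y)"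
    and D_norm: "\<And>s y. s \<in> {0..T} \<Longrightarrow> y \<in> V \<Longrightarrow> norm (D s y) \<le> M * norm y"
    and D_skew: "\<And>s y. s \<in> {0..T} \<Longrightarrow> y \<in> V \<Longrightarrow> - M * (norm (\<iota> y))\<^sup>2 \<le> \<iota> y \<bullet> D s y"
    and D_measurable: "\<And>x y. x \<in> V \<Longrightarrow> y \<in> V \<Longrightarrow>
        (\<lambda>s. \<iota> x \<bullet> D s y) \<in> borel_measurable (lebesgue_on {0..T})"
    and g_measurable: "\<And>y. y \<in> V \<Longrightarrow> (\<lambda>s. g s \<bullet> \<iota> y) \<in> borel_measurable (lebesgue_on {0..T})"
    and g_sq_integrable: "(\<lambda>s. (norm (g s))\<^sup>2) integrable_on {0..T}"
    and u\<^sub>0_in: "u\<^sub>0 \<in> V" and w\<^sub>0_in: "w\<^sub>0 \<in> closure (\<iota> ` V)"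
begin

subsection \<open>Bounds and integrability of the forms\<close>

lemma B_bound: "s \<in> {0..T} \<Longrightarrow> y \<in> V \<Longrightarrow> \<bar>x \<bullet> B s y\<bar> \<le> M * norm x * norm y"
  using inner_abs_le_if_norm_le[OF B_norm, of s y x] by (simp add: mult_ac)

lemma C_bound: "s \<in> {0..T} \<Longrightarrow> y \<in> V \<Longrightarrow> \<bar>x \<bullet> C s y\<bar> \<le> M * norm x * norm (\<iota> y)"
  using inner_abs_le_if_norm_le[OF C_norm, of s y x] by (simp add: mult_ac)

lemma C_bound_norm: "s \<in> {0..T} \<Longrightarrow> y \<in> V \<Longrightarrow> \<bar>x \<bullet> C s y\<bar> \<le> M * norm x * norm y"
  using C_bound[of s y x] mult_left_mono[OF \<iota>_norm[of y], of "M * norm x"] M_nonneg by simp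

lemma D_bound: "s \<in> {0..T} \<Longrightarrow> y \<in> V \<Longrightarrow> \<bar>h \<bullet> D s y\<bar> \<le> M * norm h * norm y"
  using inner_abs_le_if_norm_le[OF D_norm, of s y h] by (simp add: mult_ac)

lemma D_bound_norm: "s \<in> {0..T} \<Longrightarrow> y \<in> V \<Longrightarrow> \<bar>\<iota> x \<bullet> D s y\<bar> \<le> M * norm x * norm y"
  using D_bound[of s y "\<iota> x"] mult_left_mono[OF \<iota>_norm[of x], of "M * norm y"] M_nonneg
  by (simp add: mult_ac)

lemma inner_\<iota>_bound: "\<bar>h \<bullet> \<iota> y\<bar> \<le> norm h * norm y"
  by (rule inner_abs_le_if_norm_le[OF \<iota>_norm])

lemma source_bound: "\<bar>g s \<bullet> \<iota> y\<bar> \<le> (1 + (norm (g s))\<^sup>2) * norm y"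
  using inner_\<iota>_bound[of "g s" y] mult_right_mono[OF le_one_plus_square[of "norm (g s)"], of "norm y"]
  by simp

lemma source_sq_integrable: "0 \<le> a \<Longrightarrow> b \<le> T \<Longrightarrow> (\<lambda>s. (norm (g s))\<^sup>2) integrable_on {a..b}"
  by (rule integrable_on_subinterval[OF g_sq_integrable]) auto

lemma bounded_measurable_integrable_on:
  fixes f :: "real \<Rightarrow> real"
  assumes "f \<in> borel_measurable (lebesgue_on {0..T})" "k integrable_on {0..T}"
    and "\<And>s. s \<in> {0..T} \<Longrightarrow> \<bar>f s\<bar> \<le> k s" and "0 \<le> a" "b \<le> T"
  shows "f integrable_on {a..b}"
proof (rule integrable_on_subinterval)
  show "f integrable_on {0..T}"
    using assms by (intro measurable_bounded_by_integrable_imp_integrable[of f "{0..T}" k]) auto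
qed (use assms in auto)

context
  fixes a b :: real
  assumes ab: "0 \<le> a" "b \<le> T"
begin

lemma B_integrable:
  assumes "x \<in> V" "y \<in> V"
  shows "(\<lambda>s. x \<bullet> B s y) integrable_on {a..b}"
proof (intro integrable_continuous_interval lipschitz_on_continuous_on lipschitz_onI)
  show "dist (x \<bullet> B s y) (x \<bullet> B r y) \<le> (M * norm x * norm y) * dist s r"
    if "s \<in> {a..b}" "r \<in> {a..b}" for s r
    using B_lipschitz[of s r x y] assms ab that by (auto simp: dist_real_def mult_ac)
qed (use M_nonneg in simp)

lemma C_integrable: "x \<in> V \<Longrightarrow> y \<in> V \<Longrightarrow> (\<lambda>s. x \<bullet> C s y) integrable_on {a..b}"
  by (rule bounded_measurable_integrable_on[OF C_measurable integrable_const_ivl C_bound ab])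

lemma D_integrable: "x \<in> V \<Longrightarrow> y \<in> V \<Longrightarrow> (\<lambda>s. \<iota> x \<bullet> D s y) integrable_on {a..b}"
  by (rule bounded_measurable_integrable_on[OF D_measurable integrable_const_ivl D_bound ab])

lemma source_integrable: "y \<in> V \<Longrightarrow> (\<lambda>s. g s \<bullet> \<iota> y) integrable_on {a..b}"
  by (rule bounded_measurable_integrable_on[OF g_measurable _ source_bound ab])
    (auto intro!: integrable_on_mult_left integrable_add g_sq_integrable)

end

definition flux :: "'x \<Rightarrow> 'h \<Rightarrow> 'x \<Rightarrow> real \<Rightarrow> real" where
  "flux u w y s = u \<bullet> B s y + u \<bullet> C s y + w \<bullet> D s y - g s \<bullet> \<iota> y"

lemma flux_linear:
  assumes "s \<in> {0..T}"
  shows "linear_form_on V (\<lambda>y. flux u w y s)"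
proof -
  have "linear_form_on V (\<lambda>y. u \<bullet> B s y + u \<bullet> C s y + w \<bullet> D s y + (-1) * (g s \<bullet> \<iota> y))"
    using assms by (intro linear_form_on_plus linear_form_on_cmult B_linear C_linear D_linear
        linear_form_on_inner_linear(1)[OF \<iota>_linear])
  then show ?thesis by (simp add: flux_def)
qed

lemma flux_integrable:
  assumes "u \<in> V" "x \<in> V" "y \<in> V" "0 \<le> a" "b \<le> T"
  shows "flux u (\<iota> x) y integrable_on {a..b}"
  unfolding flux_def[abs_def] using assms
  by (intro integrable_add integrable_diff B_integrable C_integrable D_integrable source_integrable)

lemma flux_bound:
  assumes s: "s \<in> {0..T}" and y: "y \<in> V" and uw: "norm u \<le> K" "norm w \<le> K"
  shows "\<bar>flux u w y s\<bar> \<le> (3 * M * K + norm (g s)) * norm y"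
proof -
  have scale: "M * norm x * norm y \<le> M * K * norm y" if "norm x \<le> K" for x :: "'z::real_normed_vector"
    using that M_nonneg by (intro mult_right_mono mult_left_mono) auto
  have "\<bar>u \<bullet> B s y\<bar> \<le> M * K * norm y" "\<bar>u \<bullet> C s y\<bar> \<le> M * K * norm y" "\<bar>w \<bullet> D s y\<bar> \<le> M * K * norm y"
    using B_bound[OF s y, of u] C_bound_norm[OF s y, of u] D_bound[OF s y, of w] scale[OF uw(1)]
      scale[OF uw(2)]
    by linarith+
  then show ?thesis using inner_\<iota>_bound[of "g s" y] unfolding flux_def by (simp add: algebra_simps)
qed

subsection \<open>The implicit Euler step\<close>

text \<open>The time step from \<open>a\<close> to \<open>b\<close> leads from the state \<open>(p, w)\<close> to \<open>(u, v)\<close>; the rough coefficients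
  are averaged over the step.\<close>
definition euler_step :: "real \<Rightarrow> real \<Rightarrow> 'x \<Rightarrow> 'h \<Rightarrow> 'x \<Rightarrow> 'h \<Rightarrow> bool" where
  "euler_step a b p w u v \<longleftrightarrow> u \<in> V \<and> v = \<iota> ((u - p) /\<^sub>R (b - a))
    \<and> (\<forall>y\<in>V. (v - w) \<bullet> \<iota> y + integral {a..b} (flux u v y) = 0)"

definition gronwall_const :: real where
  "gronwall_const = 4 * M / \<alpha> + 3 * M + 1"

definition admissible_step :: "real \<Rightarrow> bool" where
  "admissible_step \<tau> \<longleftrightarrow> 0 < \<tau> \<and> \<tau> * M \<le> 1 / 2 \<and> \<tau> * \<tau> * M\<^sup>2 / (2 * \<alpha>) \<le> 1 / 2
  \<and> gronwall_const * \<tau> \<le> 1 / 2"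

text \<open>Elimination of the velocity turns an Euler step into the variational problem
  \<open>step_form a b u y = step_load a b p w y\<close> for the new position.\<close>
definition step_form :: "real \<Rightarrow> real \<Rightarrow> 'x \<Rightarrow> 'x \<Rightarrow> real" where
  "step_form a b u y = \<iota> u \<bullet> \<iota> y
  + (b - a) * integral {a..b} (\<lambda>s. u \<bullet> B s y + u \<bullet> C s y) + integral {a..b} (\<lambda>s. \<iota> u \<bullet> D s y)"

definition step_load :: "real \<Rightarrow> real \<Rightarrow> 'x \<Rightarrow> 'h \<Rightarrow> 'x \<Rightarrow> real" where
  "step_load a b p w y = (\<iota> p + (b - a) *\<^sub>R w) \<bullet> \<iota> y
  + (b - a) * integral {a..b} (\<lambda>s. g s \<bullet> \<iota> y) + integral {a..b} (\<lambda>s. \<iota> p \<bullet> D s y)"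

context
  fixes a b :: real
  assumes ab: "0 \<le> a" "a < b" "b \<le> T"
begin

lemma step_times: "s \<in> {a..b} \<Longrightarrow> s \<in> {0..T}"
  using ab by simp

lemma step_form_linear_left:
  assumes "y \<in> V"
  shows "linear_form_on V (\<lambda>u. step_form a b u y)"
  unfolding step_form_def using assms ab
  by (intro linear_form_on_plus linear_form_on_cmult linear_form_on_integral integrable_add
      B_integrable C_integrable D_integrable linear_form_on_inner_left
      linear_form_on_inner_linear(2)[OF \<iota>_linear]) auto

lemma step_form_linear_right:
  assumes "u \<in> V"
  shows "linear_form_on V (step_form a b u)"
  unfolding step_form_def[abs_def] using assms ab
  by (intro linear_form_on_plus linear_form_on_cmult linear_form_on_integral integrable_add
      B_integrable C_integrable D_integrable B_linear C_linear D_linear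
      linear_form_on_inner_linear(1)[OF \<iota>_linear]) auto

lemma step_load_linear:
  assumes "p \<in> V"
  shows "linear_form_on V (step_load a b p w)"
  unfolding step_load_def[abs_def] using assms ab
  by (intro linear_form_on_plus linear_form_on_cmult linear_form_on_integral D_integrable D_linear
      source_integrable linear_form_on_inner_linear(1)[OF \<iota>_linear]) auto

lemma integral_abs_le_const:
  fixes f :: "real \<Rightarrow> real"
  assumes "f integrable_on {a..b}" "\<And>s. s \<in> {a..b} \<Longrightarrow> \<bar>f s\<bar> \<le> K"
  shows "\<bar>integral {a..b} f\<bar> \<le> K * (b - a)"
proof -
  have "norm (integral {a..b} f) \<le> integral {a..b} (\<lambda>s. K)"
    using assms by (intro Henstock_Kurzweil_Integration.integral_norm_bound_integral) auto
  then show ?thesis using ab(2) by (simp add: mult.commute)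
qed

lemma integral_ge_const:
  fixes f :: "real \<Rightarrow> real"
  assumes "f integrable_on {a..b}" "\<And>s. s \<in> {a..b} \<Longrightarrow> K \<le> f s"
  shows "K * (b - a) \<le> integral {a..b} f"
  using integral_le[OF integrable_const_ivl assms] ab(2) by (simp add: mult.commute)

lemma step_form_bounded:
  assumes u: "u \<in> V" and y: "y \<in> V"
  shows "\<bar>step_form a b u y\<bar> \<le> (1 + 2 * M * (b - a)\<^sup>2 + M * (b - a)) * norm u * norm y"
proof -
  let ?m = "M * norm u * norm y"
  have "\<bar>\<iota> u \<bullet> \<iota> y\<bar> \<le> norm u * norm y"
    using inner_\<iota>_bound[of "\<iota> u" y] mult_right_mono[OF \<iota>_norm[of u] norm_ge_zero[of y]] by linarith
  moreover have "\<bar>integral {a..b} (\<lambda>s. u \<bullet> B s y + u \<bullet> C s y)\<bar> \<le> (2 * ?m) * (b - a)"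
  proof (rule integral_abs_le_const)
    fix s assume "s \<in> {a..b}"
    then show "\<bar>u \<bullet> B s y + u \<bullet> C s y\<bar> \<le> 2 * ?m"
      using B_bound[OF step_times y, of s u] C_bound_norm[OF step_times y, of s u] by linarith
  qed (use u y ab in \<open>auto intro!: integrable_add B_integrable C_integrable\<close>)
  then have "\<bar>(b - a) * integral {a..b} (\<lambda>s. u \<bullet> B s y + u \<bullet> C s y)\<bar> \<le> (b - a) * ((2 * ?m) * (b - a))"
    unfolding abs_mult using ab(2) by (intro mult_mono) auto
  moreover have "\<bar>integral {a..b} (\<lambda>s. \<iota> u \<bullet> D s y)\<bar> \<le> ?m * (b - a)"
    using u y ab by (intro integral_abs_le_const D_integrable D_bound_norm step_times) auto
  ultimately have "\<bar>step_form a b u y\<bar> \<le> norm u * norm y + (b - a) * ((2 * ?m) * (b - a)) + ?m * (b - a)"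
    unfolding step_form_def by linarith
  then show ?thesis by (simp add: algebra_simps power2_eq_square)
qed

lemma step_form_coercive:
  assumes admissible: "admissible_step (b - a)" and u: "u \<in> V"
  shows "(b - a)\<^sup>2 * \<alpha> / 2 * (norm u)\<^sup>2 \<le> step_form a b u u"
proof -
  define \<tau> where "\<tau> = b - a"
  let ?k = "\<alpha> * (norm u)\<^sup>2 - M * norm u * norm (\<iota> u)"
  have \<tau>: "\<tau> > 0" using ab by (simp add: \<tau>_def)
  have "?k * \<tau> \<le> integral {a..b} (\<lambda>s. u \<bullet> B s u + u \<bullet> C s u)"
    unfolding \<tau>_def
  proof (rule integral_ge_const)
    fix s assume "s \<in> {a..b}"
    then show "?k \<le> u \<bullet> B s u + u \<bullet> C s u"
      using B_coercive[OF step_times u, of s] C_bound[OF step_times u, of s u] by linarith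
  qed (use u ab in \<open>auto intro!: integrable_add B_integrable C_integrable\<close>)
  then have elliptic: "\<tau> * (?k * \<tau>) \<le> \<tau> * integral {a..b} (\<lambda>s. u \<bullet> B s u + u \<bullet> C s u)"
    using \<tau> by (intro mult_left_mono) auto
  have mixed: "(- M * (norm (\<iota> u))\<^sup>2) * \<tau> \<le> integral {a..b} (\<lambda>s. \<iota> u \<bullet> D s u)"
    unfolding \<tau>_def using u ab by (intro integral_ge_const D_integrable D_skew step_times) auto
  have "\<tau> * (\<tau> * (M * norm u * norm (\<iota> u)))
      \<le> \<tau> * (\<tau> * (\<alpha> / 2 * (norm u)\<^sup>2 + M\<^sup>2 / (2 * \<alpha>) * (norm (\<iota> u))\<^sup>2))"
    using \<tau> by (intro mult_left_mono weighted_young \<alpha>_pos) auto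
  moreover have "(\<tau> * M + \<tau> * \<tau> * M\<^sup>2 / (2 * \<alpha>)) * (norm (\<iota> u))\<^sup>2 \<le> 1 * (norm (\<iota> u))\<^sup>2"
    using admissible by (intro mult_right_mono) (auto simp: admissible_step_def \<tau>_def)
  ultimately show ?thesis
    using elliptic mixed unfolding step_form_def \<tau>_def[symmetric] power2_norm_eq_inner[symmetric]
    by (simp add: algebra_simps power2_eq_square)
qed

lemma step_load_bounded:
  assumes p: "p \<in> V"
  obtains K where "\<And>y. y \<in> V \<Longrightarrow> \<bar>step_load a b p w y\<bar> \<le> K * norm y"
proof (rule that)
  define m where "m = integral {a..b} (\<lambda>s. 1 + (norm (g s))\<^sup>2)"
  fix y assume y: "y \<in> V"
  have "(\<lambda>s. 1 + (norm (g s))\<^sup>2) integrable_on {a..b}"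
    using ab by (intro integrable_add source_sq_integrable) auto
  then have "norm (integral {a..b} (\<lambda>s. g s \<bullet> \<iota> y)) \<le> integral {a..b} (\<lambda>s. (1 + (norm (g s))\<^sup>2) * norm y)"
    using source_integrable[OF ab(1,3) y] source_bound
    by (intro Henstock_Kurzweil_Integration.integral_norm_bound_integral integrable_on_mult_left) auto
  then have "\<bar>(b - a) * integral {a..b} (\<lambda>s. g s \<bullet> \<iota> y)\<bar> \<le> (b - a) * (m * norm y)"
    unfolding abs_mult using ab(2) by (intro mult_mono) (auto simp: m_def)
  moreover have "\<bar>integral {a..b} (\<lambda>s. \<iota> p \<bullet> D s y)\<bar> \<le> M * norm p * norm y * (b - a)"
    using p y ab by (intro integral_abs_le_const D_integrable D_bound_norm step_times) auto
  ultimately have "\<bar>step_load a b p w y\<bar>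
      \<le> norm (\<iota> p + (b - a) *\<^sub>R w) * norm y + (b - a) * (m * norm y) + M * norm p * norm y * (b - a)"
    unfolding step_load_def using inner_\<iota>_bound[of "\<iota> p + (b - a) *\<^sub>R w" y] by linarith
  then show "\<bar>step_load a b p w y\<bar>
      \<le> (norm (\<iota> p + (b - a) *\<^sub>R w) + (b - a) * m + M * norm p * (b - a)) * norm y"
    by (simp add: algebra_simps)
qed

lemma step_residual:
  assumes p: "p \<in> V" and u: "u \<in> V" and y: "y \<in> V"
  defines "v \<equiv> (u - p) /\<^sub>R (b - a)"
  shows "(b - a) * ((\<iota> v - w) \<bullet> \<iota> y + integral {a..b} (flux u (\<iota> v) y))
    = step_form a b u y - step_load a b p w y"
proof -
  have v: "v \<in> V" using u p subspace_V by (simp add: v_def subspace_diff subspace_scale)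
  have "(b - a) *\<^sub>R \<iota> v = \<iota> u - \<iota> p"
    using ab(2) \<iota>_linear by (simp add: v_def linear_scale linear_diff)
  then have inner_v: "(b - a) * (\<iota> v \<bullet> h) = \<iota> u \<bullet> h - \<iota> p \<bullet> h" for h
    by (metis inner_diff_left inner_scaleR_left)
  have "integral {a..b} (flux u (\<iota> v) y) = integral {a..b} (\<lambda>s. u \<bullet> B s y + u \<bullet> C s y)
      + integral {a..b} (\<lambda>s. \<iota> v \<bullet> D s y) - integral {a..b} (\<lambda>s. g s \<bullet> \<iota> y)"
    unfolding flux_def[abs_def] using ab u v y
    by (simp add: Henstock_Kurzweil_Integration.integral_add Henstock_Kurzweil_Integration.integral_diff
        integrable_add B_integrable C_integrable D_integrable source_integrable)
  moreover have "(b - a) * integral {a..b} (\<lambda>s. \<iota> v \<bullet> D s y)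
      = integral {a..b} (\<lambda>s. \<iota> u \<bullet> D s y) - integral {a..b} (\<lambda>s. \<iota> p \<bullet> D s y)"
  proof -
    have "(b - a) * integral {a..b} (\<lambda>s. \<iota> v \<bullet> D s y) = integral {a..b} (\<lambda>s. (b - a) * (\<iota> v \<bullet> D s y))"
      by simp
    also have "\<dots> = integral {a..b} (\<lambda>s. \<iota> u \<bullet> D s y - \<iota> p \<bullet> D s y)" by (simp only: inner_v)
    also have "\<dots> = integral {a..b} (\<lambda>s. \<iota> u \<bullet> D s y) - integral {a..b} (\<lambda>s. \<iota> p \<bullet> D s y)"
      using D_integrable ab p u y by (intro Henstock_Kurzweil_Integration.integral_diff) auto
    finally show ?thesis .
  qed
  moreover have "(b - a) * ((\<iota> v - w) \<bullet> \<iota> y) = \<iota> u \<bullet> \<iota> y - \<iota> p \<bullet> \<iota> y - (b - a) * (w \<bullet> \<iota> y)"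
    using inner_v[of "\<iota> y"] by (simp add: inner_diff_left right_diff_distrib)
  ultimately show ?thesis
    by (simp add: step_form_def step_load_def distrib_left right_diff_distrib inner_add_left)
qed

lemma euler_step_exists:
  assumes admissible: "admissible_step (b - a)" and p: "p \<in> V"
  shows "\<exists>u v. euler_step a b p w u v"
proof -
  obtain K where load_bounded: "\<And>y. y \<in> V \<Longrightarrow> \<bar>step_load a b p w y\<bar> \<le> K * norm y"
    using step_load_bounded[OF p] by blast
  obtain u where u: "u \<in> V" "\<And>y. y \<in> V \<Longrightarrow> step_form a b u y = step_load a b p w y"
  proof (rule lax_milgram_on[OF subspace_V closed_V, of "step_form a b"])
    show "(b - a)\<^sup>2 * \<alpha> / 2 > 0" using ab(2) \<alpha>_pos by simp
  qed (rule step_form_linear_left step_form_linear_right step_form_bounded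
      step_form_coercive[OF admissible] step_load_linear[OF p] load_bounded that; assumption)+
  then have "euler_step a b p w u (\<iota> ((u - p) /\<^sub>R (b - a)))"
    using step_residual[OF p, of u _ w] ab(2) by (auto simp: euler_step_def)
  then show ?thesis by blast
qed

end

subsection \<open>The energy estimate\<close>

definition energy :: "real \<Rightarrow> 'x \<Rightarrow> 'h \<Rightarrow> real" where
  "energy t u w = (norm w)\<^sup>2 + u \<bullet> B t u"

lemma B_nonneg: "t \<in> {0..T} \<Longrightarrow> u \<in> V \<Longrightarrow> 0 \<le> u \<bullet> B t u"
  using B_coercive[of t u] \<alpha>_pos by (meson mult_nonneg_nonneg less_imp_le zero_le_power2 order_trans)

lemma energy_nonneg: "t \<in> {0..T} \<Longrightarrow> u \<in> V \<Longrightarrow> 0 \<le> energy t u w"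
  by (simp add: energy_def B_nonneg)

lemma norm_sq_le_energy:
  assumes "t \<in> {0..T}" "u \<in> V"
  shows "(norm w)\<^sup>2 \<le> energy t u w" "\<alpha> * (norm u)\<^sup>2 \<le> energy t u w"
  using B_nonneg[OF assms] B_coercive[OF assms] zero_le_power2[of "norm w"]
  unfolding energy_def by linarith+

lemma gronwall_const_ge_one: "1 \<le> gronwall_const"
proof -
  have "0 \<le> 4 * M / \<alpha>" using M_nonneg \<alpha>_pos by simp
  then show ?thesis unfolding gronwall_const_def using M_nonneg by linarith
qed

lemma step_errors_le_energy:
  assumes t: "s \<in> {0..T}" "t \<in> {0..T}" and pu: "p \<in> V" "u \<in> V"
  shows "4 * M * (norm u)\<^sup>2 + 2 * M * (norm p)\<^sup>2 + (3 * M + 1) * (norm v)\<^sup>2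
    \<le> gronwall_const * (energy t u v + energy s p w)"
proof -
  have norm_sq: "4 * M * (norm x)\<^sup>2 \<le> 4 * M / \<alpha> * (x \<bullet> B r x)" if "r \<in> {0..T}" "x \<in> V" for r x
  proof -
    have "4 * M / \<alpha> * (\<alpha> * (norm x)\<^sup>2) \<le> 4 * M / \<alpha> * (x \<bullet> B r x)"
      using M_nonneg \<alpha>_pos B_coercive[OF that] by (intro mult_left_mono) auto
    then show ?thesis using \<alpha>_pos by simp
  qed
  have "2 * M * (norm p)\<^sup>2 \<le> 4 * M * (norm p)\<^sup>2" using M_nonneg by (intro mult_right_mono) auto
  then have "4 * M * (norm u)\<^sup>2 + 2 * M * (norm p)\<^sup>2 + (3 * M + 1) * (norm v)\<^sup>2
      \<le> 4 * M / \<alpha> * (u \<bullet> B t u + p \<bullet> B s p) + (3 * M + 1) * (norm v)\<^sup>2"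
    using norm_sq[OF t(2) pu(2)] norm_sq[OF t(1) pu(1)] unfolding distrib_left by linarith
  also have "\<dots> \<le> gronwall_const * (u \<bullet> B t u + p \<bullet> B s p) + gronwall_const * ((norm v)\<^sup>2 + (norm w)\<^sup>2)"
    using B_nonneg t pu M_nonneg \<alpha>_pos by (intro add_mono mult_mono) (auto simp: gronwall_const_def)
  finally show ?thesis by (simp add: energy_def algebra_simps)
qed

lemma principal_part_increment:
  assumes times: "s \<in> {a..b}" "a \<in> {0..T}" "b \<in> {0..T}" and pu: "p \<in> V" "u \<in> V"
  shows "u \<bullet> B b u - p \<bullet> B a p - (b - a) * (3 * M * (norm u)\<^sup>2 + 2 * M * (norm p)\<^sup>2)
    \<le> 2 * (u \<bullet> B s (u - p))"
proof -
  define \<tau> where "\<tau> = b - a"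
  let ?d = "u - p"
  have s: "s \<in> {0..T}" "0 \<le> \<tau>" and d: "?d \<in> V"
    using times pu subspace_V by (auto simp: subspace_diff \<tau>_def)
  have "\<bar>u \<bullet> B s ?d - u \<bullet> B b ?d\<bar> \<le> M * \<bar>s - b\<bar> * norm u * norm ?d"
    by (rule B_lipschitz[OF s(1) times(3) pu(2) d])
  also have "\<dots> \<le> M * \<tau> * norm u * (norm u + norm p)"
    using M_nonneg times s by (intro mult_mono norm_triangle_ineq4) (auto simp: \<tau>_def)
  finally have time_change: "u \<bullet> B b ?d - M * \<tau> * norm u * (norm u + norm p) \<le> u \<bullet> B s ?d" by linarith
  have "0 \<le> ?d \<bullet> B b ?d" by (rule B_nonneg[OF times(3) d])
  then have square: "u \<bullet> B b u - p \<bullet> B b p \<le> 2 * (u \<bullet> B b ?d)"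
    using linear_form_on_diff[OF B_linear[OF times(3)] pu(2,1)] B_sym[OF times(3) pu]
    by (simp add: inner_diff_left)
  have "\<bar>p \<bullet> B b p - p \<bullet> B a p\<bar> \<le> M * \<bar>b - a\<bar> * norm p * norm p"
    by (rule B_lipschitz[OF times(3,2) pu(1) pu(1)])
  then have "p \<bullet> B b p \<le> p \<bullet> B a p + M * \<tau> * (norm p)\<^sup>2"
    using s(2) by (simp add: \<tau>_def power2_eq_square mult_ac)
  moreover have "M * \<tau> * (2 * (norm u * norm p)) \<le> M * \<tau> * ((norm u)\<^sup>2 + (norm p)\<^sup>2)"
    using M_nonneg s(2) sum_squares_bound[of "norm u" "norm p"]
    by (intro mult_left_mono) (auto simp: mult.assoc)
  ultimately show ?thesis
    using time_change square unfolding \<tau>_def[symmetric] by (simp add: algebra_simps power2_eq_square)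
qed

lemma lower_order_increment:
  assumes s: "s \<in> {0..T}" and u: "u \<in> V" and y: "y \<in> V" and "0 \<le> \<tau>"
  shows "- \<tau> * (M * (norm u)\<^sup>2 + (3 * M + 1) * (norm (\<iota> y))\<^sup>2 + (norm (g s))\<^sup>2)
    \<le> 2 * (u \<bullet> C s (\<tau> *\<^sub>R y) + \<iota> y \<bullet> D s (\<tau> *\<^sub>R y) - g s \<bullet> \<iota> (\<tau> *\<^sub>R y))"
proof -
  let ?v = "\<iota> y"
  have "M * (2 * (norm u * norm ?v)) \<le> M * ((norm u)\<^sup>2 + (norm ?v)\<^sup>2)"
    using M_nonneg sum_squares_bound[of "norm u" "norm ?v"]
    by (intro mult_left_mono) (auto simp: mult.assoc)
  then have "- (M * (norm u)\<^sup>2 + M * (norm ?v)\<^sup>2) \<le> 2 * (u \<bullet> C s y)"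
    using C_bound[OF s y, of u] by (simp add: algebra_simps)
  moreover have "2 * (g s \<bullet> ?v) \<le> (norm (g s))\<^sup>2 + (norm ?v)\<^sup>2"
    using norm_cauchy_schwarz[of "g s" ?v] sum_squares_bound[of "norm (g s)" "norm ?v"] by simp
  ultimately have "- (M * (norm u)\<^sup>2 + (3 * M + 1) * (norm ?v)\<^sup>2 + (norm (g s))\<^sup>2)
      \<le> 2 * (u \<bullet> C s y + ?v \<bullet> D s y - g s \<bullet> ?v)"
    using D_skew[OF s y] by (simp add: algebra_simps)
  from mult_left_mono[OF this \<open>0 \<le> \<tau>\<close>]
  have "- \<tau> * (M * (norm u)\<^sup>2 + (3 * M + 1) * (norm ?v)\<^sup>2 + (norm (g s))\<^sup>2)
      \<le> 2 * (\<tau> * (u \<bullet> C s y) + \<tau> * (?v \<bullet> D s y) - \<tau> * (g s \<bullet> ?v))" by (simp add: algebra_simps)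
  then show ?thesis
    using linear_form_on_scale[OF C_linear[OF s] subspace_V y, of u \<tau>]
      linear_form_on_scale[OF D_linear[OF s] subspace_V y, of ?v \<tau>]
    by (simp add: linear_scale[OF \<iota>_linear])
qed

lemma flux_increment_ge:
  assumes step: "euler_step a b p w u v" and p: "p \<in> V" and ab: "0 \<le> a" "a < b" "b \<le> T"
    and s: "s \<in> {a..b}"
  shows "u \<bullet> B b u - p \<bullet> B a p - (b - a) * (gronwall_const * (energy b u v + energy a p w) + (norm (g s))\<^sup>2)
    \<le> 2 * flux u v (u - p) s"
proof -
  define \<tau> where "\<tau> = b - a"
  define y where "y = (u - p) /\<^sub>R (b - a)"
  have u: "u \<in> V" and v: "v = \<iota> y" using step by (auto simp: euler_step_def y_def)
  have y: "y \<in> V" using p u subspace_V by (simp add: y_def subspace_diff subspace_scale)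
  have increment: "u - p = (b - a) *\<^sub>R y" using ab by (simp add: y_def)
  have times: "s \<in> {0..T}" "a \<in> {0..T}" "b \<in> {0..T}" "0 \<le> b - a" using s ab by auto
  have "(b - a) * (4 * M * (norm u)\<^sup>2 + 2 * M * (norm p)\<^sup>2 + (3 * M + 1) * (norm v)\<^sup>2)
      \<le> (b - a) * (gronwall_const * (energy b u v + energy a p w))"
    using times p u by (intro mult_left_mono step_errors_le_energy) auto
  moreover note principal_part_increment[OF s times(2,3) p u]
  moreover note lower_order_increment[OF times(1) u y times(4), folded increment v]
  ultimately show ?thesis
    unfolding flux_def \<tau>_def[symmetric] by (simp add: algebra_simps)
qed

lemma energy_step:
  assumes step: "euler_step a b p w u v" and p: "p \<in> V" and ab: "0 \<le> a" "a < b" "b \<le> T"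
  shows "energy b u v - energy a p w
    \<le> gronwall_const * (b - a) * (energy b u v + energy a p w) + integral {a..b} (\<lambda>s. (norm (g s))\<^sup>2)"
proof -
  define \<tau> where "\<tau> = b - a"
  let ?G = "integral {a..b} (\<lambda>s. (norm (g s))\<^sup>2)"
  define y where "y = (u - p) /\<^sub>R (b - a)"
  have u: "u \<in> V" and v: "v = \<iota> y"
    and step_equation: "\<And>x. x \<in> V \<Longrightarrow> (v - w) \<bullet> \<iota> x + integral {a..b} (flux u v x) = 0"
    using step by (auto simp: euler_step_def y_def)
  have y: "y \<in> V" and increment_in: "u - p \<in> V"
    using p u subspace_V by (simp_all add: y_def subspace_diff subspace_scale)
  define k where "k = u \<bullet> B b u - p \<bullet> B a p - \<tau> * (gronwall_const * (energy b u v + energy a p w))"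
  have "((\<lambda>s. k - \<tau> * (norm (g s))\<^sup>2) has_integral (\<tau> * k - \<tau> * ?G)) {a..b}"
    using has_integral_const_real[of k a b] ab unfolding \<tau>_def
    by (intro has_integral_diff has_integral_mult_right integrable_integral source_sq_integrable) auto
  moreover have "((\<lambda>s. 2 * flux u v (u - p) s) has_integral 2 * integral {a..b} (flux u v (u - p))) {a..b}"
    unfolding v using flux_integrable[OF u y increment_in ab(1,3)]
    by (intro has_integral_mult_right integrable_integral)
  moreover have "k - \<tau> * (norm (g s))\<^sup>2 \<le> 2 * flux u v (u - p) s" if "s \<in> {a..b}" for s
    using flux_increment_ge[OF assms that] by (simp add: k_def \<tau>_def algebra_simps)
  ultimately have "\<tau> * k - \<tau> * ?G \<le> 2 * integral {a..b} (flux u v (u - p))"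
    by (rule has_integral_le)
  also have "\<dots> = - (2 * \<tau> * ((v - w) \<bullet> v))"
  proof -
    have "\<iota> (u - p) = \<tau> *\<^sub>R v"
      unfolding v using ab linear_scale[OF \<iota>_linear, of \<tau> y] by (simp add: y_def \<tau>_def)
    then show ?thesis using step_equation[OF increment_in] by simp
  qed
  also have "\<dots> \<le> \<tau> * ((norm w)\<^sup>2 - (norm v)\<^sup>2)"
  proof -
    have "0 \<le> \<tau> * (norm (v - w))\<^sup>2" using ab by (simp add: \<tau>_def)
    then show ?thesis
      by (simp add: power2_norm_eq_inner inner_diff_left inner_diff_right inner_commute algebra_simps)
  qed
  finally have "\<tau> * (k - ?G) \<le> \<tau> * ((norm w)\<^sup>2 - (norm v)\<^sup>2)" by (simp add: right_diff_distrib)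
  then have "k - ?G \<le> (norm w)\<^sup>2 - (norm v)\<^sup>2" using ab by (simp add: \<tau>_def)
  then show ?thesis unfolding \<tau>_def[symmetric] by (simp add: k_def energy_def algebra_simps)
qed

end

lemma implicit_gronwall_step:
  fixes E E' x G :: real
  assumes step: "E' - E \<le> x * (E' + E) + G" and x: "0 \<le> x" "x \<le> 1 / 2" and nonneg: "0 \<le> E" "0 \<le> G"
  shows "E' \<le> exp (3 * x) * E + 2 * G"
proof -
  have inverse_le: "1 / (1 - x) \<le> 1 + 2 * x" "1 / (1 - x) \<le> 2"
    using x mult_left_mono[of "2 * x" 1 x] by (auto simp: field_simps)
  have "(1 - x) * E' \<le> (1 + x) * E + G" using step by (simp add: algebra_simps)
  then have "E' \<le> ((1 + x) * E + G) / (1 - x)" using x by (simp add: pos_le_divide_eq mult.commute)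
  also have "\<dots> = 1 / (1 - x) * ((1 + x) * E) + 1 / (1 - x) * G" by (simp add: add_divide_distrib)
  also have "\<dots> \<le> (1 + 2 * x) * ((1 + x) * E) + 2 * G"
    using inverse_le x nonneg by (intro add_mono mult_right_mono) auto
  also have "\<dots> \<le> (exp (2 * x) * exp x) * E + 2 * G"
    using x nonneg exp_ge_add_one_self[of x] exp_ge_add_one_self[of "2 * x"]
    by (auto simp: mult.assoc intro!: mult_mono)
  also have "exp (2 * x) * exp x = exp (3 * x)" by (simp flip: exp_add)
  finally show ?thesis .
qed

context hyperbolic_system
begin

subsection \<open>The discrete solutions\<close>

definition grid :: "nat \<Rightarrow> nat \<Rightarrow> real" where
  "grid n j = real j * (T / real n)"

lemma grid_0 [simp]: "grid n 0 = 0"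
  by (simp add: grid_def)

lemma grid_last: "n > 0 \<Longrightarrow> grid n n = T"
  by (simp add: grid_def)

lemma grid_step: "grid n (Suc j) - grid n j = T / real n"
  by (simp add: grid_def distrib_right add_divide_distrib)

lemma grid_mono: "i \<le> j \<Longrightarrow> grid n i \<le> grid n j"
  unfolding grid_def using T_pos by (intro mult_right_mono) auto

lemma grid_less_Suc: "n > 0 \<Longrightarrow> grid n j < grid n (Suc j)"
  unfolding grid_def using T_pos by (intro mult_strict_right_mono) auto

lemma grid_in: "j \<le> n \<Longrightarrow> grid n j \<in> {0..T}"
  using grid_mono[of 0 j n] grid_mono[of j n n] grid_last[of n] T_pos by (cases "n = 0") auto

definition euler_solution :: "nat \<Rightarrow> (nat \<Rightarrow> 'x) \<Rightarrow> (nat \<Rightarrow> 'h) \<Rightarrow> bool" where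
  "euler_solution n U W \<longleftrightarrow> U 0 = u\<^sub>0 \<and> W 0 = w\<^sub>0
    \<and> (\<forall>j<n. euler_step (grid n j) (grid n (Suc j)) (U j) (W j) (U (Suc j)) (W (Suc j)))"

lemma euler_solution_exists:
  assumes n: "n > 0" and admissible: "admissible_step (T / real n)"
  shows "\<exists>U W. euler_solution n U W"
proof -
  let ?P = "\<lambda>j (u, w). u \<in> V \<and> (j = (0::nat) \<longrightarrow> u = u\<^sub>0 \<and> w = w\<^sub>0)"
  let ?Q = "\<lambda>j (p, w) (u, v). j < n \<longrightarrow> euler_step (grid n j) (grid n (Suc j)) p w u v"
  have "\<exists>f. \<forall>j. ?P j (f j) \<and> ?Q j (f j) (f (Suc j))"
  proof (rule dependent_nat_choice)
    show "\<exists>x. ?P 0 x" using u\<^sub>0_in by auto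
  next
    fix x j assume "?P j x"
    then obtain p w where x: "x = (p, w)" "p \<in> V" by (cases x) auto
    show "\<exists>y. ?P (Suc j) y \<and> ?Q j x y"
    proof (cases "j < n")
      case True
      then have "0 \<le> grid n j" "grid n (Suc j) \<le> T" using grid_in[of j n] grid_in[of "Suc j" n] by auto
      with True obtain u v where "euler_step (grid n j) (grid n (Suc j)) p w u v"
        using euler_step_exists[of "grid n j" "grid n (Suc j)" p w] grid_less_Suc[OF n] admissible x(2)
        unfolding grid_step by blast
      then show ?thesis using x by (intro exI[of _ "(u, v)"]) (auto simp: euler_step_def)
    qed (use x in auto)
  qed
  then obtain f where "\<forall>j. ?P j (f j) \<and> ?Q j (f j) (f (Suc j))" by (rule exE)
  then have "euler_solution n (\<lambda>j. fst (f j)) (\<lambda>j. snd (f j))"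
    by (simp add: euler_solution_def split_beta)
  then show ?thesis by blast
qed

lemma euler_solution_step:
  "euler_solution n U W \<Longrightarrow> j < n \<Longrightarrow>
    euler_step (grid n j) (grid n (Suc j)) (U j) (W j) (U (Suc j)) (W (Suc j))"
  by (simp add: euler_solution_def)

lemma euler_solution_position_in: "euler_solution n U W \<Longrightarrow> j \<le> n \<Longrightarrow> U j \<in> V"
  using euler_solution_step[of n U W "j - 1"] u\<^sub>0_in
  by (cases j) (auto simp: euler_solution_def euler_step_def)

lemma euler_solution_velocity_in:
  assumes euler: "euler_solution n U W" and "j \<le> n"
  shows "W j \<in> closure (\<iota> ` V)"
proof (cases j)
  case 0
  then show ?thesis using euler w\<^sub>0_in by (simp add: euler_solution_def)
next
  case (Suc k)
  have "U (Suc k) \<in> V" "U k \<in> V" using euler_solution_position_in[OF euler] Suc assms(2) by auto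
  then have "(U (Suc k) - U k) /\<^sub>R r \<in> V" for r
    using subspace_V by (simp add: subspace_scale subspace_diff)
  then show ?thesis
    using euler_solution_step[OF euler, of k] Suc assms(2) closure_subset
    by (fastforce simp: euler_step_def)
qed

subsection \<open>The discrete energy bound\<close>

definition source_energy :: "real \<Rightarrow> real" where
  "source_energy t = integral {0..t} (\<lambda>s. (norm (g s))\<^sup>2)"

lemma source_integral_nonneg: "0 \<le> integral I (\<lambda>s. (norm (g s))\<^sup>2)"
  by (cases "(\<lambda>s. (norm (g s))\<^sup>2) integrable_on I")
    (auto intro: Henstock_Kurzweil_Integration.integral_nonneg simp: not_integrable_integral)

lemma source_energy_combine:
  assumes "0 \<le> a" "a \<le> b" "b \<le> T"
  shows "source_energy a + integral {a..b} (\<lambda>s. (norm (g s))\<^sup>2) = source_energy b"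
  unfolding source_energy_def using assms source_sq_integrable[of 0 b]
  by (intro Henstock_Kurzweil_Integration.integral_combine) auto

definition energy_bound :: real where
  "energy_bound = exp (3 * gronwall_const * T) * (energy 0 u\<^sub>0 w\<^sub>0 + 2 * source_energy T)"

lemma discrete_energy_growth:
  assumes n: "n > 0" and admissible: "admissible_step (T / real n)" and euler: "euler_solution n U W"
    and "j \<le> n"
  shows "energy (grid n j) (U j) (W j)
    \<le> exp (3 * gronwall_const * grid n j) * (energy 0 u\<^sub>0 w\<^sub>0 + 2 * source_energy (grid n j))"
  using \<open>j \<le> n\<close>
proof (induction j)
  case 0
  then show ?case using euler by (simp add: euler_solution_def source_energy_def)
next
  case (Suc k)
  let ?a = "grid n k" and ?b = "grid n (Suc k)"
  let ?G = "integral {?a..?b} (\<lambda>s. (norm (g s))\<^sup>2)" and ?E = "energy ?a (U k) (W k)"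
  let ?x = "gronwall_const * (T / real n)"
  have k: "k < n" "k \<le> n" using Suc by auto
  have ab: "0 \<le> ?a" "?a < ?b" "?b \<le> T"
    using grid_in[OF k(2)] grid_in[OF Suc.prems] grid_less_Suc[OF n] by auto
  have x: "0 \<le> ?x" "?x \<le> 1 / 2"
    using admissible gronwall_const_ge_one T_pos by (auto simp: admissible_step_def)
  have U: "U k \<in> V" by (rule euler_solution_position_in[OF euler k(2)])
  have "energy ?b (U (Suc k)) (W (Suc k)) \<le> exp (3 * ?x) * ?E + 2 * ?G"
  proof (rule implicit_gronwall_step[OF _ x])
    show "energy ?b (U (Suc k)) (W (Suc k)) - ?E \<le> ?x * (energy ?b (U (Suc k)) (W (Suc k)) + ?E) + ?G"
      using energy_step[OF euler_solution_step[OF euler k(1)] U ab] unfolding grid_step .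
    show "0 \<le> ?E" by (rule energy_nonneg[OF grid_in[OF k(2)] U])
  qed (rule source_integral_nonneg)
  also have "\<dots> \<le> exp (3 * ?x) * (exp (3 * gronwall_const * ?a) * (energy 0 u\<^sub>0 w\<^sub>0 + 2 * source_energy ?a))
      + exp (3 * gronwall_const * ?b) * (2 * ?G)"
  proof (intro add_mono mult_left_mono)
    show "?E \<le> exp (3 * gronwall_const * ?a) * (energy 0 u\<^sub>0 w\<^sub>0 + 2 * source_energy ?a)" using Suc k by simp
    have "1 * (2 * ?G) \<le> exp (3 * gronwall_const * ?b) * (2 * ?G)"
      using ab gronwall_const_ge_one source_integral_nonneg by (intro mult_right_mono) auto
    then show "2 * ?G \<le> exp (3 * gronwall_const * ?b) * (2 * ?G)" by simp
  qed simp
  also have "exp (3 * ?x) * (exp (3 * gronwall_const * ?a) * (energy 0 u\<^sub>0 w\<^sub>0 + 2 * source_energy ?a))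
      = exp (3 * gronwall_const * ?b) * (energy 0 u\<^sub>0 w\<^sub>0 + 2 * source_energy ?a)"
    unfolding grid_step[of n k, symmetric] by (simp add: exp_add[symmetric] algebra_simps)
  also have "\<dots> + exp (3 * gronwall_const * ?b) * (2 * ?G)
      = exp (3 * gronwall_const * ?b) * (energy 0 u\<^sub>0 w\<^sub>0 + 2 * source_energy ?b)"
    unfolding source_energy_combine[OF ab(1) less_imp_le[OF ab(2)] ab(3), symmetric]
    by (simp add: distrib_left)
  finally show ?case .
qed

lemma discrete_energy_bound:
  assumes "n > 0" "admissible_step (T / real n)" "euler_solution n U W" and j: "j \<le> n"
  shows "energy (grid n j) (U j) (W j) \<le> energy_bound"
proof -
  let ?t = "grid n j"
  have t: "0 \<le> ?t" "?t \<le> T" using grid_in[OF j] by auto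
  have initial: "0 \<le> energy 0 u\<^sub>0 w\<^sub>0" using energy_nonneg[of 0 u\<^sub>0] u\<^sub>0_in T_pos by simp
  have source: "0 \<le> source_energy ?t" "source_energy ?t \<le> source_energy T"
    using source_energy_combine[of ?t T] t source_integral_nonneg[of "{?t..T}"]
      source_integral_nonneg[of "{0..?t}"] by (auto simp: source_energy_def)
  have "energy ?t (U j) (W j) \<le> exp (3 * gronwall_const * ?t) * (energy 0 u\<^sub>0 w\<^sub>0 + 2 * source_energy ?t)"
    by (rule discrete_energy_growth[OF assms])
  also have "\<dots> \<le> energy_bound"
    unfolding energy_bound_def using t initial source gronwall_const_ge_one by (intro mult_mono) auto
  finally show ?thesis .
qed

definition sol_bound :: real where
  "sol_bound = sqrt energy_bound + sqrt (energy_bound / \<alpha>)"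

lemma norms_le_sol_bound:
  assumes energy: "energy t u w \<le> energy_bound" and t: "t \<in> {0..T}" and u: "u \<in> V"
  shows "norm u \<le> sol_bound" "norm w \<le> sol_bound"
proof -
  have nonneg: "0 \<le> energy_bound" using energy_nonneg[OF t u, of w] energy by linarith
  have "norm w \<le> sqrt energy_bound"
    using norm_sq_le_energy(1)[OF t u, of w] energy by (intro real_le_rsqrt) linarith
  moreover have "norm u \<le> sqrt (energy_bound / \<alpha>)"
    using norm_sq_le_energy(2)[OF t u, of w] energy \<alpha>_pos
    by (intro real_le_rsqrt) (simp add: pos_le_divide_eq mult.commute)
  moreover have "0 \<le> sqrt energy_bound" "0 \<le> sqrt (energy_bound / \<alpha>)" using nonneg \<alpha>_pos by auto
  ultimately show "norm u \<le> sol_bound" "norm w \<le> sol_bound" unfolding sol_bound_def by linarith+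
qed

definition flux_majorant :: "real \<Rightarrow> real" where
  "flux_majorant s = 3 * M * sol_bound + 1 + (norm (g s))\<^sup>2"

lemma flux_majorant_integrable: "(\<lambda>s. flux_majorant s * r) integrable_on {0..T}"
  unfolding flux_majorant_def
  by (intro integrable_on_mult_left integrable_add g_sq_integrable integrable_const_ivl)

lemma flux_le_majorant:
  assumes "s \<in> {0..T}" "y \<in> V" "norm u \<le> sol_bound" "norm w \<le> sol_bound"
  shows "\<bar>flux u w y s\<bar> \<le> flux_majorant s * norm y"
  using order_trans[OF flux_bound[OF assms] mult_right_mono] le_one_plus_square[of "norm (g s)"]
  by (simp add: flux_majorant_def)

subsection \<open>Piecewise constant interpolation\<close>

definition grid_index :: "nat \<Rightarrow> real \<Rightarrow> nat" where
  "grid_index n t = nat \<lceil>t * real n / T\<rceil>"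

definition grid_up :: "nat \<Rightarrow> real \<Rightarrow> real" where
  "grid_up n t = grid n (grid_index n t)"

lemma grid_index_0 [simp]: "grid_index n 0 = 0"
  by (simp add: grid_index_def)

lemma grid_index_le:
  assumes "t \<in> {0..T}"
  shows "grid_index n t \<le> n"
proof -
  have "t * real n / T \<le> real n"
    using assms T_pos mult_right_mono[of t T "real n"] by (simp add: divide_le_eq mult.commute)
  then show ?thesis unfolding grid_index_def by (simp add: ceiling_le_iff)
qed

lemma grid_index_eq_Suc:
  assumes n: "n > 0" and r: "grid n k < r" "r \<le> grid n (Suc k)"
  shows "grid_index n r = Suc k"
proof -
  have "real k < r * real n / T" "r * real n / T \<le> real k + 1"
    using r n T_pos by (auto simp: grid_def field_simps)
  then have "\<lceil>r * real n / T\<rceil> = int k + 1" by (intro ceiling_unique) auto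
  then show ?thesis by (simp add: grid_index_def nat_add_distrib)
qed

lemma grid_up_bounds:
  assumes n: "n > 0" and t: "t \<in> {0..T}"
  shows "t \<le> grid_up n t" "grid_up n t \<le> t + T / real n" "grid_up n t \<in> {0..T}"
proof -
  let ?x = "t * real n / T"
  have index: "real (grid_index n t) = of_int \<lceil>?x\<rceil>" using t T_pos by (simp add: grid_index_def)
  have "?x * (T / real n) \<le> grid_up n t"
    unfolding grid_up_def grid_def index using T_pos n by (intro mult_right_mono) auto
  then show "t \<le> grid_up n t" using T_pos n by simp
  have "grid_up n t \<le> (?x + 1) * (T / real n)"
    unfolding grid_up_def grid_def index using T_pos n of_int_ceiling_le_add_one
    by (intro mult_right_mono) auto
  then show "grid_up n t \<le> t + T / real n" using T_pos n by (simp add: add_divide_distrib distrib_right)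
  show "grid_up n t \<in> {0..T}" unfolding grid_up_def by (rule grid_in[OF grid_index_le[OF t]])
qed

lemma has_integral_piecewise:
  fixes F :: "nat \<Rightarrow> real \<Rightarrow> real"
  assumes n: "n > 0"
    and piece: "\<And>k. k < j \<Longrightarrow> (F (Suc k) has_integral (X (Suc k) - X k)) {grid n k..grid n (Suc k)}"
  shows "((\<lambda>r. F (grid_index n r) r) has_integral (X j - X 0)) {0..grid n j}"
  using piece
proof (induction j)
  case (Suc k)
  have "((\<lambda>r. F (grid_index n r) r) has_integral (X (Suc k) - X k)) {grid n k..grid n (Suc k)}"
  proof (rule has_integral_spike_finite[OF _ _ Suc.prems])
    show "F (grid_index n r) r = F (Suc k) r" if "r \<in> {grid n k..grid n (Suc k)} - {grid n k}" for r
      using grid_index_eq_Suc[OF n, of k r] that by simp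
  qed auto
  moreover have "((\<lambda>r. F (grid_index n r) r) has_integral (X k - X 0)) {0..grid n k}" using Suc by simp
  ultimately have "((\<lambda>r. F (grid_index n r) r) has_integral ((X k - X 0) + (X (Suc k) - X k)))
      {0..grid n (Suc k)}"
    using grid_mono[of 0 k n] grid_mono[of k "Suc k" n] by (intro has_integral_combine) auto
  then show ?case by simp
qed (simp add: has_integral_refl)

text \<open>The time-integrated form of the equation. For the interpolated Euler scheme, \<open>\<theta>\<close> rounds up to the
  time grid; for solutions it is the identity.\<close>
definition integrated_solution :: "(real \<Rightarrow> real) \<Rightarrow> (real \<Rightarrow> 'x) \<Rightarrow> (real \<Rightarrow> 'h) \<Rightarrow> bool" where
  "integrated_solution \<theta> u w \<longleftrightarrow> u 0 = u\<^sub>0 \<and> w 0 = w\<^sub>0 \<and> (\<forall>t\<in>{0..T}.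
    u t \<in> V \<and> norm (u t) \<le> sol_bound \<and> w t \<in> closure (\<iota> ` V) \<and> norm (w t) \<le> sol_bound
    \<and> (\<forall>h. ((\<lambda>s. w s \<bullet> h) has_integral (\<iota> (u t) \<bullet> h - \<iota> u\<^sub>0 \<bullet> h)) {0..\<theta> t})
    \<and> (\<forall>y\<in>V. ((\<lambda>s. - flux (u s) (w s) y s) has_integral (w t \<bullet> \<iota> y - w\<^sub>0 \<bullet> \<iota> y)) {0..\<theta> t}))"

lemma integrated_solution_initial:
  "integrated_solution \<theta> u w \<Longrightarrow> u 0 = u\<^sub>0"
  "integrated_solution \<theta> u w \<Longrightarrow> w 0 = w\<^sub>0"
  by (simp_all add: integrated_solution_def)

lemma integrated_solutionD:
  assumes "integrated_solution \<theta> u w" "t \<in> {0..T}"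
  shows "u t \<in> V" "norm (u t) \<le> sol_bound" "w t \<in> closure (\<iota> ` V)" "norm (w t) \<le> sol_bound"
    and "((\<lambda>s. w s \<bullet> h) has_integral (\<iota> (u t) \<bullet> h - \<iota> u\<^sub>0 \<bullet> h)) {0..\<theta> t}"
    and "y \<in> V \<Longrightarrow> ((\<lambda>s. - flux (u s) (w s) y s) has_integral (w t \<bullet> \<iota> y - w\<^sub>0 \<bullet> \<iota> y)) {0..\<theta> t}"
  using assms by (auto simp: integrated_solution_def)

lemma euler_step_velocity_integral:
  assumes "euler_step a b p w u v" "a < b"
  shows "((\<lambda>_. v \<bullet> h) has_integral (\<iota> u \<bullet> h - \<iota> p \<bullet> h)) {a..b}"
proof -
  have "(b - a) *\<^sub>R v = \<iota> u - \<iota> p"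
    using assms \<iota>_linear by (simp add: euler_step_def linear_scale linear_diff)
  then have "(b - a) * (v \<bullet> h) = \<iota> u \<bullet> h - \<iota> p \<bullet> h" by (metis inner_diff_left inner_scaleR_left)
  then show ?thesis using has_integral_const_real[of "v \<bullet> h" a b] assms(2) by simp
qed

lemma euler_step_flux_integral:
  assumes step: "euler_step a b p w u v" and p: "p \<in> V" and ab: "0 \<le> a" "b \<le> T" and y: "y \<in> V"
  shows "((\<lambda>s. - flux u v y s) has_integral (v \<bullet> \<iota> y - w \<bullet> \<iota> y)) {a..b}"
proof -
  have u: "u \<in> V" and v: "v = \<iota> ((u - p) /\<^sub>R (b - a))"
    and step_equation: "(v - w) \<bullet> \<iota> y + integral {a..b} (flux u v y) = 0"
    using step y by (auto simp: euler_step_def)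
  have "flux u v y integrable_on {a..b}"
    unfolding v using u p y ab subspace_V by (intro flux_integrable subspace_scale subspace_diff) auto
  then have "((\<lambda>s. - flux u v y s) has_integral - integral {a..b} (flux u v y)) {a..b}"
    by (intro has_integral_neg integrable_integral)
  moreover have "- integral {a..b} (flux u v y) = v \<bullet> \<iota> y - w \<bullet> \<iota> y"
    using step_equation by (simp add: inner_diff_left)
  ultimately show ?thesis by simp
qed

lemma euler_interpolant_integrated_solution:
  assumes n: "n > 0" and admissible: "admissible_step (T / real n)" and euler: "euler_solution n U W"
  shows "integrated_solution (grid_up n) (\<lambda>t. U (grid_index n t)) (\<lambda>t. W (grid_index n t))"
proof -
  have initial: "U 0 = u\<^sub>0" "W 0 = w\<^sub>0" using euler by (auto simp: euler_solution_def)
  have norms: "norm (U j) \<le> sol_bound" "norm (W j) \<le> sol_bound" if "j \<le> n" for j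
    using norms_le_sol_bound[OF discrete_energy_bound[OF assms that] grid_in[OF that]
        euler_solution_position_in[OF euler that]] by auto
  have velocity: "((\<lambda>s. W (grid_index n s) \<bullet> h) has_integral (\<iota> (U j) \<bullet> h - \<iota> (U 0) \<bullet> h)) {0..grid n j}"
    if "j \<le> n" for h j
  proof (rule has_integral_piecewise[OF n, of j "\<lambda>j _. W j \<bullet> h" "\<lambda>j. \<iota> (U j) \<bullet> h"])
    fix k assume "k < j"
    then have "k < n" using that by simp
    from euler_step_velocity_integral[OF euler_solution_step[OF euler this] grid_less_Suc[OF n]]
    show "((\<lambda>_. W (Suc k) \<bullet> h) has_integral (\<iota> (U (Suc k)) \<bullet> h - \<iota> (U k) \<bullet> h))
        {grid n k..grid n (Suc k)}" .
  qed
  have flux: "((\<lambda>s. - flux (U (grid_index n s)) (W (grid_index n s)) y s) has_integral (W j \<bullet> \<iota> y - W 0 \<bullet> \<iota> y))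
      {0..grid n j}" if "j \<le> n" "y \<in> V" for y j
  proof (rule has_integral_piecewise[OF n, of j "\<lambda>j s. - flux (U j) (W j) y s" "\<lambda>j. W j \<bullet> \<iota> y"])
    fix k assume "k < j"
    then have k: "k < n" "k \<le> n" "Suc k \<le> n" using that by simp_all
    then show "((\<lambda>s. - flux (U (Suc k)) (W (Suc k)) y s) has_integral (W (Suc k) \<bullet> \<iota> y - W k \<bullet> \<iota> y))
        {grid n k..grid n (Suc k)}"
      using grid_in[OF k(2)] grid_in[OF k(3)] euler_solution_position_in[OF euler k(2)] that(2)
      by (intro euler_step_flux_integral[OF euler_solution_step[OF euler]]) auto
  qed
  show ?thesis
    unfolding integrated_solution_def grid_up_def
    using initial norms velocity flux euler_solution_position_in[OF euler]
      euler_solution_velocity_in[OF euler]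
      grid_index_le by auto
qed

end

subsection \<open>Passage to the limit\<close>

lemma continuous_on_indefinite_integral:
  fixes f F :: "real \<Rightarrow> real"
  assumes T: "0 \<le> T" and int: "\<And>t. t \<in> {0..T} \<Longrightarrow> (f has_integral (F t - c)) {0..t}"
  shows "continuous_on {0..T} F"
proof (rule continuous_on_eq)
  have "f integrable_on {0..T}" using int[of T] T by (auto intro: has_integral_integrable)
  then show "continuous_on {0..T} (\<lambda>t. c + integral {0..t} f)"
    by (intro continuous_intros indefinite_integral_continuous_1)
qed (use integral_unique[OF int] in auto)

lemma increment_le_integral_majorant:
  fixes f k :: "real \<Rightarrow> real"
  assumes int: "\<And>t. t \<in> I \<Longrightarrow> (f has_integral (X t - c)) {0..\<theta> t}"
    and \<theta>: "\<And>t. t \<in> I \<Longrightarrow> \<theta> t \<in> {0..T}"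
    and k: "k integrable_on {0..T}" "\<And>s. s \<in> {0..T} \<Longrightarrow> \<bar>f s\<bar> \<le> k s" and st: "s \<in> I" "t \<in> I"
  shows "\<bar>X t - X s\<bar> \<le> \<bar>integral {0..\<theta> t} k - integral {0..\<theta> s} k\<bar>"
proof -
  have ordered: "\<bar>X t - X s\<bar> \<le> integral {0..\<theta> t} k - integral {0..\<theta> s} k"
    if st: "s \<in> I" "t \<in> I" "\<theta> s \<le> \<theta> t" for s t
  proof -
    have \<theta>_st: "0 \<le> \<theta> s" "\<theta> t \<le> T" using \<theta> st by auto
    have f: "f integrable_on {0..\<theta> t}" using int[OF st(2)] by (rule has_integral_integrable)
    have k_upto: "k integrable_on {0..\<theta> t}" by (rule integrable_on_subinterval[OF k(1)]) (use \<theta>_st in auto)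
    have integrable_between: "f integrable_on {\<theta> s..\<theta> t}" "k integrable_on {\<theta> s..\<theta> t}"
      by (rule integrable_on_subinterval[OF f] integrable_on_subinterval[OF k_upto], use \<theta>_st in auto)+
    have "integral {0..\<theta> s} f + integral {\<theta> s..\<theta> t} f = integral {0..\<theta> t} f"
      "integral {0..\<theta> s} k + integral {\<theta> s..\<theta> t} k = integral {0..\<theta> t} k"
      using \<theta>_st st(3) f k_upto by (auto intro: Henstock_Kurzweil_Integration.integral_combine)
    moreover have "norm (integral {\<theta> s..\<theta> t} f) \<le> integral {\<theta> s..\<theta> t} k"
      using integrable_between k(2) \<theta>_st by (intro Henstock_Kurzweil_Integration.integral_norm_bound_integral) auto
    ultimately show ?thesis
      using integral_unique[OF int[OF st(1)]] integral_unique[OF int[OF st(2)]] by simp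
  qed
  show ?thesis
  proof (cases "\<theta> s \<le> \<theta> t")
    case True
    from ordered[OF st this] show ?thesis by linarith
  next
    case False
    then have "\<theta> t \<le> \<theta> s" by simp
    from ordered[OF st(2,1) this] show ?thesis by linarith
  qed
qed

lemma has_integral_dominated_limit:
  fixes f :: "nat \<Rightarrow> real \<Rightarrow> real"
  assumes \<theta>: "0 \<le> t" "\<And>n. t \<le> \<theta> n" "\<And>n. \<theta> n \<le> T" "\<theta> \<longlonglongrightarrow> t"
    and k: "k integrable_on {0..T}" "\<And>n s. s \<in> {0..T} \<Longrightarrow> \<bar>f n s\<bar> \<le> k s"
    and pointwise: "\<And>s. s \<in> {0..T} \<Longrightarrow> (\<lambda>n. f n s) \<longlonglongrightarrow> f' s"
    and int: "\<And>n. (f n has_integral L n) {0..\<theta> n}" and L: "L \<longlonglongrightarrow> L'"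
  shows "(f' has_integral L') {0..t}"
proof -
  define \<kappa> where "\<kappa> r = integral {0..r} k" for r
  have t: "t \<le> T" using \<theta>(2,3) order_trans by blast
  have k_sub: "k integrable_on {0..t}" by (rule integrable_on_subinterval[OF k(1)]) (use t in auto)
  have f_sub: "f n integrable_on {0..t}" for n
    by (rule integrable_on_subinterval[OF has_integral_integrable[OF int]]) (use \<theta> in auto)
  have dominated: "f' integrable_on {0..t}" "(\<lambda>n. integral {0..t} (f n)) \<longlonglongrightarrow> integral {0..t} f'"
    using dominated_convergence[of f "{0..t}" k f'] f_sub k_sub t k(2) pointwise by auto
  have "continuous_on {0..T} \<kappa>" unfolding \<kappa>_def using k(1) by (rule indefinite_integral_continuous_1)
  moreover have "\<forall>n. \<theta> n \<in> {0..T}" using \<theta>(3) order_trans[OF \<theta>(1,2)] by simp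
  ultimately have "(\<lambda>n. \<kappa> (\<theta> n)) \<longlonglongrightarrow> \<kappa> t"
    using \<theta>(1) t by (intro continuous_on_tendsto_compose[OF _ \<theta>(4)]) auto
  then have \<kappa>_null: "(\<lambda>n. \<bar>\<kappa> (\<theta> n) - \<kappa> t\<bar>) \<longlonglongrightarrow> 0" by (simp add: LIM_zero tendsto_rabs_zero)
  have "(\<lambda>n. L n - integral {0..t} (f n)) \<longlonglongrightarrow> 0"
  proof (rule Lim_null_comparison[OF _ \<kappa>_null], intro always_eventually allI)
    fix n
    have f_int: "(f n has_integral (integral {0..r} (f n) - 0)) {0..r}" if "r \<in> {t, \<theta> n}" for r
      using that f_sub has_integral_integrable[OF int[of n]] by (auto intro: integrable_integral)
    have "\<bar>integral {0..\<theta> n} (f n) - integral {0..t} (f n)\<bar> \<le> \<bar>\<kappa> (\<theta> n) - \<kappa> t\<bar>"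
      unfolding \<kappa>_def
      by (rule increment_le_integral_majorant[where \<theta> = "\<lambda>r. r" and I = "{t, \<theta> n}", OF f_int _ k(1) k(2)])
        (use \<theta> t order_trans[OF \<theta>(1,2)] in auto)
    then show "norm (L n - integral {0..t} (f n)) \<le> \<bar>\<kappa> (\<theta> n) - \<kappa> t\<bar>"
      using integral_unique[OF int[of n]] by simp
  qed
  then have "(\<lambda>n. L n - (L n - integral {0..t} (f n))) \<longlonglongrightarrow> L' - 0" by (intro tendsto_diff L)
  then have "integral {0..t} f' = L'" using LIMSEQ_unique[OF dominated(2)] by simp
  then show ?thesis using dominated(1) by (simp add: has_integral_integrable_integral)
qed

context hyperbolic_system
begin

lemma closed_range_subspace: "subspace (closure (\<iota> ` V))"
  by (intro subspace_closure linear_subspace_image \<iota>_linear subspace_V)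

lemma \<iota>_adjoint_exists: "\<exists>z. z \<in> V \<and> (\<forall>v\<in>V. \<iota> v \<bullet> h = v \<bullet> z)"
proof -
  have "\<bar>\<iota> v \<bullet> h\<bar> \<le> norm h * norm v" for v using inner_\<iota>_bound[of h v] by (simp add: inner_commute)
  from riesz_representation_on[OF subspace_V closed_V linear_form_on_inner_linear(2)[OF \<iota>_linear, of V h] this]
  show ?thesis by metis
qed

definition \<iota>_adjoint :: "'h \<Rightarrow> 'x" where
  "\<iota>_adjoint h = (SOME z. z \<in> V \<and> (\<forall>v\<in>V. \<iota> v \<bullet> h = v \<bullet> z))"

lemma \<iota>_adjoint_in: "\<iota>_adjoint h \<in> V" and inner_\<iota>_adjoint: "v \<in> V \<Longrightarrow> v \<bullet> \<iota>_adjoint h = \<iota> v \<bullet> h"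
  using someI_ex[OF \<iota>_adjoint_exists[of h]] unfolding \<iota>_adjoint_def by auto

lemma total_in_range_adjoint: "total_in V (range \<iota>_adjoint)"
  unfolding total_in_def
proof (intro conjI ballI impI)
  fix v assume v: "v \<in> V" and "\<forall>y\<in>range \<iota>_adjoint. v \<bullet> y = 0"
  then have "\<iota> v \<bullet> \<iota> v = 0" using inner_\<iota>_adjoint[OF v, of "\<iota> v"] by simp
  then show "v = 0" using \<iota>_inj[OF v] by simp
qed (use \<iota>_adjoint_in in auto)

lemma position_weakly_continuous:
  assumes solution: "integrated_solution (\<lambda>t. t) u w"
  shows "continuous_on {0..T} (\<lambda>t. u t \<bullet> y)"
proof (rule weakly_continuous_if_continuous_on_total[OF subspace_V closed_V total_in_range_adjoint])
  fix y assume "y \<in> range \<iota>_adjoint"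
  then obtain h where y: "y = \<iota>_adjoint h" by blast
  have "continuous_on {0..T} (\<lambda>t. \<iota> (u t) \<bullet> h)"
    by (rule continuous_on_indefinite_integral[OF less_imp_le[OF T_pos] integrated_solutionD(5)[OF solution]])
  then show "continuous_on {0..T} (\<lambda>t. u t \<bullet> y)"
    by (rule continuous_on_eq) (simp add: y inner_\<iota>_adjoint integrated_solutionD(1)[OF solution])
qed (use integrated_solutionD[OF solution] in auto)

lemma velocity_weakly_continuous:
  assumes solution: "integrated_solution (\<lambda>t. t) u w"
  shows "continuous_on {0..T} (\<lambda>t. w t \<bullet> h)"
proof (rule weakly_continuous_if_continuous_on_total[OF closed_range_subspace closed_closure total_in_closure])
  fix h assume "h \<in> \<iota> ` V"
  then show "continuous_on {0..T} (\<lambda>t. w t \<bullet> h)"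
    using continuous_on_indefinite_integral[OF less_imp_le[OF T_pos] integrated_solutionD(6)[OF solution]]
    by blast
qed (use integrated_solutionD[OF solution] in auto)

end

locale approximating_sequence = hyperbolic_system V \<iota> B C D g T M \<alpha> u\<^sub>0 w\<^sub>0
  for V :: "'x::{real_inner,banach} set" and \<iota> :: "'x \<Rightarrow> 'h::{real_inner,banach}"
    and B C D g T M \<alpha> u\<^sub>0 w\<^sub>0 +
  fixes \<theta> :: "nat \<Rightarrow> real \<Rightarrow> real" and U :: "nat \<Rightarrow> real \<Rightarrow> 'x" and W :: "nat \<Rightarrow> real \<Rightarrow> 'h" and S :: "real set"
  assumes approximants: "\<And>n. integrated_solution (\<theta> n) (U n) (W n)"
    and \<theta>_bounds: "\<And>n t. t \<in> {0..T} \<Longrightarrow> t \<le> \<theta> n t" "\<And>n t. t \<in> {0..T} \<Longrightarrow> \<theta> n t \<le> T"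
    and \<theta>_limit: "\<And>t. t \<in> {0..T} \<Longrightarrow> (\<lambda>n. \<theta> n t) \<longlonglongrightarrow> t"
    and dense_times: "S \<subseteq> {0..T}" "{0..T} \<subseteq> closure S"
    and U_convergent: "\<And>t y. t \<in> S \<Longrightarrow> convergent (\<lambda>n. U n t \<bullet> y)"
    and W_convergent: "\<And>t h. t \<in> S \<Longrightarrow> convergent (\<lambda>n. W n t \<bullet> h)"
begin

lemmas approximantsD = integrated_solutionD[OF approximants]

lemma \<theta>_in: "t \<in> {0..T} \<Longrightarrow> \<theta> n t \<in> {0..T}"
  using \<theta>_bounds[of t n] by auto

lemma W_inner_bound: "t \<in> {0..T} \<Longrightarrow> \<bar>W n t \<bullet> h\<bar> \<le> sol_bound * norm h"
  by (rule order_trans[OF Cauchy_Schwarz_ineq2 mult_right_mono[OF approximantsD(4)]]) auto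

lemma flux_approximate_bound:
  "t \<in> {0..T} \<Longrightarrow> y \<in> V \<Longrightarrow> \<bar>- flux (U n t) (W n t) y t\<bar> \<le> flux_majorant t * norm y"
  unfolding abs_minus_cancel by (intro flux_le_majorant approximantsD)

lemma convergent_at_all_times:
  fixes X :: "nat \<Rightarrow> real \<Rightarrow> real"
  assumes int: "\<And>n t. t \<in> {0..T} \<Longrightarrow> (f n has_integral (X n t - c)) {0..\<theta> n t}"
    and k: "k integrable_on {0..T}" "\<And>n s. s \<in> {0..T} \<Longrightarrow> \<bar>f n s\<bar> \<le> k s"
    and conv: "\<And>s. s \<in> S \<Longrightarrow> convergent (\<lambda>n. X n s)" and t: "t \<in> {0..T}"
  shows "convergent (\<lambda>n. X n t)"
proof (rule convergent_at_limit_of_equicontinuous[OF _ _ _ dense_times conv t])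
  show cont: "continuous_on {0..T} (\<lambda>t. integral {0..t} k)"
    by (rule indefinite_integral_continuous_1[OF k(1)])
  show "\<bar>X n t - X n s\<bar> \<le> \<bar>integral {0..\<theta> n t} k - integral {0..\<theta> n s} k\<bar>"
    if "s \<in> {0..T}" "t \<in> {0..T}" for n s t
    by (rule increment_le_integral_majorant[OF int \<theta>_in k that])
  show "(\<lambda>n. integral {0..\<theta> n t} k) \<longlonglongrightarrow> integral {0..t} k" if "t \<in> {0..T}" for t
    using continuous_on_tendsto_compose[OF cont \<theta>_limit[OF that] that] \<theta>_in[OF that] by simp
qed

lemma U_weakly_convergent:
  assumes t: "t \<in> {0..T}"
  obtains z where "z \<in> V" "norm z \<le> sol_bound" "weakly_tendsto (\<lambda>n. U n t) z"
proof (rule weakly_convergent_if_convergent_on_total[OF subspace_V closed_V total_in_range_adjoint])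
  fix y assume "y \<in> range \<iota>_adjoint"
  then obtain h where y: "y = \<iota>_adjoint h" by blast
  have inner_y: "U n t \<bullet> y = \<iota> (U n t) \<bullet> h" if "t \<in> {0..T}" for n t
    by (simp add: y inner_\<iota>_adjoint approximantsD(1)[OF that])
  have "convergent (\<lambda>n. \<iota> (U n t) \<bullet> h)"
    using U_convergent[of _ y] inner_y dense_times(1)
    by (intro convergent_at_all_times[OF approximantsD(5) integrable_const_ivl W_inner_bound _ t])
      (auto simp: subset_iff)
  then show "convergent (\<lambda>n. U n t \<bullet> y)" by (simp add: inner_y[OF t])
qed (use approximantsD[OF t] that in auto)

lemma W_weakly_convergent:
  assumes t: "t \<in> {0..T}"
  obtains z where "z \<in> closure (\<iota> ` V)" "norm z \<le> sol_bound" "weakly_tendsto (\<lambda>n. W n t) z"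
proof (rule weakly_convergent_if_convergent_on_total[OF closed_range_subspace closed_closure total_in_closure])
  fix h assume "h \<in> \<iota> ` V"
  then obtain y where y: "y \<in> V" "h = \<iota> y" by blast
  then show "convergent (\<lambda>n. W n t \<bullet> h)"
    using convergent_at_all_times[OF approximantsD(6) flux_majorant_integrable flux_approximate_bound
      W_convergent t]
    by blast
qed (use approximantsD[OF t] that in auto)

definition limit_position :: "real \<Rightarrow> 'x" where
  "limit_position t = (SOME z. z \<in> V \<and> norm z \<le> sol_bound \<and> weakly_tendsto (\<lambda>n. U n t) z)"

definition limit_velocity :: "real \<Rightarrow> 'h" where
  "limit_velocity t =
    (SOME z. z \<in> closure (\<iota> ` V) \<and> norm z \<le> sol_bound \<and> weakly_tendsto (\<lambda>n. W n t) z)"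

lemma limit_position:
  assumes "t \<in> {0..T}"
  shows "limit_position t \<in> V" "norm (limit_position t) \<le> sol_bound"
    and "(\<lambda>n. U n t \<bullet> y) \<longlonglongrightarrow> limit_position t \<bullet> y"
proof -
  have "\<exists>z. z \<in> V \<and> norm z \<le> sol_bound \<and> weakly_tendsto (\<lambda>n. U n t) z"
    using U_weakly_convergent[OF assms] by blast
  from someI_ex[OF this] show "limit_position t \<in> V" "norm (limit_position t) \<le> sol_bound"
    "(\<lambda>n. U n t \<bullet> y) \<longlonglongrightarrow> limit_position t \<bullet> y"
    by (auto simp: limit_position_def dest: weakly_tendstoD)
qed

lemma limit_velocity:
  assumes "t \<in> {0..T}"
  shows "limit_velocity t \<in> closure (\<iota> ` V)" "norm (limit_velocity t) \<le> sol_bound"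
    and "(\<lambda>n. W n t \<bullet> h) \<longlonglongrightarrow> limit_velocity t \<bullet> h"
proof -
  have "\<exists>z. z \<in> closure (\<iota> ` V) \<and> norm z \<le> sol_bound \<and> weakly_tendsto (\<lambda>n. W n t) z"
    using W_weakly_convergent[OF assms] by blast
  from someI_ex[OF this] show "limit_velocity t \<in> closure (\<iota> ` V)" "norm (limit_velocity t) \<le> sol_bound"
    "(\<lambda>n. W n t \<bullet> h) \<longlonglongrightarrow> limit_velocity t \<bullet> h"
    by (auto simp: limit_velocity_def dest: weakly_tendstoD)
qed

lemma \<iota>_limit_position:
  assumes t: "t \<in> {0..T}"
  shows "(\<lambda>n. \<iota> (U n t) \<bullet> h) \<longlonglongrightarrow> \<iota> (limit_position t) \<bullet> h"
  using limit_position(3)[OF t, of "\<iota>_adjoint h"] approximantsD(1)[OF t] limit_position(1)[OF t]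
  by (simp add: inner_\<iota>_adjoint)

lemma limit_integrated_solution: "integrated_solution (\<lambda>t. t) limit_position limit_velocity"
  unfolding integrated_solution_def
proof (intro conjI ballI allI)
  have zero: "0 \<in> {0..T}" using T_pos by simp
  note initial = integrated_solution_initial[OF approximants]
  show "limit_position 0 = u\<^sub>0"
    using limit_position(1)[OF zero] u\<^sub>0_in LIMSEQ_unique[OF limit_position(3)[OF zero]]
    by (intro eq_if_inner_eq_on_total[OF subspace_V total_in_range_adjoint]) (auto simp: initial)
  show "limit_velocity 0 = w\<^sub>0"
    using limit_velocity(1)[OF zero] w\<^sub>0_in LIMSEQ_unique[OF limit_velocity(3)[OF zero]]
    by (intro eq_if_inner_eq_on_total[OF closed_range_subspace total_in_closure]) (auto simp: initial)
  fix t assume t: "t \<in> {0..T}"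
  note limit_rule = has_integral_dominated_limit[OF _ \<theta>_bounds[OF t] \<theta>_limit[OF t]]
  show "((\<lambda>s. limit_velocity s \<bullet> h) has_integral (\<iota> (limit_position t) \<bullet> h - \<iota> u\<^sub>0 \<bullet> h)) {0..t}" for h
    by (rule limit_rule[OF _ integrable_const_ivl W_inner_bound limit_velocity(3) approximantsD(5)[OF t]])
      (use t in \<open>auto intro!: tendsto_intros \<iota>_limit_position\<close>)
  show "((\<lambda>s. - flux (limit_position s) (limit_velocity s) y s) has_integral
      (limit_velocity t \<bullet> \<iota> y - w\<^sub>0 \<bullet> \<iota> y)) {0..t}" if y: "y \<in> V" for y
  proof (rule limit_rule[OF _ flux_majorant_integrable flux_approximate_bound[OF _ y] _ approximantsD(6)[OF t y]])
    show "(\<lambda>n. - flux (U n s) (W n s) y s) \<longlonglongrightarrow> - flux (limit_position s) (limit_velocity s) y s"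
      if "s \<in> {0..T}" for s
      unfolding flux_def by (intro tendsto_intros limit_position(3) limit_velocity(3) that)
    show "(\<lambda>n. W n t \<bullet> \<iota> y - w\<^sub>0 \<bullet> \<iota> y) \<longlonglongrightarrow> limit_velocity t \<bullet> \<iota> y - w\<^sub>0 \<bullet> \<iota> y"
      by (intro tendsto_intros limit_velocity(3) t)
  qed (use t in auto)
qed (use limit_position limit_velocity in auto)

end

lemma Icc_subset_closure_rationals:
  assumes "a < b"
  shows "{a..b::real} \<subseteq> closure ({a..b} \<inter> \<rat>)"
proof -
  have "{a<..<b} \<subseteq> closure ({a<..<b} \<inter> \<rat>)"
    using open_Int_closure_subset[of "{a<..<b}" "\<rat>"] by (simp add: Rats_closure_real)
  also have "\<dots> \<subseteq> closure ({a..b} \<inter> \<rat>)" by (intro closure_mono) auto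
  finally have "closure {a<..<b} \<subseteq> closure ({a..b} \<inter> \<rat>)" by (rule closure_minimal) simp
  then show ?thesis using assms by simp
qed

context hyperbolic_system
begin

lemma eventually_admissible_step: "\<forall>\<^sub>F n in sequentially. n > 0 \<and> admissible_step (T / real n)"
proof -
  note step_null = lim_const_over_n[of T]
  have "(\<lambda>n. r * (T / real n)) \<longlonglongrightarrow> 0" for r using tendsto_mult_right_zero[OF step_null] .
  then have "\<forall>\<^sub>F n in sequentially. r * (T / real n) < 1 / 2" for r by (rule order_tendstoD) simp
  note small = this[of M] this[of gronwall_const]
  have "(\<lambda>n. (T / real n) * (T / real n) * M\<^sup>2 / (2 * \<alpha>)) \<longlonglongrightarrow> 0 * 0 * M\<^sup>2 / (2 * \<alpha>)"
    by (intro tendsto_intros step_null) (use \<alpha>_pos in simp)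
  then have "\<forall>\<^sub>F n in sequentially. (T / real n) * (T / real n) * M\<^sup>2 / (2 * \<alpha>) < 1 / 2"
    by (rule order_tendstoD) simp
  with small eventually_gt_at_top[of 0] show ?thesis
    by eventually_elim (use T_pos in \<open>simp add: admissible_step_def mult.commute less_imp_le\<close>)
qed

theorem integrated_solution_exists: "\<exists>u w. integrated_solution (\<lambda>t. t) u w"
proof -
  let ?S = "{0..T} \<inter> \<rat>"
  obtain n\<^sub>0 where n\<^sub>0: "\<And>n. n \<ge> n\<^sub>0 \<Longrightarrow> n > 0 \<and> admissible_step (T / real n)"
    using eventually_admissible_step by (auto simp: eventually_sequentially)
  then have "\<exists>u w. integrated_solution (grid_up (n\<^sub>0 + n)) u w" for n
    using euler_solution_exists euler_interpolant_integrated_solution by (meson le_add1)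
  then obtain U W where UW: "\<And>n. integrated_solution (grid_up (n\<^sub>0 + n)) (U n) (W n)" by metis
  have "norm (U n t, W n t) \<le> sol_bound + sol_bound" if "t \<in> ?S" for n t
    using integrated_solutionD(2,4)[OF UW, of t] that by (intro order_trans[OF norm_Pair_le add_mono]) auto
  moreover have "countable ?S" using countable_rat by (rule countable_Int2)
  ultimately obtain r :: "nat \<Rightarrow> nat" where r: "strict_mono r"
    and conv: "\<And>t y. t \<in> ?S \<Longrightarrow> convergent (\<lambda>n. (U (r n) t, W (r n) t) \<bullet> y)"
    using weakly_Cauchy_subsequence_countable[of ?S "\<lambda>n t. (U n t, W n t)"] by blast
  have "strict_mono (\<lambda>n. n\<^sub>0 + r n)" using r by (simp add: strict_mono_def)
  then have step_null: "(\<lambda>n. T / real (n\<^sub>0 + r n)) \<longlonglongrightarrow> 0"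
    using LIMSEQ_subseq_LIMSEQ[OF lim_const_over_n[of T]] unfolding o_def by blast
  interpret approximating_sequence V \<iota> B C D g T M \<alpha> u\<^sub>0 w\<^sub>0 "\<lambda>n. grid_up (n\<^sub>0 + r n)"
    "\<lambda>n. U (r n)" "\<lambda>n. W (r n)" ?S
  proof unfold_locales
    fix n t assume t: "t \<in> {0..T}"
    note bounds = grid_up_bounds[OF conjunct1[OF n\<^sub>0[OF le_add1]] t]
    show "t \<le> grid_up (n\<^sub>0 + r n) t" "grid_up (n\<^sub>0 + r n) t \<le> T" using bounds by auto
    have "(\<lambda>n. t + T / real (n\<^sub>0 + r n)) \<longlonglongrightarrow> t" using tendsto_add[OF tendsto_const step_null, of t] by simp
    then show "(\<lambda>n. grid_up (n\<^sub>0 + r n) t) \<longlonglongrightarrow> t"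
      by (rule real_tendsto_sandwich[OF _ _ tendsto_const, rotated 2]) (use bounds in auto)
  next
    show "convergent (\<lambda>n. U (r n) t \<bullet> y)" if "t \<in> ?S" for t y using conv[OF that, of "(y, 0)"] by simp
    show "convergent (\<lambda>n. W (r n) t \<bullet> h)" if "t \<in> ?S" for t h using conv[OF that, of "(0, h)"] by simp
  qed (use UW Icc_subset_closure_rationals[OF T_pos] in auto)
  show ?thesis using limit_integrated_solution by blast
qed

end

section \<open>The Hilbert space of square integrable functions\<close>

subsection \<open>Square integrable functions\<close>

definition sq_integrable :: "('a::euclidean_space \<Rightarrow> 'b::euclidean_space) \<Rightarrow> bool" where
  "sq_integrable f \<longleftrightarrow> f \<in> borel_measurable lebesgue \<and> integrable lebesgue (\<lambda>x. (norm (f x))\<^sup>2)"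

lemma sq_integrable_measurable: "sq_integrable f \<Longrightarrow> f \<in> borel_measurable lebesgue"
  by (simp add: sq_integrable_def)

lemma sq_integrable_norm: "sq_integrable f \<Longrightarrow> integrable lebesgue (\<lambda>x. (norm (f x))\<^sup>2)"
  by (simp add: sq_integrable_def)

lemma sq_integrable_inner:
  assumes f: "sq_integrable f" and g: "sq_integrable g"
  shows "integrable lebesgue (\<lambda>x. f x \<bullet> g x)"
proof (rule Bochner_Integration.integrable_bound)
  show "integrable lebesgue (\<lambda>x. (norm (f x))\<^sup>2 + (norm (g x))\<^sup>2)"
    using f g by (intro Bochner_Integration.integrable_add sq_integrable_norm)
  show "(\<lambda>x. f x \<bullet> g x) \<in> borel_measurable lebesgue"
    using f g by (intro borel_measurable_inner sq_integrable_measurable)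
  have "\<bar>f x \<bullet> g x\<bar> \<le> (norm (f x))\<^sup>2 + (norm (g x))\<^sup>2" for x
    using Cauchy_Schwarz_ineq2[of "f x" "g x"] sum_squares_bound[of "norm (f x)" "norm (g x)"]
      mult_nonneg_nonneg[OF norm_ge_zero norm_ge_zero, of "f x" "g x"] by linarith
  then show "AE x in lebesgue. norm (f x \<bullet> g x) \<le> norm ((norm (f x))\<^sup>2 + (norm (g x))\<^sup>2)" by simp
qed

lemma sq_integrable_bound:
  assumes f: "f \<in> borel_measurable lebesgue" and h: "integrable lebesgue h" "\<And>x. (norm (f x))\<^sup>2 \<le> h x"
  shows "sq_integrable f"
  unfolding sq_integrable_def
proof (intro conjI f Bochner_Integration.integrable_bound[OF h(1)])
  show "(\<lambda>x. (norm (f x))\<^sup>2) \<in> borel_measurable lebesgue" using f by measurable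
  show "AE x in lebesgue. norm ((norm (f x))\<^sup>2) \<le> norm (h x)"
    by (intro AE_I2) (use order_trans[OF h(2) abs_ge_self] in auto)
qed

lemma sq_integrable_zero: "sq_integrable (\<lambda>_. 0)"
  by (simp add: sq_integrable_def)

lemma sq_integrable_add:
  assumes "sq_integrable f" "sq_integrable g"
  shows "sq_integrable (\<lambda>x. f x + g x)"
proof (rule sq_integrable_bound)
  show "(\<lambda>x. f x + g x) \<in> borel_measurable lebesgue"
    using assms by (intro borel_measurable_add sq_integrable_measurable)
  show "integrable lebesgue (\<lambda>x. 2 * (norm (f x))\<^sup>2 + 2 * (norm (g x))\<^sup>2)"
    using assms by (intro Bochner_Integration.integrable_add integrable_mult_right sq_integrable_norm)
  fix x
  have "(norm (f x + g x))\<^sup>2 \<le> (norm (f x) + norm (g x))\<^sup>2" by (intro power_mono norm_triangle_ineq) auto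
  also have "\<dots> \<le> 2 * (norm (f x))\<^sup>2 + 2 * (norm (g x))\<^sup>2"
    using sum_squares_bound[of "norm (f x)" "norm (g x)"] by (simp add: power2_sum)
  finally show "(norm (f x + g x))\<^sup>2 \<le> 2 * (norm (f x))\<^sup>2 + 2 * (norm (g x))\<^sup>2" .
qed

lemma sq_integrable_scaleR: "sq_integrable f \<Longrightarrow> sq_integrable (\<lambda>x. c *\<^sub>R f x)"
  by (auto simp: sq_integrable_def power_mult_distrib)

lemma sq_integrable_uminus: "sq_integrable f \<Longrightarrow> sq_integrable (\<lambda>x. - f x)"
  using sq_integrable_scaleR[of f "-1"] by simp

lemma sq_integrable_diff: "sq_integrable f \<Longrightarrow> sq_integrable g \<Longrightarrow> sq_integrable (\<lambda>x. f x - g x)"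
  using sq_integrable_add[of f "\<lambda>x. - g x"] sq_integrable_uminus[of g] by simp

subsection \<open>The Riesz--Fischer theorem\<close>

lemma sq_integrable_AE_limit:
  assumes f: "\<And>n. sq_integrable (f n)" and F: "F \<in> borel_measurable lebesgue"
    and f_limit: "AE x in lebesgue. (\<lambda>n. f n x) \<longlonglongrightarrow> F x"
    and bound: "\<And>n. n \<ge> N \<Longrightarrow> (\<integral>x. (norm (f n x))\<^sup>2 \<partial>lebesgue) \<le> C"
  shows "sq_integrable F" "(\<integral>x. (norm (F x))\<^sup>2 \<partial>lebesgue) \<le> C"
proof -
  have "(\<integral>\<^sup>+x. ennreal ((norm (F x))\<^sup>2) \<partial>lebesgue)
      = (\<integral>\<^sup>+x. liminf (\<lambda>n. ennreal ((norm (f n x))\<^sup>2)) \<partial>lebesgue)"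
  proof (rule nn_integral_cong_AE, use f_limit in eventually_elim)
    case (elim x)
    then have "(\<lambda>n. ennreal ((norm (f n x))\<^sup>2)) \<longlonglongrightarrow> ennreal ((norm (F x))\<^sup>2)" by (intro tendsto_intros)
    then show ?case by (intro lim_imp_Liminf[symmetric]) auto
  qed
  also have "\<dots> \<le> liminf (\<lambda>n. \<integral>\<^sup>+x. ennreal ((norm (f n x))\<^sup>2) \<partial>lebesgue)"
    using sq_integrable_measurable[OF f] by (intro nn_integral_liminf) measurable
  also have "\<dots> = liminf (\<lambda>n. ennreal (\<integral>x. (norm (f n x))\<^sup>2 \<partial>lebesgue))"
    using sq_integrable_norm[OF f] by (simp add: nn_integral_eq_integral)
  also have "\<dots> \<le> liminf (\<lambda>n. ennreal C)"
    using bound by (intro Liminf_mono) (auto simp: eventually_sequentially intro!: exI[of _ N] ennreal_leI)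
  also have "\<dots> = ennreal C" by (simp add: Liminf_const)
  finally have nn_integral_le: "(\<integral>\<^sup>+x. ennreal ((norm (F x))\<^sup>2) \<partial>lebesgue) \<le> ennreal C" .
  then have "(\<integral>\<^sup>+x. ennreal ((norm (F x))\<^sup>2) \<partial>lebesgue) < \<infinity>" by (simp add: le_less_trans)
  then show F_sq_integrable: "sq_integrable F"
    unfolding sq_integrable_def using F by (intro conjI integrableI_bounded) auto
  have "0 \<le> C" by (rule order_trans[OF _ bound[OF order_refl]]) simp
  then show "(\<integral>x. (norm (F x))\<^sup>2 \<partial>lebesgue) \<le> C"
    using nn_integral_le by (simp add: nn_integral_eq_integral[OF sq_integrable_norm[OF F_sq_integrable]])
qed

lemma AE_bounded_if_nn_integrals_summable:
  fixes h :: "nat \<Rightarrow> 'a \<Rightarrow> real"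
  assumes h: "\<And>n. h n \<in> borel_measurable M" "(\<Sum>n. \<integral>\<^sup>+x. ennreal (h n x) \<partial>M) < \<infinity>"
  shows "AE x in M. \<exists>C\<ge>0. \<forall>n. h n x \<le> C"
proof -
  have "(\<integral>\<^sup>+x. (\<Sum>n. ennreal (h n x)) \<partial>M) < \<infinity>" using h by (subst nn_integral_suminf) auto
  then have "AE x in M. (\<Sum>n. ennreal (h n x)) \<noteq> \<infinity>" using h(1) by (intro nn_integral_noteq_infinite) auto
  then show ?thesis
  proof eventually_elim
    case (elim x)
    then obtain C where C: "C \<ge> 0" "(\<Sum>n. ennreal (h n x)) = ennreal C"
      by (cases "\<Sum>n. ennreal (h n x)" rule: ennreal_cases) auto
    have "h n x \<le> C" for n
    proof -
      have "sum (\<lambda>i. ennreal (h i x)) {n} \<le> (\<Sum>i. ennreal (h i x))" by (rule sum_le_suminf) auto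
      then show ?thesis using C by simp
    qed
    with C(1) show ?case by blast
  qed
qed

lemma convergent_if_increments_geometric:
  fixes f :: "nat \<Rightarrow> 'a::banach"
  assumes increment: "\<And>n. 4 ^ n * (norm (f (Suc n) - f n))\<^sup>2 \<le> C" and "C \<ge> 0"
  shows "convergent f"
proof -
  have "norm (f (Suc n) - f n) \<le> sqrt C * (1/2) ^ n" for n
  proof (rule power2_le_imp_le)
    have "(sqrt C * (1/2) ^ n)\<^sup>2 = C * ((1/2)\<^sup>2) ^ n"
      using \<open>C \<ge> 0\<close> by (simp add: power_mult_distrib mult.commute flip: power_mult)
    also have "\<dots> = C / 4 ^ n" by (simp add: power2_eq_square power_divide)
    finally show "(norm (f (Suc n) - f n))\<^sup>2 \<le> (sqrt C * (1/2) ^ n)\<^sup>2"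
      using increment[of n] by (simp add: pos_le_divide_eq mult.commute)
  qed (use \<open>C \<ge> 0\<close> in simp)
  moreover have "summable (\<lambda>n. sqrt C * (1/2) ^ n)" by (intro summable_mult summable_geometric) simp
  ultimately have "summable (\<lambda>n. f (Suc n) - f n)" by (rule summable_comparison_test'[rotated])
  then have "convergent (\<lambda>n. (\<Sum>i<n. f (Suc i) - f i) + f 0)"
    unfolding summable_iff_convergent by (rule convergent_add) (rule convergent_const)
  moreover have "(\<lambda>n. (\<Sum>i<n. f (Suc i) - f i) + f 0) = f"
    using sum_lessThan_telescope[of f] by auto
  ultimately show ?thesis by simp
qed

lemma AE_convergent_if_fast_Cauchy:
  assumes f: "\<And>n. sq_integrable (f n)"
    and fast: "\<And>n. (\<integral>x. (norm (f (Suc n) x - f n x))\<^sup>2 \<partial>lebesgue) \<le> ((1/4) ^ n)\<^sup>2"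
  shows "AE x in lebesgue. convergent (\<lambda>n. f n x)"
proof -
  let ?h = "\<lambda>n x. 4 ^ n * (norm (f (Suc n) x - f n x))\<^sup>2"
  have h_integrable: "integrable lebesgue (?h n)" for n
    by (intro integrable_mult_right sq_integrable_norm sq_integrable_diff f)
  have "(\<integral>\<^sup>+x. ennreal (?h n x) \<partial>lebesgue) \<le> ennreal ((1/4) ^ n)" for n
  proof -
    have "4 ^ n * (\<integral>x. (norm (f (Suc n) x - f n x))\<^sup>2 \<partial>lebesgue) \<le> 4 ^ n * ((1/4) ^ n)\<^sup>2"
      using fast by (intro mult_left_mono) auto
    also have "\<dots> = (1/4) ^ n" by (simp add: power2_eq_square field_simps)
    finally show ?thesis using h_integrable by (subst nn_integral_eq_integral) (auto intro: ennreal_leI)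
  qed
  then have "(\<Sum>n. \<integral>\<^sup>+x. ennreal (?h n x) \<partial>lebesgue) \<le> (\<Sum>n. ennreal ((1/4) ^ n))" by (intro suminf_le) auto
  also have "\<dots> = ennreal (\<Sum>n. (1/4) ^ n)" by (intro suminf_ennreal2) (auto intro: summable_geometric)
  finally have "(\<Sum>n. \<integral>\<^sup>+x. ennreal (?h n x) \<partial>lebesgue) < \<infinity>" by (simp add: le_less_trans)
  with borel_measurable_integrable[OF h_integrable]
  have "AE x in lebesgue. \<exists>C\<ge>0. \<forall>n. ?h n x \<le> C" by (intro AE_bounded_if_nn_integrals_summable)
  then show ?thesis by eventually_elim (auto intro: convergent_if_increments_geometric)
qed

theorem riesz_fischer:
  assumes f: "\<And>n. sq_integrable (f n)"
    and fast: "\<And>k m n. k \<le> m \<Longrightarrow> k \<le> n \<Longrightarrow> (\<integral>x. (norm (f m x - f n x))\<^sup>2 \<partial>lebesgue) \<le> ((1/4) ^ k)\<^sup>2"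
  shows "\<exists>F. sq_integrable F \<and> (\<forall>m. sq_integrable (\<lambda>x. F x - f m x)
    \<and> (\<integral>x. (norm (F x - f m x))\<^sup>2 \<partial>lebesgue) \<le> ((1/4) ^ m)\<^sup>2)"
proof -
  define F where "F x = lim (\<lambda>n. f n x)" for x
  have F_measurable: "F \<in> borel_measurable lebesgue"
    unfolding F_def by (intro borel_measurable_lim_metric sq_integrable_measurable f)
  have "AE x in lebesgue. convergent (\<lambda>n. f n x)" by (intro AE_convergent_if_fast_Cauchy f fast) auto
  then have F_limit: "AE x in lebesgue. (\<lambda>n. f n x) \<longlonglongrightarrow> F x"
    by eventually_elim (simp add: F_def convergent_LIMSEQ_iff)
  have F_diff: "sq_integrable (\<lambda>x. F x - f m x)"
    "(\<integral>x. (norm (F x - f m x))\<^sup>2 \<partial>lebesgue) \<le> ((1/4) ^ m)\<^sup>2" for m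
  proof -
    have "(\<lambda>x. F x - f m x) \<in> borel_measurable lebesgue"
      by (intro borel_measurable_diff F_measurable sq_integrable_measurable f)
    moreover have "AE x in lebesgue. (\<lambda>n. f n x - f m x) \<longlonglongrightarrow> F x - f m x"
      using F_limit by eventually_elim (auto intro: tendsto_intros)
    ultimately show "sq_integrable (\<lambda>x. F x - f m x)"
      "(\<integral>x. (norm (F x - f m x))\<^sup>2 \<partial>lebesgue) \<le> ((1/4) ^ m)\<^sup>2"
      using sq_integrable_AE_limit[OF sq_integrable_diff[OF f f] _ _ fast[of m _ m]] by auto
  qed
  have "sq_integrable F" using sq_integrable_add[OF F_diff(1)[of 0] f[of 0]] by simp
  with F_diff show ?thesis by blast
qed

lemma Cauchy_fast_subsequence:
  fixes X :: "nat \<Rightarrow> 'a::metric_space"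
  assumes "Cauchy X"
  obtains r where "strict_mono r" "\<And>k m n. k \<le> m \<Longrightarrow> k \<le> n \<Longrightarrow> dist (X (r m)) (X (r n)) < (1/4) ^ k"
proof -
  have "\<exists>M. \<forall>m\<ge>M. \<forall>n\<ge>M. dist (X m) (X n) < (1/4) ^ k" for k :: nat
    using assms by (intro metric_CauchyD) auto
  then obtain M where M: "\<And>k m n. m \<ge> M k \<Longrightarrow> n \<ge> M k \<Longrightarrow> dist (X m) (X n) < (1/4) ^ k" by metis
  define r where "r n = n + (\<Sum>k\<le>n. M k)" for n
  have "strict_mono r" unfolding strict_mono_Suc_iff by (simp add: r_def)
  moreover have "r n \<ge> M k" if "k \<le> n" for k n
    using member_le_sum[of k "{..n}" M] that by (auto simp: r_def)
  ultimately show thesis using M by (intro that) auto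
qed

subsection \<open>Classes modulo null sets\<close>

quotient_type (overloaded) ('a, 'b) l2 = "'a::euclidean_space \<Rightarrow> 'b::euclidean_space" /
  partial: "\<lambda>f g. sq_integrable f \<and> sq_integrable g \<and> (AE x in lebesgue. f x = g x)"
proof (rule part_equivpI)
  let ?R = "\<lambda>(f::'a \<Rightarrow> 'b) g. sq_integrable f \<and> sq_integrable g \<and> (AE x in lebesgue. f x = g x)"
  show "\<exists>f. ?R f f" using sq_integrable_zero by auto
  show "symp ?R" by (auto simp: symp_def elim: eventually_mono)
  show "transp ?R"
  proof (rule transpI)
    fix f g h assume fgh: "?R f g" "?R g h"
    then have "AE x in lebesgue. f x = g x" "AE x in lebesgue. g x = h x" by blast+
    then have "AE x in lebesgue. f x = h x" by eventually_elim simp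
    with fgh show "?R f h" by blast
  qed
qed

lemma sq_integrable_rep: "sq_integrable (rep_l2 u)"
  using Quotient3_rep_reflp[OF Quotient3_l2, of u] by simp

lemma abs_rep_l2: "abs_l2 (rep_l2 u) = u"
  by (rule Quotient3_abs_rep[OF Quotient3_l2])

lemma abs_l2_eq_iff:
  "sq_integrable f \<Longrightarrow> sq_integrable g \<Longrightarrow> abs_l2 f = abs_l2 g \<longleftrightarrow> (AE x in lebesgue. f x = g x)"
  using Quotient3_rel[OF Quotient3_l2, of f g] by auto

lemma rep_abs_l2: "sq_integrable f \<Longrightarrow> AE x in lebesgue. rep_l2 (abs_l2 f) x = f x"
  using abs_l2_eq_iff[OF sq_integrable_rep] abs_rep_l2 by blast

lemma l2_eqI: "AE x in lebesgue. rep_l2 u x = rep_l2 v x \<Longrightarrow> u = v"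
  using abs_l2_eq_iff[OF sq_integrable_rep sq_integrable_rep, of u v] by (simp add: abs_rep_l2)

instantiation l2 :: (euclidean_space, euclidean_space) real_vector
begin

definition "0 = abs_l2 (\<lambda>_. 0)"
definition "u + v = abs_l2 (\<lambda>x. rep_l2 u x + rep_l2 v x)" for u v :: "('a, 'b) l2"
definition "u - v = abs_l2 (\<lambda>x. rep_l2 u x - rep_l2 v x)" for u v :: "('a, 'b) l2"
definition "- u = abs_l2 (\<lambda>x. - rep_l2 u x)" for u :: "('a, 'b) l2"
definition "c *\<^sub>R u = abs_l2 (\<lambda>x. c *\<^sub>R rep_l2 u x)" for u :: "('a, 'b) l2"

lemma rep_l2_plus: "AE x in lebesgue. rep_l2 (u + v) x = rep_l2 u x + rep_l2 v x"
  unfolding plus_l2_def by (intro rep_abs_l2 sq_integrable_add sq_integrable_rep)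

lemma rep_l2_minus: "AE x in lebesgue. rep_l2 (u - v) x = rep_l2 u x - rep_l2 v x"
  unfolding minus_l2_def by (intro rep_abs_l2 sq_integrable_diff sq_integrable_rep)

lemma rep_l2_uminus: "AE x in lebesgue. rep_l2 (- u) x = - rep_l2 u x"
  unfolding uminus_l2_def by (intro rep_abs_l2 sq_integrable_uminus sq_integrable_rep)

lemma rep_l2_scaleR: "AE x in lebesgue. rep_l2 (c *\<^sub>R u) x = c *\<^sub>R rep_l2 u x"
  unfolding scaleR_l2_def by (intro rep_abs_l2 sq_integrable_scaleR sq_integrable_rep)

lemma rep_l2_zero: "AE x in lebesgue. rep_l2 0 x = 0"
  unfolding zero_l2_def by (intro rep_abs_l2 sq_integrable_zero)

instance
proof
  fix a b c :: "('a, 'b) l2" and r s :: real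
  show "a + b + c = a + (b + c)"
    by (rule l2_eqI, use rep_l2_plus[of "a + b" c] rep_l2_plus[of a b] rep_l2_plus[of a "b + c"]
        rep_l2_plus[of b c] in eventually_elim) simp
  show "a + b = b + a"
    by (rule l2_eqI, use rep_l2_plus[of a b] rep_l2_plus[of b a] in eventually_elim) simp
  show "0 + a = a"
    by (rule l2_eqI, use rep_l2_plus[of 0 a] rep_l2_zero in eventually_elim) simp
  show "- a + a = 0"
    by (rule l2_eqI, use rep_l2_plus[of "- a" a] rep_l2_uminus[of a] rep_l2_zero in eventually_elim) simp
  show "a - b = a + - b"
    by (rule l2_eqI, use rep_l2_minus[of a b] rep_l2_plus[of a "- b"] rep_l2_uminus[of b] in
        eventually_elim)
      simp
  show "r *\<^sub>R (a + b) = r *\<^sub>R a + r *\<^sub>R b"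
    by (rule l2_eqI, use rep_l2_scaleR[of r "a + b"] rep_l2_plus[of a b] rep_l2_plus[of "r *\<^sub>R a" "r *\<^sub>R b"]
        rep_l2_scaleR[of r a] rep_l2_scaleR[of r b] in eventually_elim) (simp add: algebra_simps)
  show "(r + s) *\<^sub>R a = r *\<^sub>R a + s *\<^sub>R a"
    by (rule l2_eqI, use rep_l2_scaleR[of "r + s" a] rep_l2_plus[of "r *\<^sub>R a" "s *\<^sub>R a"]
        rep_l2_scaleR[of r a]
        rep_l2_scaleR[of s a] in eventually_elim) (simp add: algebra_simps)
  show "r *\<^sub>R s *\<^sub>R a = (r * s) *\<^sub>R a"
    by (rule l2_eqI, use rep_l2_scaleR[of r "s *\<^sub>R a"] rep_l2_scaleR[of s a] rep_l2_scaleR[of "r * s" a]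
        in eventually_elim) simp
  show "1 *\<^sub>R a = a" by (rule l2_eqI, use rep_l2_scaleR[of 1 a] in eventually_elim) simp
qed

end

lemma rep_l2_linear: "AE x in lebesgue. rep_l2 (u + c *\<^sub>R v) x = rep_l2 u x + c *\<^sub>R rep_l2 v x"
  using rep_l2_plus[of u "c *\<^sub>R v"] rep_l2_scaleR[of c v] by eventually_elim simp

instantiation l2 :: (euclidean_space, euclidean_space) real_inner
begin

definition "u \<bullet> v = (\<integral>x. rep_l2 u x \<bullet> rep_l2 v x \<partial>lebesgue)" for u v :: "('a, 'b) l2"
definition "norm u = sqrt (u \<bullet> u)" for u :: "('a, 'b) l2"
definition "dist u v = norm (u - v)" for u v :: "('a, 'b) l2"
definition "sgn u = u /\<^sub>R norm u" for u :: "('a, 'b) l2"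
definition "(uniformity :: (('a, 'b) l2 \<times> ('a, 'b) l2) filter)
    = (INF e\<in>{0<..}. principal {(x, y). dist x y < e})"
definition "open S = (\<forall>x\<in>S. \<forall>\<^sub>F (x', y) in uniformity. x' = x \<longrightarrow> y \<in> S)" for S :: "('a, 'b) l2 set"

lemma inner_l2_eq_integral:
  assumes "AE x in lebesgue. rep_l2 u x = f x" "AE x in lebesgue. rep_l2 v x = g x"
    and "sq_integrable f" "sq_integrable g"
  shows "u \<bullet> v = (\<integral>x. f x \<bullet> g x \<partial>lebesgue)"
  unfolding inner_l2_def
proof (rule integral_cong_AE)
  show "AE x in lebesgue. rep_l2 u x \<bullet> rep_l2 v x = f x \<bullet> g x" using assms(1,2) by eventually_elim simp
qed (intro borel_measurable_inner sq_integrable_measurable sq_integrable_rep assms)+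

instance
proof
  fix a b c :: "('a, 'b) l2" and r :: real
  show "a \<bullet> b = b \<bullet> a" by (simp add: inner_l2_def inner_commute)
  have "(a + b) \<bullet> c = (\<integral>x. (rep_l2 a x + rep_l2 b x) \<bullet> rep_l2 c x \<partial>lebesgue)"
    by (intro inner_l2_eq_integral rep_l2_plus sq_integrable_add sq_integrable_rep) auto
  also have "\<dots> = a \<bullet> c + b \<bullet> c"
    unfolding inner_add_left inner_l2_def
    by (intro Bochner_Integration.integral_add sq_integrable_inner sq_integrable_rep)
  finally show "(a + b) \<bullet> c = a \<bullet> c + b \<bullet> c" .
  have "(r *\<^sub>R a) \<bullet> b = (\<integral>x. (r *\<^sub>R rep_l2 a x) \<bullet> rep_l2 b x \<partial>lebesgue)"
    by (intro inner_l2_eq_integral rep_l2_scaleR sq_integrable_scaleR sq_integrable_rep) auto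
  also have "\<dots> = r * (a \<bullet> b)" unfolding inner_l2_def by simp
  finally show "(r *\<^sub>R a) \<bullet> b = r * (a \<bullet> b)" .
  show "0 \<le> a \<bullet> a" by (simp add: inner_l2_def)
  show "(a \<bullet> a = 0) = (a = 0)"
  proof
    assume "a \<bullet> a = 0"
    then have "AE x in lebesgue. rep_l2 a x \<bullet> rep_l2 a x = 0"
      unfolding inner_l2_def
      by (subst (asm) integral_nonneg_eq_0_iff_AE) (auto intro: sq_integrable_inner sq_integrable_rep)
    then have "AE x in lebesgue. rep_l2 a x = rep_l2 0 x" using rep_l2_zero by eventually_elim simp
    then show "a = 0" by (rule l2_eqI)
  next
    assume "a = 0"
    then have "a \<bullet> a = (\<integral>x. 0 \<bullet> (0::'b) \<partial>(lebesgue :: 'a measure))"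
      by (intro inner_l2_eq_integral) (use rep_l2_zero sq_integrable_zero in auto)
    then show "a \<bullet> a = 0" by simp
  qed
qed (auto simp: norm_l2_def dist_l2_def sgn_l2_def uniformity_l2_def open_l2_def)

end

lemma norm_sq_l2_eq_integral:
  assumes "AE x in lebesgue. rep_l2 u x = f x" "sq_integrable f"
  shows "(norm u)\<^sup>2 = (\<integral>x. (norm (f x))\<^sup>2 \<partial>lebesgue)"
  unfolding power2_norm_eq_inner by (intro inner_l2_eq_integral assms)

instance l2 :: (euclidean_space, euclidean_space) banach
proof
  fix X :: "nat \<Rightarrow> ('a, 'b) l2" assume X: "Cauchy X"
  obtain r where r: "strict_mono r" "\<And>k m n. k \<le> m \<Longrightarrow> k \<le> n \<Longrightarrow> dist (X (r m)) (X (r n)) < (1/4) ^ k"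
    using Cauchy_fast_subsequence[OF X] by blast
  define f where "f n = rep_l2 (X (r n))" for n
  have f: "sq_integrable (f n)" for n by (simp add: f_def sq_integrable_rep)
  have "(\<integral>x. (norm (f m x - f n x))\<^sup>2 \<partial>lebesgue) \<le> ((1/4) ^ k)\<^sup>2" if "k \<le> m" "k \<le> n" for k m n
  proof -
    have "(norm (X (r m) - X (r n)))\<^sup>2 = (\<integral>x. (norm (f m x - f n x))\<^sup>2 \<partial>lebesgue)"
      unfolding f_def by (intro norm_sq_l2_eq_integral rep_l2_minus sq_integrable_diff sq_integrable_rep)
    moreover have "(norm (X (r m) - X (r n)))\<^sup>2 \<le> ((1/4) ^ k)\<^sup>2"
      using r(2)[OF that] by (intro power_mono) (auto simp: dist_norm)
    ultimately show ?thesis by simp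
  qed
  from riesz_fischer[of f, OF f this] obtain F where F: "sq_integrable F"
    "\<And>m. sq_integrable (\<lambda>x. F x - f m x)" "\<And>m. (\<integral>x. (norm (F x - f m x))\<^sup>2 \<partial>lebesgue) \<le> ((1/4) ^ m)\<^sup>2"
    by blast
  have "norm (X (r m) - abs_l2 F) \<le> (1/4) ^ m" for m
  proof (rule power2_le_imp_le)
    have "AE x in lebesgue. rep_l2 (abs_l2 F - X (r m)) x = F x - f m x"
      using rep_l2_minus[of "abs_l2 F" "X (r m)"] rep_abs_l2[OF F(1)] by eventually_elim (simp add: f_def)
    then show "(norm (X (r m) - abs_l2 F))\<^sup>2 \<le> ((1/4) ^ m)\<^sup>2"
      unfolding norm_minus_commute[of "X (r m)"] using F(2,3) by (simp add: norm_sq_l2_eq_integral)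
  qed simp
  then have "\<forall>\<^sub>F m in sequentially. norm (X (r m) - abs_l2 F) \<le> (1/4) ^ m" by (intro always_eventually allI)
  moreover have "(\<lambda>m. (1/4) ^ m) \<longlonglongrightarrow> (0::real)" by (rule LIMSEQ_power_zero) simp
  ultimately have "(\<lambda>m. X (r m) - abs_l2 F) \<longlonglongrightarrow> 0" by (rule Lim_null_comparison)
  then have "(X \<circ> r) \<longlonglongrightarrow> abs_l2 F" unfolding o_def by (rule LIM_zero_cancel)
  then show "convergent X" by (rule convergentI[OF Cauchy_converges_subseq[OF X r(1)]])
qed

section \<open>Test functions\<close>

subsection \<open>Smooth functions\<close>

lemma smooth_fun_coinduct:
  assumes "P f" "\<And>f x. P f \<Longrightarrow> f differentiable (at x)"
    and "\<And>f e. P f \<Longrightarrow> P (\<lambda>x. frechet_derivative f (at x) e)"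
  shows "smooth_fun f"
proof -
  have "P (dderiv es f)" for es by (induction es) (use assms in auto)
  then show ?thesis unfolding smooth_fun_def using assms(2) by blast
qed

lemma smooth_fun_differentiable: "smooth_fun f \<Longrightarrow> f differentiable (at x)"
  unfolding smooth_fun_def by (drule spec[of _ "[]"]) simp

lemma smooth_fun_has_derivative: "smooth_fun f \<Longrightarrow> (f has_derivative frechet_derivative f (at x)) (at x)"
  using smooth_fun_differentiable frechet_derivative_works by blast

lemma smooth_fun_continuous: "smooth_fun f \<Longrightarrow> continuous_on UNIV f"
  by (meson continuous_at_imp_continuous_on differentiable_imp_continuous_within smooth_fun_differentiable)

lemma smooth_fun_continuous_derivative:
  assumes "smooth_fun f"
  shows "continuous_on UNIV (\<lambda>x. frechet_derivative f (at x) e)"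
proof -
  have "dderiv [e] f differentiable (at x)" for x
    using assms by (simp add: smooth_fun_def del: dderiv.simps)
  then show ?thesis by (simp add: continuous_at_imp_continuous_on differentiable_imp_continuous_within)
qed

lemma frechet_derivative_linear_combination:
  fixes f g :: "'a::real_normed_vector \<Rightarrow> real"
  assumes "f differentiable (at x)" "g differentiable (at x)"
  shows "frechet_derivative (\<lambda>x. f x + c * g x) (at x) e
    = frechet_derivative f (at x) e + c * frechet_derivative g (at x) e"
proof -
  have "((\<lambda>x. f x + c * g x) has_derivative
      (\<lambda>e. frechet_derivative f (at x) e + c * frechet_derivative g (at x) e)) (at x)"
    using assms by (auto intro!: derivative_eq_intros simp: frechet_derivative_works)
  from frechet_derivative_at[OF this, symmetric] show ?thesis by simp
qed

lemma smooth_fun_linear: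
  assumes f: "smooth_fun f" and g: "smooth_fun g"
  shows "smooth_fun (\<lambda>x. f x + c * g x)"
proof -
  have "dderiv es (\<lambda>x. f x + c * g x) = (\<lambda>x. dderiv es f x + c * dderiv es g x)" for es
    by (induction es)
      (use f g in \<open>simp_all add: smooth_fun_def frechet_derivative_linear_combination\<close>)
  then show ?thesis using f g by (auto simp: smooth_fun_def intro!: derivative_intros)
qed

lemma smooth_fun_zero: "smooth_fun (\<lambda>x. 0)"
  by (rule smooth_fun_coinduct[of "\<lambda>f. f = (\<lambda>x. 0)"]) auto

lemma test_fun_smooth: "test_fun U \<phi> \<Longrightarrow> smooth_fun \<phi>"
  by (simp add: test_fun_def)

lemma test_funI:
  assumes "smooth_fun \<phi>" "compact K" "K \<subseteq> U" "\<And>x. x \<notin> K \<Longrightarrow> \<phi> x = 0"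
  shows "test_fun U \<phi>"
proof -
  have "{x. \<phi> x \<noteq> 0} \<subseteq> K" using assms(4) by blast
  then have "closure {x. \<phi> x \<noteq> 0} \<subseteq> K" using assms(2) by (intro closure_minimal compact_imp_closed)
  moreover from this have "compact (closure {x. \<phi> x \<noteq> 0})"
    using assms(2) by (metis closed_closure compact_Int_closed inf.absorb_iff2)
  ultimately show ?thesis using assms by (auto simp: test_fun_def)
qed

lemma frechet_derivative_eq_zero_off_closed:
  fixes f :: "'a::real_normed_vector \<Rightarrow> 'b::real_normed_vector"
  assumes "closed K" "\<And>x. x \<notin> K \<Longrightarrow> f x = 0" "x \<notin> K" "(f has_derivative f') (at x)"
  shows "f' e = 0"
proof -
  have "(f has_derivative (\<lambda>_. 0)) (at x)"
    by (rule has_derivative_transform_within_open[of "\<lambda>_. 0" _ _ _ "- K"]) (use assms in auto)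
  with assms(4) have "f' = (\<lambda>_. 0)" by (rule has_derivative_unique)
  then show ?thesis by simp
qed

lemma test_fun_support:
  assumes "test_fun U \<phi>"
  shows "\<exists>K. compact K \<and> K \<subseteq> U \<and> (\<forall>x. x \<notin> K \<longrightarrow> \<phi> x = 0)"
  using assms closure_subset[of "{x. \<phi> x \<noteq> 0}"] unfolding test_fun_def
  by (intro exI[of _ "closure {x. \<phi> x \<noteq> 0}"]) auto

lemma test_fun_zero: "test_fun U (\<lambda>x. 0)"
  by (simp add: test_fun_def smooth_fun_zero)

lemma test_fun_linear:
  assumes f: "test_fun U f" and g: "test_fun U g"
  shows "test_fun U (\<lambda>x. f x + c * g x)"
proof -
  obtain K where K: "compact K" "K \<subseteq> U" "\<forall>x. x \<notin> K \<longrightarrow> f x = 0" using test_fun_support[OF f] by blast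
  obtain K' where K': "compact K'" "K' \<subseteq> U" "\<forall>x. x \<notin> K' \<longrightarrow> g x = 0" using test_fun_support[OF g] by blast
  show ?thesis
  proof (rule test_funI)
    show "smooth_fun (\<lambda>x. f x + c * g x)"
      by (intro smooth_fun_linear test_fun_smooth[OF f] test_fun_smooth[OF g])
    show "compact (K \<union> K')" by (rule compact_Un[OF K(1) K'(1)])
  qed (use K K' in auto)
qed

subsection \<open>Bump functions on boxes\<close>

definition flat :: "nat \<Rightarrow> real \<Rightarrow> real \<Rightarrow> real" where
  "flat n k s = (if s > 0 then (1 / s) ^ n * exp (- k / s) else 0)"

lemma flat_limit:
  assumes k: "k > 0"
  shows "((\<lambda>s. (1 / s) ^ n * exp (- k / s)) \<longlongrightarrow> 0) (at_right (0::real))"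
proof -
  have "filterlim (\<lambda>s. k * inverse s) at_top (at_right (0::real))"
    using k by (intro filterlim_tendsto_pos_mult_at_top[OF tendsto_const] filterlim_inverse_at_top_right)
  from filterlim_compose[OF tendsto_power_div_exp_0[of n] this]
  have "((\<lambda>s. (1 / k ^ n) * ((k * inverse s) ^ n / exp (k * inverse s))) \<longlongrightarrow> (1 / k ^ n) * 0) (at_right 0)"
    by (intro tendsto_mult_left)
  moreover have "(1 / k ^ n) * ((k * inverse s) ^ n / exp (k * inverse s)) = (1 / s) ^ n * exp (- k / s)"
    for s
    using k by (simp add: power_mult_distrib exp_minus divide_inverse power_inverse)
  ultimately show ?thesis by simp
qed

lemma flat_derivative_pos:
  assumes s: "s > 0"
  shows "(flat n k has_real_derivative (- real n * flat (n + 1) k s + k * flat (n + 2) k s)) (at s)"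
proof -
  let ?y = "inverse s"
  let ?D = "real n * (- (?y ^ Suc (Suc 0)) * ?y ^ (n - Suc 0)) * exp (- k * ?y)
    + exp (- k * ?y) * (- k * - (?y ^ Suc (Suc 0))) * ?y ^ n"
  have "(inverse has_real_derivative - (?y ^ Suc (Suc 0))) (at s)" using s by (intro DERIV_inverse) simp
  then have "((\<lambda>s. inverse s ^ n * exp (- k * inverse s)) has_real_derivative ?D) (at s)"
    by (intro DERIV_mult[OF DERIV_power DERIV_fun_exp[OF DERIV_cmult]])
  then have "(flat n k has_real_derivative ?D) (at s)"
    by (rule has_field_derivative_transform_within_open[where S="{0<..}"])
      (use s in \<open>auto simp: flat_def inverse_eq_divide\<close>)
  moreover have "?D = - real n * flat (n + 1) k s + k * flat (n + 2) k s"
    using s by (cases n) (simp_all add: flat_def inverse_eq_divide field_simps)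
  ultimately show ?thesis by (simp only:)
qed

lemma flat_derivative_zero:
  assumes k: "k > 0"
  shows "(flat n k has_real_derivative 0) (at 0)"
  unfolding DERIV_def filterlim_at_split
proof
  show "((\<lambda>h. (flat n k (0 + h) - flat n k 0) / h) \<longlongrightarrow> 0) (at_left 0)"
    by (rule tendsto_eventually) (auto simp: flat_def eventually_at_filter)
  have "\<forall>\<^sub>F h in at_right 0. (1 / h) ^ (n + 1) * exp (- k / h) = (flat n k (0 + h) - flat n k 0) / h"
    by (auto simp: flat_def eventually_at_filter)
  from Lim_transform_eventually[OF flat_limit[OF k] this]
  show "((\<lambda>h. (flat n k (0 + h) - flat n k 0) / h) \<longlongrightarrow> 0) (at_right 0)" .
qed

lemma flat_derivative:
  assumes k: "k > 0"
  shows "(flat n k has_real_derivative (- real n * flat (n + 1) k s + k * flat (n + 2) k s)) (at s)"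
proof -
  consider (pos) "s > 0" | (neg) "s < 0" | (zero) "s = 0" by linarith
  then show ?thesis
  proof cases
    case neg
    have "((\<lambda>s. 0) has_real_derivative (- real n * flat (n + 1) k s + k * flat (n + 2) k s)) (at s)"
      using neg by (simp add: flat_def)
    then show ?thesis
      by (rule has_field_derivative_transform_within_open[where S="{..<0}"])
        (use neg in \<open>auto simp: flat_def\<close>)
  next
    case zero
    then show ?thesis using flat_derivative_zero[OF k] by (simp add: flat_def)
  qed (rule flat_derivative_pos)
qed

text \<open>An algebra of functions closed under differentiation, from which \<open>box_bump\<close> gets its smoothness.\<close>
inductive flat_algebra :: "('a::euclidean_space \<Rightarrow> real) \<Rightarrow> bool" where
  const: "flat_algebra (\<lambda>x. c)"
| ridge: "k > 0 \<Longrightarrow> flat_algebra (\<lambda>x. flat n k (x \<bullet> u + c))"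
| add: "flat_algebra f \<Longrightarrow> flat_algebra g \<Longrightarrow> flat_algebra (\<lambda>x. f x + g x)"
| mult: "flat_algebra f \<Longrightarrow> flat_algebra g \<Longrightarrow> flat_algebra (\<lambda>x. f x * g x)"

definition flat_algebra_derivatives :: "('a::euclidean_space \<Rightarrow> real) \<Rightarrow> bool" where
  "flat_algebra_derivatives f \<longleftrightarrow> (\<forall>x. f differentiable (at x))
    \<and> (\<forall>e. flat_algebra (\<lambda>x. frechet_derivative f (at x) e))"

lemma flat_algebra_derivativesI:
  assumes "\<And>x. (f has_derivative f' x) (at x)" "\<And>e. flat_algebra (\<lambda>x. f' x e)"
  shows "flat_algebra_derivatives f"
proof -
  have "frechet_derivative f (at x) = f' x" for x using frechet_derivative_at[OF assms(1)] by simp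
  then show ?thesis using assms by (auto simp: flat_algebra_derivatives_def differentiable_def)
qed

lemma flat_algebra_derivativesD:
  "flat_algebra_derivatives f \<Longrightarrow> (f has_derivative frechet_derivative f (at x)) (at x)"
  "flat_algebra_derivatives f \<Longrightarrow> flat_algebra (\<lambda>x. frechet_derivative f (at x) e)"
  by (auto simp: flat_algebra_derivatives_def simp flip: frechet_derivative_works)

lemma flat_algebra_derivative: "flat_algebra f \<Longrightarrow> flat_algebra_derivatives f"
proof (induction rule: flat_algebra.induct)
  case (const c)
  show ?case by (rule flat_algebra_derivativesI[OF has_derivative_const]) (rule flat_algebra.const)
next
  case (ridge k n u c)
  let ?D = "\<lambda>x. - real n * flat (n + 1) k (x \<bullet> u + c) + k * flat (n + 2) k (x \<bullet> u + c)"
  show ?case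
  proof (rule flat_algebra_derivativesI)
    show "((\<lambda>x. flat n k (x \<bullet> u + c)) has_derivative (\<lambda>e. (e \<bullet> u) * ?D x)) (at x)" for x
      by (rule has_derivative_compose[OF _ flat_derivative[OF ridge, THEN has_field_derivative_imp_has_derivative],
            THEN has_derivative_eq_rhs]) (auto intro!: derivative_eq_intros simp: mult.commute)
    show "flat_algebra (\<lambda>x. (e \<bullet> u) * ?D x)" for e using ridge by (intro flat_algebra.intros)
  qed
next
  case (add f g)
  show ?case
    by (rule flat_algebra_derivativesI[OF has_derivative_add])
      (use add.IH in \<open>auto intro: flat_algebra_derivativesD flat_algebra.add\<close>)
next
  case (mult f g)
  show ?case
    by (rule flat_algebra_derivativesI[OF has_derivative_mult])
      (use add mult in \<open>auto intro!: flat_algebra_derivativesD flat_algebra.add flat_algebra.mult\<close>)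
qed

lemma flat_algebra_smooth: "flat_algebra f \<Longrightarrow> smooth_fun f"
  by (rule smooth_fun_coinduct[of flat_algebra])
    (use flat_algebra_derivative in \<open>auto simp: flat_algebra_derivatives_def\<close>)

lemma flat_algebra_prod:
  assumes "finite I" "\<And>i. i \<in> I \<Longrightarrow> flat_algebra (f i)"
  shows "flat_algebra (\<lambda>x. \<Prod>i\<in>I. f i x)"
  using assms by (induction I) (auto intro: flat_algebra.intros)

definition box_bump :: "real \<Rightarrow> 'a::euclidean_space \<Rightarrow> 'a \<Rightarrow> 'a \<Rightarrow> real" where
  "box_bump k a b x = (\<Prod>i\<in>Basis. flat 0 k (x \<bullet> i - a \<bullet> i) * flat 0 k (b \<bullet> i - x \<bullet> i))"

lemma box_bump_smooth:
  assumes "k > 0"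
  shows "smooth_fun (box_bump k a b)"
proof -
  have "flat_algebra (\<lambda>x. \<Prod>i\<in>Basis. flat 0 k (x \<bullet> i + (- (a \<bullet> i))) * flat 0 k (x \<bullet> (- i) + b \<bullet> i))"
    using assms by (intro flat_algebra_prod flat_algebra.mult flat_algebra.ridge) auto
  from flat_algebra_smooth[OF this] show ?thesis by (simp add: box_bump_def[abs_def])
qed

lemma box_bump_bounds:
  assumes "k > 0"
  shows "0 \<le> box_bump k a b x" "box_bump k a b x \<le> 1"
proof -
  have "0 \<le> flat 0 k s" "flat 0 k s \<le> 1" for s using assms by (auto simp: flat_def)
  then show "0 \<le> box_bump k a b x" "box_bump k a b x \<le> 1"
    unfolding box_bump_def by (auto intro!: prod_nonneg prod_le_1 mult_le_one)
qed

lemma box_bump_outside: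
  assumes "x \<notin> box a b"
  shows "box_bump k a b x = 0"
proof -
  obtain i where "i \<in> Basis" "\<not> (a \<bullet> i < x \<bullet> i \<and> x \<bullet> i < b \<bullet> i)" using assms unfolding mem_box by blast
  then show ?thesis unfolding box_bump_def by (intro prod_zero) (auto simp: flat_def intro!: bexI[of _ i])
qed

lemma box_bump_test_fun:
  assumes "k > 0" "cbox a b \<subseteq> U"
  shows "test_fun U (box_bump k a b)"
  by (rule test_funI[OF box_bump_smooth[OF assms(1)] compact_cbox assms(2)])
    (use box_bump_outside box_subset_cbox in blast)

lemma box_bump_limit: "(\<lambda>m. box_bump (1 / real (Suc m)) a b x) \<longlonglongrightarrow> indicator (box a b) x"
proof (cases "x \<in> box a b")
  case True
  have flat_limit_one: "(\<lambda>m. flat 0 (1 / real (Suc m)) s) \<longlonglongrightarrow> 1" if "s > 0" for s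
  proof -
    have "(\<lambda>m. exp (- (1 / real (Suc m)) / s)) \<longlonglongrightarrow> exp (- 0 / s)"
      using that by (intro tendsto_intros LIMSEQ_Suc[OF lim_1_over_n]) auto
    then show ?thesis using that by (simp add: flat_def)
  qed
  have "(\<lambda>m. box_bump (1 / real (Suc m)) a b x) \<longlonglongrightarrow> (\<Prod>i\<in>(Basis::'a set). 1 * 1)"
    unfolding box_bump_def using True
    by (intro tendsto_prod tendsto_mult flat_limit_one) (auto simp: mem_box)
  then show ?thesis using True by simp
qed (simp add: box_bump_outside)

subsection \<open>The fundamental lemma of the calculus of variations\<close>

lemma lebesgue_on_indicator:
  fixes f :: "'a::euclidean_space \<Rightarrow> 'b::euclidean_space"
  assumes "U \<in> sets lebesgue"
  shows "integral\<^sup>L (lebesgue_on U) f = (\<integral>x. indicator U x *\<^sub>R f x \<partial>lebesgue)"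
    "integrable (lebesgue_on U) f \<longleftrightarrow> integrable lebesgue (\<lambda>x. indicator U x *\<^sub>R f x)"
    "f \<in> borel_measurable (lebesgue_on U) \<longleftrightarrow> (\<lambda>x. indicator U x *\<^sub>R f x) \<in> borel_measurable lebesgue"
  using assms
  by (auto intro!: integral_restrict_space integrable_restrict_space borel_measurable_restrict_space_iff)

lemma sq_integrable_indicator_cbox: "sq_integrable (indicator (cbox a b) :: 'a::euclidean_space \<Rightarrow> real)"
  unfolding sq_integrable_def
proof
  have "(\<lambda>x. (norm (indicator (cbox a b) x :: real))\<^sup>2) = indicator (cbox a b)"
    by (auto simp: indicator_def fun_eq_iff)
  moreover have "integrable lebesgue (indicator (cbox a b) :: 'a \<Rightarrow> real)"
    using lmeasurable_cbox[of a b] by (intro integrable_real_indicator) (auto simp: fmeasurable_def)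
  ultimately show "integrable lebesgue (\<lambda>x. (norm (indicator (cbox a b) x :: real))\<^sup>2)" by simp
qed (auto intro: borel_measurable_indicator)

lemma sq_integrable_cbox_set_integrable:
  fixes f :: "'a::euclidean_space \<Rightarrow> real"
  assumes "sq_integrable f"
  shows "f absolutely_integrable_on cbox a b"
  using sq_integrable_inner[OF sq_integrable_indicator_cbox assms] by (simp add: set_integrable_def)

lemma cube_subset_open:
  fixes x :: "'a::euclidean_space"
  assumes "open U" "x \<in> U"
  shows "\<forall>\<^sub>F h in at_right 0. cbox x (x + h *\<^sub>R One) \<subseteq> U"
proof -
  obtain a b where ab: "cbox a b \<subseteq> U" "x \<in> box a b" using open_contains_cbox[OF assms] by metis
  have "((\<lambda>h. x + h *\<^sub>R One) \<longlongrightarrow> x + 0 *\<^sub>R One) (at_right 0)" by (intro tendsto_intros)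
  then have "\<forall>\<^sub>F h in at_right 0. x + h *\<^sub>R One \<in> box a b" using ab(2) by (intro topological_tendstoD) auto
  then show ?thesis
  proof eventually_elim
    case (elim h)
    have "cbox x (x + h *\<^sub>R One) \<subseteq> cbox a b" using ab(2) elim by (auto simp: mem_box subset_box less_imp_le)
    then show ?case using ab(1) by blast
  qed
qed

lemma AE_zero_if_cbox_integrals_zero:
  fixes f :: "'a::euclidean_space \<Rightarrow> 'b::euclidean_space"
  assumes f: "\<And>a b. f integrable_on cbox a b" and U: "open U"
    and zero: "\<And>a b. cbox a b \<subseteq> U \<Longrightarrow> integral (cbox a b) f = 0"
  shows "AE x in lebesgue. x \<in> U \<longrightarrow> f x = 0"
proof -
  obtain N where N: "negligible N" "\<And>x e. x \<notin> N \<Longrightarrow> 0 < e \<Longrightarrow> \<exists>d>0. \<forall>h. 0 < h \<and> h < d \<longrightarrow>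
      norm (integral (cbox x (x + h *\<^sub>R One)) f /\<^sub>R h ^ DIM('a) - f x) < e"
    using integrable_ccontinuous_explicit[OF f] by metis
  have "f x = 0" if x: "x \<in> U" "x \<notin> N" for x
  proof (rule ccontr)
    assume "f x \<noteq> 0"
    then obtain d where "d > 0" and "\<forall>h. 0 < h \<and> h < d \<longrightarrow>
        norm (integral (cbox x (x + h *\<^sub>R One)) f /\<^sub>R h ^ DIM('a) - f x) < norm (f x)"
      using N(2)[OF x(2), of "norm (f x)"] by auto
    then have "\<forall>\<^sub>F h in at_right 0. norm (integral (cbox x (x + h *\<^sub>R One)) f /\<^sub>R h ^ DIM('a) - f x)
        < norm (f x)"
      unfolding eventually_at_right_field by (intro exI[of _ d]) auto
    with cube_subset_open[OF U x(1)] have "\<forall>\<^sub>F h::real in at_right 0. False"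
      by eventually_elim (simp add: zero)
    then show False by simp
  qed
  moreover have "AE x in lebesgue. x \<notin> N" using N(1) negligible_iff_null_sets by (intro AE_not_in) auto
  ultimately show ?thesis by (auto elim: eventually_mono)
qed

lemma box_integral_zero_if_orthogonal_to_test_funs:
  fixes D :: "'a::euclidean_space \<Rightarrow> real"
  assumes D: "sq_integrable D" and orthogonal: "\<And>\<phi>. test_fun U \<phi> \<Longrightarrow> (\<integral>x. D x * \<phi> x \<partial>lebesgue) = 0"
    and ab: "cbox a b \<subseteq> U"
  shows "integral (cbox a b) D = 0"
proof -
  let ?\<phi> = "\<lambda>m. box_bump (1 / real (Suc m)) a b"
  have "(\<lambda>m. \<integral>x. D x * ?\<phi> m x \<partial>lebesgue) \<longlonglongrightarrow> (\<integral>x. D x * indicator (box a b) x \<partial>lebesgue)"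
  proof (rule integral_dominated_convergence)
    show "integrable lebesgue (\<lambda>x. \<bar>D x * indicator (cbox a b) x\<bar>)"
      using sq_integrable_inner[OF D sq_integrable_indicator_cbox[of a b]] by (intro integrable_abs) simp
    show "AE x in lebesgue. (\<lambda>m. D x * ?\<phi> m x) \<longlonglongrightarrow> D x * indicator (box a b) x"
      by (intro AE_I2 tendsto_intros box_bump_limit)
    have "\<bar>?\<phi> m x\<bar> \<le> indicator (cbox a b) x" for m x
      using box_bump_bounds[of "1 / real (Suc m)" a b x] box_bump_outside[of x a b] box_subset_cbox[of a b]
      by (cases "x \<in> box a b") (auto simp: indicator_def simp del: of_nat_Suc)
    then show "AE x in lebesgue. norm (D x * ?\<phi> m x) \<le> \<bar>D x * indicator (cbox a b) x\<bar>" for m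
      by (intro AE_I2) (simp add: abs_mult mult_left_mono del: of_nat_Suc)
    show "(\<lambda>x. D x * indicator (box a b) x) \<in> borel_measurable lebesgue"
      using sq_integrable_measurable[OF D]
      by (intro borel_measurable_times borel_measurable_indicator) auto
    show "(\<lambda>x. D x * ?\<phi> m x) \<in> borel_measurable lebesgue" for m
      using smooth_fun_continuous[OF box_bump_smooth, of "1 / real (Suc m)" a b]
      by (intro borel_measurable_times[OF sq_integrable_measurable[OF D] measurable_completion])
        (simp add: borel_measurable_continuous_onI)
  qed
  moreover have "(\<integral>x. D x * ?\<phi> m x \<partial>lebesgue) = 0" for m by (intro orthogonal box_bump_test_fun ab) simp
  ultimately have zero: "(\<integral>x. D x * indicator (box a b) x \<partial>lebesgue) = 0"
    using LIMSEQ_unique[OF _ tendsto_const] by simp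
  have "D absolutely_integrable_on box a b"
    by (rule set_integrable_subset[OF sq_integrable_cbox_set_integrable[OF D, of a b] _ box_subset_cbox])
      auto
  from set_lebesgue_integral_eq_integral(2)[OF this] zero
  show ?thesis unfolding integral_open_interval by (simp add: set_lebesgue_integral_def mult.commute)
qed

theorem fundamental_lemma:
  fixes d :: "'a::euclidean_space \<Rightarrow> real"
  assumes U: "open U" and d: "sq_integrable (\<lambda>x. indicator U x *\<^sub>R d x)"
    and orthogonal: "\<And>\<phi>. test_fun U \<phi> \<Longrightarrow> (\<integral>x. d x * \<phi> x \<partial>lebesgue_on U) = 0"
  shows "AE x in lebesgue_on U. d x = 0"
proof -
  have U_sets: "U \<in> sets lebesgue" using U by auto
  have "AE x in lebesgue. x \<in> U \<longrightarrow> indicator U x *\<^sub>R d x = 0"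
  proof (rule AE_zero_if_cbox_integrals_zero[OF _ U])
    show "(\<lambda>x. indicator U x *\<^sub>R d x) integrable_on cbox a b" for a b
      by (rule set_lebesgue_integral_eq_integral(1)[OF sq_integrable_cbox_set_integrable[OF d]])
    show "integral (cbox a b) (\<lambda>x. indicator U x *\<^sub>R d x) = 0" if "cbox a b \<subseteq> U" for a b
      by (rule box_integral_zero_if_orthogonal_to_test_funs[OF d _ that])
        (use orthogonal in \<open>simp add: lebesgue_on_indicator[OF U_sets] mult.assoc\<close>)
  qed
  then show ?thesis using U_sets by (subst AE_restrict_space_iff) (auto elim: eventually_mono)
qed

subsection \<open>Integration by parts against a Lipschitz function\<close>

lemma lipschitz_extension_UNIV:
  fixes f :: "'a::metric_space \<Rightarrow> real"
  assumes f: "L-lipschitz_on U f"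
  obtains F where "L-lipschitz_on UNIV F" "\<And>x. x \<in> U \<Longrightarrow> F x = f x"
proof (cases "U = {}")
  case True
  have "L-lipschitz_on UNIV (\<lambda>_::'a. 0::real)"
    using lipschitz_on_nonneg[OF f] by (intro lipschitz_onI) auto
  then show thesis using that True by blast
next
  case False
  then obtain u\<^sub>0 where u\<^sub>0: "u\<^sub>0 \<in> U" by blast
  have L: "L \<ge> 0" by (rule lipschitz_on_nonneg[OF f])
  have f_le: "f u - f v \<le> L * dist u v" if "u \<in> U" "v \<in> U" for u v
    using lipschitz_onD[OF f that] by (simp add: dist_real_def)
  define F where "F x = (INF u\<in>U. f u + L * dist x u)" for x
  have "f u\<^sub>0 - L * dist x u\<^sub>0 \<le> f u + L * dist x u" if "u \<in> U" for x u
    using f_le[OF u\<^sub>0 that] mult_left_mono[OF dist_triangle3[of u\<^sub>0 u x] L] by (simp add: distrib_left)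
  then have bdd: "bdd_below ((\<lambda>u. f u + L * dist x u) ` U)" for x by (intro bdd_belowI2)
  have F_le: "F x \<le> f u + L * dist x u" if "u \<in> U" for x u
    unfolding F_def by (rule cINF_lower[OF bdd that])
  have F_diff: "F x - F y \<le> L * dist x y" for x y
  proof -
    have "F x - L * dist x y \<le> f u + L * dist y u" if "u \<in> U" for u
      using F_le[OF that, of x] mult_left_mono[OF dist_triangle[of x u y] L] by (simp add: distrib_left)
    then have "F x - L * dist x y \<le> F y" unfolding F_def[of y] by (intro cINF_greatest False)
    then show ?thesis by simp
  qed
  show thesis
  proof
    have "dist (F x) (F y) \<le> L * dist x y" for x y
      using F_diff[of x y] F_diff[of y x] by (simp add: dist_real_def abs_le_iff dist_commute)
    with L show "L-lipschitz_on UNIV F" by (intro lipschitz_onI)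
    show "F x = f x" if "x \<in> U" for x
    proof (rule antisym)
      show "F x \<le> f x" using F_le[OF that, of x] by simp
      show "f x \<le> F x"
        unfolding F_def using f_le[OF that]
        by (intro cINF_greatest False) (simp add: diff_le_eq add.commute)
    qed
  qed
qed

lemma continuous_compact_support_integrable:
  fixes f :: "'a::euclidean_space \<Rightarrow> 'b::euclidean_space"
  assumes "continuous_on UNIV f" "compact K" "\<And>x. x \<notin> K \<Longrightarrow> f x = 0"
  shows "integrable lborel f"
proof -
  have "(\<lambda>x. indicator K x *\<^sub>R f x) = f" using assms(3) by (auto simp: indicator_def fun_eq_iff)
  then show ?thesis
    using borel_integrable_compact[OF assms(2) continuous_on_subset[OF assms(1)]] by simp
qed

lemma lborel_integral_eq_cbox_integral:
  fixes f :: "'a::euclidean_space \<Rightarrow> 'b::euclidean_space"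
  assumes "integrable lborel f" "\<And>x. x \<notin> cbox a b \<Longrightarrow> f x = 0"
  shows "(\<integral>x. f x \<partial>lborel) = integral (cbox a b) f"
proof -
  have "(\<lambda>x. if x \<in> cbox a b then f x else 0) = f" using assms(2) by auto
  then show ?thesis
    using integral_restrict_UNIV[of "cbox a b" f] integral_lborel[OF assms(1)] by simp
qed

lemma lborel_integral_translate:
  fixes f :: "'a::euclidean_space \<Rightarrow> real"
  assumes "f \<in> borel_measurable borel"
  shows "(\<integral>x. f (x + y) \<partial>lborel) = (\<integral>x. f x \<partial>lborel)"
proof -
  have "(\<integral>x. f x \<partial>distr lborel borel ((+) y)) = (\<integral>x. f (y + x) \<partial>lborel)"
    using assms by (intro integral_distr) measurable
  then show ?thesis by (simp add: lborel_distr_plus add.commute)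
qed

text \<open>The translation is moved from \<open>\<eta>\<close> to \<open>F\<close>; this replaces Rademacher's theorem.\<close>
lemma lipschitz_translation_bound:
  fixes F \<eta> :: "'a::euclidean_space \<Rightarrow> real"
  assumes F: "L-lipschitz_on UNIV F" and \<eta>: "continuous_on UNIV \<eta>"
    and K: "compact K" "\<And>x. x \<notin> K \<Longrightarrow> \<eta> x = 0"
  shows "\<bar>(\<integral>x. F x * \<eta> (x + y) \<partial>lborel) - (\<integral>x. F x * \<eta> x \<partial>lborel)\<bar> \<le> L * norm y * (\<integral>x. \<bar>\<eta> x\<bar> \<partial>lborel)"
proof -
  have F_cont: "continuous_on S F" for S
    using lipschitz_on_continuous_on[OF F] continuous_on_subset by blast
  have F_shift: "continuous_on UNIV (\<lambda>x. F (x - z))" for z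
    by (rule continuous_on_compose2[OF F_cont[of UNIV]]) (auto intro: continuous_intros)
  have integrable: "integrable lborel (\<lambda>x. F (x - z) * \<eta> x)" for z
    using K(2)
    by (intro continuous_compact_support_integrable[OF _ K(1)] continuous_on_mult F_shift \<eta>) auto
  have "(\<integral>x. F x * \<eta> (x + y) \<partial>lborel) = (\<integral>x. F (x + y - y) * \<eta> (x + y) \<partial>lborel)" by simp
  also have "\<dots> = (\<integral>x. F (x - y) * \<eta> x \<partial>lborel)"
    by (rule lborel_integral_translate[OF borel_measurable_integrable[OF integrable[of y], simplified]])
  finally have "(\<integral>x. F x * \<eta> (x + y) \<partial>lborel) - (\<integral>x. F x * \<eta> x \<partial>lborel)
      = (\<integral>x. (F (x - y) - F x) * \<eta> x \<partial>lborel)"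
    using integrable[of y] integrable[of 0] by (simp add: left_diff_distrib)
  also have "\<bar>\<dots>\<bar> \<le> (\<integral>x. (L * norm y) * \<bar>\<eta> x\<bar> \<partial>lborel)"
  proof (rule integral_abs_bound_integral)
    show "integrable lborel (\<lambda>x. (F (x - y) - F x) * \<eta> x)"
      using integrable[of y] integrable[of 0] by (simp add: left_diff_distrib)
    show "integrable lborel (\<lambda>x. L * norm y * \<bar>\<eta> x\<bar>)"
      using K(2) by (intro integrable_mult_right continuous_compact_support_integrable[OF _ K(1)]
          continuous_on_rabs \<eta>) auto
    show "\<bar>(F (x - y) - F x) * \<eta> x\<bar> \<le> L * norm y * \<bar>\<eta> x\<bar>" for x
      using lipschitz_onD[OF F, of "x - y" x] unfolding abs_mult
      by (intro mult_right_mono) (auto simp: dist_real_def dist_norm)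
  qed
  finally show ?thesis by simp
qed

lemma cbox_translated_integral_has_derivative:
  fixes F \<eta> :: "'a::euclidean_space \<Rightarrow> real"
  assumes F: "continuous_on UNIV F"
    and \<eta>: "\<And>x. (\<eta> has_derivative \<eta>' x) (at x)" "continuous_on UNIV (\<lambda>x. \<eta>' x e)"
  shows "((\<lambda>s. integral (cbox a b) (\<lambda>x. F x * \<eta> (x + s *\<^sub>R e))) has_real_derivative
    integral (cbox a b) (\<lambda>x. F x * \<eta>' x e)) (at 0)"
proof -
  let ?I = "{-1..1::real}"
  have "((\<lambda>s. integral (cbox a b) (\<lambda>x. F x * \<eta> (x + s *\<^sub>R e))) has_field_derivative
      integral (cbox a b) (\<lambda>x. F x * \<eta>' (x + 0 *\<^sub>R e) e)) (at 0 within ?I)"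
  proof (rule leibniz_rule_field_derivative)
    fix s x
    have "((\<lambda>s. \<eta> (x + s *\<^sub>R e)) has_derivative (\<lambda>r. \<eta>' (x + s *\<^sub>R e) (r *\<^sub>R e))) (at s within ?I)"
      by (rule has_derivative_compose[OF _ \<eta>(1)]) (auto intro!: derivative_eq_intros)
    moreover have "\<eta>' (x + s *\<^sub>R e) (r *\<^sub>R e) = \<eta>' (x + s *\<^sub>R e) e * r" for r
      using linear_scale[OF has_derivative_linear[OF \<eta>(1)]] by simp
    ultimately have "((\<lambda>s. \<eta> (x + s *\<^sub>R e)) has_field_derivative \<eta>' (x + s *\<^sub>R e) e) (at s within ?I)"
      by (simp add: has_field_derivative_def)
    then show "((\<lambda>s. F x * \<eta> (x + s *\<^sub>R e)) has_field_derivative F x * \<eta>' (x + s *\<^sub>R e) e) (at s within ?I)"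
      by (rule DERIV_cmult)
  next
    have "continuous_on UNIV \<eta>"
      using has_derivative_continuous[OF \<eta>(1)] by (intro continuous_at_imp_continuous_on) auto
    then have "continuous_on (cbox a b) (\<lambda>x. \<eta> (x + s *\<^sub>R e))" for s
      by (rule continuous_on_compose2) (auto intro: continuous_intros)
    then show "(\<lambda>x. F x * \<eta> (x + s *\<^sub>R e)) integrable_on cbox a b" for s
      using continuous_on_subset[OF F] by (intro integrable_continuous continuous_on_mult) auto
    have "continuous_on (?I \<times> cbox a b) (\<lambda>z. F (snd z))"
      "continuous_on (?I \<times> cbox a b) (\<lambda>z. \<eta>' (snd z + fst z *\<^sub>R e) e)"
      by (rule continuous_on_compose2[OF F] continuous_on_compose2[OF \<eta>(2)], auto
          intro!: continuous_intros)+
    then show "continuous_on (?I \<times> cbox a b) (\<lambda>(s, x). F x * \<eta>' (x + s *\<^sub>R e) e)"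
      unfolding split_beta by (rule continuous_on_mult)
  qed auto
  moreover have "at 0 within ?I = at 0" by (rule at_within_interior) simp
  ultimately show ?thesis by (simp only: scaleR_zero_left add_0_right)
qed

lemma translated_integral_has_derivative:
  fixes F \<eta> :: "'a::euclidean_space \<Rightarrow> real"
  assumes F: "continuous_on UNIV F"
    and \<eta>: "\<And>x. (\<eta> has_derivative \<eta>' x) (at x)" "continuous_on UNIV (\<lambda>x. \<eta>' x e)"
    and K: "compact K" "\<And>x. x \<notin> K \<Longrightarrow> \<eta> x = 0"
  shows "((\<lambda>s. \<integral>x. F x * \<eta> (x + s *\<^sub>R e) \<partial>lborel) has_real_derivative (\<integral>x. F x * \<eta>' x e \<partial>lborel)) (at 0)"
proof -
  let ?K' = "{x + y | x y. x \<in> K \<and> y \<in> cball 0 (norm e)}"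
  have \<eta>_cont: "continuous_on UNIV \<eta>"
    using has_derivative_continuous[OF \<eta>(1)] by (intro continuous_at_imp_continuous_on) auto
  have "compact ?K'" by (intro compact_sums K compact_cball)
  then obtain a b where Q: "?K' \<subseteq> cbox a b"
    using bounded_subset_cbox_symmetric[OF compact_imp_bounded] by blast
  have outside: "x + s *\<^sub>R e \<notin> K" if "x \<notin> cbox a b" "\<bar>s\<bar> \<le> 1" for x s
  proof
    assume "x + s *\<^sub>R e \<in> K"
    moreover have "- (s *\<^sub>R e) \<in> cball 0 (norm e)" using that(2) by (simp add: mult_left_le_one_le)
    ultimately have "(x + s *\<^sub>R e) + - (s *\<^sub>R e) \<in> ?K'" by blast
    with Q that(1) show False by auto
  qed
  have restrict: "(\<integral>x. F x * h (x + s *\<^sub>R e) \<partial>lborel) = integral (cbox a b) (\<lambda>x. F x * h (x + s *\<^sub>R e))"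
    if h: "continuous_on UNIV h" "\<And>x. x \<notin> K \<Longrightarrow> h x = 0" and s: "\<bar>s\<bar> \<le> 1" for h s
  proof (intro lborel_integral_eq_cbox_integral continuous_compact_support_integrable[OF _ compact_cbox[of a b]])
    show "continuous_on UNIV (\<lambda>x. F x * h (x + s *\<^sub>R e))"
      by (intro continuous_on_mult F continuous_on_compose2[OF h(1)] continuous_intros) auto
  qed (use outside[OF _ s] h(2) in auto)
  have \<eta>'_zero: "\<eta>' x e = 0" if "x \<notin> K" for x
    by (rule frechet_derivative_eq_zero_off_closed[OF compact_imp_closed[OF K(1)] K(2) that \<eta>(1)])
  have "(\<integral>x. F x * \<eta>' x e \<partial>lborel) = integral (cbox a b) (\<lambda>x. F x * \<eta>' x e)"
    using restrict[OF \<eta>(2) \<eta>'_zero, of 0] by simp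
  then show ?thesis
    using cbox_translated_integral_has_derivative[OF F \<eta>, of a b]
    by (auto intro: has_field_derivative_transform_within[of _ _ _ UNIV 1] simp: restrict[OF \<eta>_cont K(2)])
qed

lemma abs_deriv_le_if_increment_le:
  fixes f :: "real \<Rightarrow> real"
  assumes deriv: "(f has_real_derivative D) (at 0)" and increment: "\<And>s. \<bar>f s - f 0\<bar> \<le> C * \<bar>s\<bar>"
  shows "\<bar>D\<bar> \<le> C"
proof (rule tendsto_upperbound[OF tendsto_rabs[OF deriv[unfolded DERIV_def]]])
  have "\<bar>(f (0 + h) - f 0) / h\<bar> \<le> C" if "h \<noteq> 0" for h
    using increment[of h] that by (simp add: abs_divide pos_divide_le_eq)
  then show "\<forall>\<^sub>F h in at 0. \<bar>(f (0 + h) - f 0) / h\<bar> \<le> C" by (auto simp: eventually_at_filter)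
qed simp

lemma lipschitz_integral_bound:
  fixes f \<eta> :: "'a::euclidean_space \<Rightarrow> real"
  assumes U: "open U" and f: "L-lipschitz_on U f"
    and \<eta>: "\<And>x. (\<eta> has_derivative \<eta>' x) (at x)" "continuous_on UNIV (\<lambda>x. \<eta>' x e)"
    and K: "compact K" "K \<subseteq> U" "\<And>x. x \<notin> K \<Longrightarrow> \<eta> x = 0"
  shows "\<bar>\<integral>x. f x * \<eta>' x e \<partial>lebesgue_on U\<bar> \<le> L * norm e * (\<integral>x. \<bar>\<eta> x\<bar> \<partial>lebesgue_on U)"
proof -
  obtain F where F: "L-lipschitz_on UNIV F" "\<And>x. x \<in> U \<Longrightarrow> F x = f x"
    using lipschitz_extension_UNIV[OF f] by blast
  have \<eta>_cont: "continuous_on UNIV \<eta>"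
    using has_derivative_continuous[OF \<eta>(1)] by (intro continuous_at_imp_continuous_on) auto
  have \<eta>'_zero: "\<eta>' x e = 0" if "x \<notin> K" for x
    by (rule frechet_derivative_eq_zero_off_closed[OF compact_imp_closed[OF K(1)] K(3) that \<eta>(1)])
  have restrict: "(\<integral>x. h x \<partial>lebesgue_on U) = (\<integral>x. k x \<partial>lborel)"
    if "\<And>x. x \<in> U \<Longrightarrow> h x = k x" "\<And>x. x \<notin> K \<Longrightarrow> k x = 0" "continuous_on UNIV k" for h k :: "'a \<Rightarrow> real"
  proof -
    have "(\<lambda>x. indicator U x *\<^sub>R h x) = k" using that(1,2) K(2) by (auto simp: indicator_def fun_eq_iff)
    moreover have "(\<integral>x. k x \<partial>lebesgue) = (\<integral>x. k x \<partial>lborel)"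
      using borel_measurable_continuous_onI[OF that(3)] by (intro integral_completion) simp
    ultimately show ?thesis using U by (simp add: lebesgue_on_indicator(1))
  qed
  have "\<bar>\<integral>x. F x * \<eta>' x e \<partial>lborel\<bar> \<le> L * norm e * (\<integral>x. \<bar>\<eta> x\<bar> \<partial>lborel)"
  proof (rule abs_deriv_le_if_increment_le)
    show "((\<lambda>s. \<integral>x. F x * \<eta> (x + s *\<^sub>R e) \<partial>lborel) has_real_derivative (\<integral>x. F x * \<eta>' x e \<partial>lborel)) (at 0)"
      by (rule translated_integral_has_derivative[OF lipschitz_on_continuous_on[OF F(1)] \<eta> K(1,3)])
    show "\<bar>(\<integral>x. F x * \<eta> (x + s *\<^sub>R e) \<partial>lborel) - (\<integral>x. F x * \<eta> (x + 0 *\<^sub>R e) \<partial>lborel)\<bar>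
        \<le> L * norm e * (\<integral>x. \<bar>\<eta> x\<bar> \<partial>lborel) * \<bar>s\<bar>" for s
      using lipschitz_translation_bound[OF F(1) \<eta>_cont K(1,3), of "s *\<^sub>R e"] by (simp add: mult_ac)
  qed
  moreover have "(\<integral>x. f x * \<eta>' x e \<partial>lebesgue_on U) = (\<integral>x. F x * \<eta>' x e \<partial>lborel)"
    using F(2) \<eta>'_zero lipschitz_on_continuous_on[OF F(1)] \<eta>(2) by (intro restrict continuous_on_mult) auto
  moreover have "(\<integral>x. \<bar>\<eta> x\<bar> \<partial>lebesgue_on U) = (\<integral>x. \<bar>\<eta> x\<bar> \<partial>lborel)"
    using K(3) \<eta>_cont by (intro restrict continuous_on_rabs) auto
  ultimately show ?thesis by simp
qed

section \<open>Square-integrable functions on an open set\<close>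

definition l2_class :: "'a::euclidean_space set \<Rightarrow> ('a \<Rightarrow> 'b::euclidean_space) \<Rightarrow> ('a, 'b) l2" where
  "l2_class U F = abs_l2 (\<lambda>x. indicator U x *\<^sub>R F x)"

text \<open>Functions on \<open>U\<close> are represented by their extensions by zero.\<close>
definition l2_restrict :: "'a::euclidean_space set \<Rightarrow> ('a, 'b::euclidean_space) l2 \<Rightarrow> ('a, 'b) l2" where
  "l2_restrict U q = l2_class U (rep_l2 q)"

definition l2_supported :: "'a::euclidean_space set \<Rightarrow> ('a, 'b::euclidean_space) l2 set" where
  "l2_supported U = {q. l2_restrict U q = q}"

definition bounded_coefficient :: "'a::euclidean_space set
    \<Rightarrow> ('c::euclidean_space \<Rightarrow> 'b::euclidean_space \<Rightarrow> 'd::euclidean_space) \<Rightarrow> ('a \<Rightarrow> 'c) \<Rightarrow> real \<Rightarrow> bool" where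
  "bounded_coefficient U \<mu> c K \<longleftrightarrow> bounded_bilinear \<mu>
    \<and> (\<lambda>x. indicator U x *\<^sub>R c x) \<in> borel_measurable lebesgue
    \<and> 0 \<le> K \<and> (\<forall>x\<in>U. \<forall>y. norm (\<mu> (c x) y) \<le> K * norm y)"

definition l2_multiply :: "'a::euclidean_space set
    \<Rightarrow> ('c \<Rightarrow> 'b::euclidean_space \<Rightarrow> 'd::euclidean_space) \<Rightarrow> ('a \<Rightarrow> 'c) \<Rightarrow> ('a, 'b) l2 \<Rightarrow> ('a, 'd) l2" where
  "l2_multiply U \<mu> c q = l2_class U (\<lambda>x. \<mu> (c x) (rep_l2 q x))"

lemma L2_eq_L2v: "L2 U f = L2v U f"
  by (simp add: L2_def L2v_def)

lemma L2v_zero: "L2v U (\<lambda>x. 0)"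
  by (simp add: L2v_def)

lemma l2_class_zero: "l2_class U (\<lambda>x. 0) = 0"
  by (simp add: l2_class_def zero_l2_def)

locale open_domain =
  fixes U :: "'a::euclidean_space set"
  assumes open_U: "open U"
begin

lemma U_sets: "U \<in> sets lebesgue"
  using open_U by auto

lemma AE_lebesgue_on_iff: "(AE x in lebesgue_on U. P x) \<longleftrightarrow> (AE x in lebesgue. x \<in> U \<longrightarrow> P x)"
  using U_sets by (subst AE_restrict_space_iff) auto

lemma L2v_iff: "L2v U F \<longleftrightarrow> sq_integrable (\<lambda>x. indicator U x *\<^sub>R F x)"
proof -
  have "(\<lambda>x. (norm (indicator U x *\<^sub>R F x))\<^sup>2) = (\<lambda>x. indicator U x *\<^sub>R (norm (F x))\<^sup>2)"
    by (auto simp: indicator_def)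
  then show ?thesis unfolding L2v_def sq_integrable_def lebesgue_on_indicator[OF U_sets] by simp
qed

lemma L2v_sq_integrable: "L2v U F \<Longrightarrow> sq_integrable (\<lambda>x. indicator U x *\<^sub>R F x)"
  by (simp add: L2v_iff)

lemma L2v_indicator_measurable: "L2v U F \<Longrightarrow> (\<lambda>x. indicator U x *\<^sub>R F x) \<in> borel_measurable lebesgue"
  by (simp add: L2v_iff sq_integrable_measurable)

lemma
  assumes F: "L2v U F" and G: "L2v U G"
  shows inner_l2_class: "l2_class U F \<bullet> l2_class U G = (\<integral>x. F x \<bullet> G x \<partial>lebesgue_on U)"
    and L2v_inner_integrable: "integrable (lebesgue_on U) (\<lambda>x. F x \<bullet> G x)"
proof -
  let ?F = "\<lambda>x. indicator U x *\<^sub>R F x" and ?G = "\<lambda>x. indicator U x *\<^sub>R G x"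
  have inner_eq: "(\<lambda>x. ?F x \<bullet> ?G x) = (\<lambda>x. indicator U x *\<^sub>R (F x \<bullet> G x))"
    by (auto simp: indicator_def)
  have "l2_class U F \<bullet> l2_class U G = (\<integral>x. ?F x \<bullet> ?G x \<partial>lebesgue)"
    unfolding l2_class_def by (intro inner_l2_eq_integral rep_abs_l2 L2v_sq_integrable F G)
  then show "l2_class U F \<bullet> l2_class U G = (\<integral>x. F x \<bullet> G x \<partial>lebesgue_on U)"
    unfolding inner_eq lebesgue_on_indicator(1)[OF U_sets] .
  show "integrable (lebesgue_on U) (\<lambda>x. F x \<bullet> G x)"
    unfolding lebesgue_on_indicator(2)[OF U_sets] inner_eq[symmetric]
    by (rule sq_integrable_inner[OF L2v_sq_integrable[OF F] L2v_sq_integrable[OF G]])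
qed

lemma norm_sq_l2_class: "L2v U F \<Longrightarrow> (norm (l2_class U F))\<^sup>2 = (\<integral>x. (norm (F x))\<^sup>2 \<partial>lebesgue_on U)"
  unfolding power2_norm_eq_inner by (rule inner_l2_class)

lemma norm_l2_class: "L2v U f \<Longrightarrow> norm (l2_class U f) = L2norm U f"
  unfolding L2norm_def using norm_sq_l2_class[of f]
  by (intro real_sqrt_unique[symmetric]) simp_all

lemma rep_l2_class: "L2v U F \<Longrightarrow> AE x in lebesgue_on U. rep_l2 (l2_class U F) x = F x"
  unfolding l2_class_def AE_lebesgue_on_iff
  by (rule eventually_mono[OF rep_abs_l2[OF L2v_sq_integrable]]) auto

lemma l2_class_eq_iff:
  assumes "L2v U F" "L2v U G"
  shows "l2_class U F = l2_class U G \<longleftrightarrow> (AE x in lebesgue_on U. F x = G x)"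
proof -
  have "l2_class U F = l2_class U G
      \<longleftrightarrow> (AE x in lebesgue. indicator U x *\<^sub>R F x = indicator U x *\<^sub>R G x)"
    unfolding l2_class_def using assms by (intro abs_l2_eq_iff L2v_sq_integrable)
  also have "\<dots> \<longleftrightarrow> (AE x in lebesgue. x \<in> U \<longrightarrow> F x = G x)"
    by (intro AE_cong) (auto simp: indicator_def)
  finally show ?thesis by (simp add: AE_lebesgue_on_iff)
qed

lemma l2_class_eqI:
  "L2v U F \<Longrightarrow> L2v U G \<Longrightarrow> AE x in lebesgue_on U. F x = G x \<Longrightarrow> l2_class U F = l2_class U G"
  by (simp add: l2_class_eq_iff)

lemma L2v_linear:
  assumes "L2v U F" "L2v U G"
  shows "L2v U (\<lambda>x. F x + c *\<^sub>R G x)"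
proof -
  have "sq_integrable (\<lambda>x. indicator U x *\<^sub>R F x + c *\<^sub>R (indicator U x *\<^sub>R G x))"
    using assms by (intro sq_integrable_add sq_integrable_scaleR L2v_sq_integrable)
  then show ?thesis unfolding L2v_iff by (simp add: algebra_simps)
qed

lemma l2_class_linear:
  assumes F: "L2v U F" and G: "L2v U G"
  shows "l2_class U (\<lambda>x. F x + c *\<^sub>R G x) = l2_class U F + c *\<^sub>R l2_class U G"
proof (rule l2_eqI)
  have rep: "AE x in lebesgue. rep_l2 (l2_class U H) x = indicator U x *\<^sub>R H x" if "L2v U H" for H
    unfolding l2_class_def by (rule rep_abs_l2[OF L2v_sq_integrable[OF that]])
  show "AE x in lebesgue. rep_l2 (l2_class U (\<lambda>x. F x + c *\<^sub>R G x)) x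
      = rep_l2 (l2_class U F + c *\<^sub>R l2_class U G) x"
    using rep[OF L2v_linear[OF F G]] rep[OF F] rep[OF G] rep_l2_linear[of "l2_class U F" c "l2_class U G"]
    by eventually_elim (simp add: algebra_simps)
qed

lemma
  fixes F :: "'a \<Rightarrow> 'b::euclidean_space" and G :: "'a \<Rightarrow> 'c::euclidean_space"
  assumes F: "L2v U F" and G: "(\<lambda>x. indicator U x *\<^sub>R G x) \<in> borel_measurable lebesgue"
    and K: "0 \<le> K" "\<And>x. x \<in> U \<Longrightarrow> norm (G x) \<le> K * norm (F x)"
  shows L2v_dominated: "L2v U G"
    and norm_l2_class_dominated: "norm (l2_class U G) \<le> K * norm (l2_class U F)"
proof -
  have norm_sq_le: "(norm (G x))\<^sup>2 \<le> K\<^sup>2 * (norm (F x))\<^sup>2" if "x \<in> U" for x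
    using power_mono[OF K(2)[OF that] norm_ge_zero, of 2] by (simp add: power_mult_distrib)
  show G_L2: "L2v U G" unfolding L2v_iff
  proof (rule sq_integrable_bound[OF G])
    show "integrable lebesgue (\<lambda>x. K\<^sup>2 * (norm (indicator U x *\<^sub>R F x))\<^sup>2)"
      by (intro integrable_mult_right sq_integrable_norm L2v_sq_integrable F)
    show "(norm (indicator U x *\<^sub>R G x))\<^sup>2 \<le> K\<^sup>2 * (norm (indicator U x *\<^sub>R F x))\<^sup>2" for x
      using norm_sq_le[of x] by (cases "x \<in> U") auto
  qed
  show "norm (l2_class U G) \<le> K * norm (l2_class U F)"
  proof (rule power2_le_imp_le)
    have "(norm (l2_class U G))\<^sup>2 \<le> (\<integral>x. K\<^sup>2 * (norm (F x))\<^sup>2 \<partial>lebesgue_on U)"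
      unfolding norm_sq_l2_class[OF G_L2] using F norm_sq_le G_L2
      by (intro integral_mono) (auto simp: L2v_def)
    then show "(norm (l2_class U G))\<^sup>2 \<le> (K * norm (l2_class U F))\<^sup>2"
      by (simp add: power_mult_distrib norm_sq_l2_class[OF F])
  qed (use K in simp)
qed

lemma L2v_rep: "L2v U (rep_l2 q)"
  and norm_l2_restrict_le: "norm (l2_restrict U q) \<le> norm q"
  for q :: "('a, 'b::euclidean_space) l2"
proof -
  let ?R = "\<lambda>x. indicator U x *\<^sub>R rep_l2 q x"
  have R: "sq_integrable ?R"
  proof (rule sq_integrable_bound[OF _ sq_integrable_norm[OF sq_integrable_rep[of q]]])
    show "?R \<in> borel_measurable lebesgue"
      using sq_integrable_measurable[OF sq_integrable_rep] U_sets
      by (intro borel_measurable_scaleR borel_measurable_indicator) auto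
  qed (auto simp: indicator_def)
  then show L2v_rep: "L2v U (rep_l2 q)" by (simp add: L2v_iff)
  have "(norm (l2_restrict U q))\<^sup>2 = (\<integral>x. (norm (?R x))\<^sup>2 \<partial>lebesgue)"
    unfolding l2_restrict_def l2_class_def by (intro norm_sq_l2_eq_integral rep_abs_l2 R)
  also have "\<dots> \<le> (\<integral>x. (norm (rep_l2 q x))\<^sup>2 \<partial>lebesgue)"
    by (intro integral_mono sq_integrable_norm R sq_integrable_rep) (auto simp: indicator_def)
  also have "\<dots> = (norm q)\<^sup>2" by (rule norm_sq_l2_eq_integral[symmetric]) (simp_all add: sq_integrable_rep)
  finally show "norm (l2_restrict U q) \<le> norm q" by (rule power2_le_imp_le) simp
qed

lemma l2_restrict_class: "L2v U F \<Longrightarrow> l2_restrict U (l2_class U F) = l2_class U F"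
  unfolding l2_restrict_def by (intro l2_class_eqI L2v_rep rep_l2_class)

end

subsection \<open>Multiplication by bounded coefficients\<close>

context open_domain
begin

lemma
  assumes c: "bounded_coefficient U \<mu> c K" and F: "L2v U F"
  shows L2v_multiply: "L2v U (\<lambda>x. \<mu> (c x) (F x))"
    and norm_l2_class_multiply: "norm (l2_class U (\<lambda>x. \<mu> (c x) (F x))) \<le> K * norm (l2_class U F)"
proof -
  interpret bounded_bilinear \<mu> using c by (simp add: bounded_coefficient_def)
  have "(\<lambda>x. \<mu> (indicator U x *\<^sub>R c x) (indicator U x *\<^sub>R F x)) \<in> borel_measurable lebesgue"
  proof (rule borel_measurable_continuous_Pair[where H = \<mu>, OF _ L2v_indicator_measurable[OF F]])
    show "continuous_on UNIV (\<lambda>z. \<mu> (fst z) (snd z))" by (intro continuous_on continuous_intros)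
  qed (use c in \<open>simp add: bounded_coefficient_def\<close>)
  moreover have "(\<lambda>x. \<mu> (indicator U x *\<^sub>R c x) (indicator U x *\<^sub>R F x))
      = (\<lambda>x. indicator U x *\<^sub>R \<mu> (c x) (F x))"
    by (auto simp: indicator_def zero_left)
  ultimately have measurable: "(\<lambda>x. indicator U x *\<^sub>R \<mu> (c x) (F x)) \<in> borel_measurable lebesgue" by simp
  show "L2v U (\<lambda>x. \<mu> (c x) (F x))"
    "norm (l2_class U (\<lambda>x. \<mu> (c x) (F x))) \<le> K * norm (l2_class U F)"
    using c L2v_dominated[OF F measurable, of K] norm_l2_class_dominated[OF F measurable, of K]
    by (auto simp: bounded_coefficient_def)
qed

lemma l2_multiply_class:
  assumes c: "bounded_coefficient U \<mu> c K" and F: "L2v U F"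
  shows "l2_multiply U \<mu> c (l2_class U F) = l2_class U (\<lambda>x. \<mu> (c x) (F x))"
  unfolding l2_multiply_def using rep_l2_class[OF F]
  by (intro l2_class_eqI L2v_multiply[OF c] L2v_rep F) (auto elim: eventually_mono)

lemma linear_l2_multiply:
  assumes c: "bounded_coefficient U \<mu> c K"
  shows "linear (l2_multiply U \<mu> c)"
proof -
  interpret bounded_bilinear \<mu> using c by (simp add: bounded_coefficient_def)
  have linear_combination: "l2_multiply U \<mu> c (p + r *\<^sub>R q)
      = l2_multiply U \<mu> c p + r *\<^sub>R l2_multiply U \<mu> c q" for p q r
  proof -
    have "AE x in lebesgue. rep_l2 (p + r *\<^sub>R q) x = rep_l2 p x + r *\<^sub>R rep_l2 q x" by (rule rep_l2_linear)
    then have "AE x in lebesgue_on U. \<mu> (c x) (rep_l2 (p + r *\<^sub>R q) x)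
        = \<mu> (c x) (rep_l2 p x) + r *\<^sub>R \<mu> (c x) (rep_l2 q x)"
      unfolding AE_lebesgue_on_iff by eventually_elim (simp add: add_right scaleR_right)
    then have "l2_multiply U \<mu> c (p + r *\<^sub>R q)
        = l2_class U (\<lambda>x. \<mu> (c x) (rep_l2 p x) + r *\<^sub>R \<mu> (c x) (rep_l2 q x))"
      unfolding l2_multiply_def by (intro l2_class_eqI L2v_linear L2v_multiply[OF c] L2v_rep)
    then show ?thesis unfolding l2_multiply_def
      by (simp only: l2_class_linear[OF L2v_multiply[OF c L2v_rep] L2v_multiply[OF c L2v_rep]])
  qed
  from linear_combination[of 0 "-1" 0] have "l2_multiply U \<mu> c 0 = 0" by simp
  then show ?thesis
    using linear_combination[of _ 1] linear_combination[of 0] by (intro linearI) auto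
qed

lemma norm_l2_multiply_le:
  assumes c: "bounded_coefficient U \<mu> c K"
  shows "norm (l2_multiply U \<mu> c q) \<le> K * norm q"
proof -
  have "norm (l2_multiply U \<mu> c q) \<le> K * norm (l2_restrict U q)"
    unfolding l2_multiply_def l2_restrict_def by (rule norm_l2_class_multiply[OF c L2v_rep])
  also have "\<dots> \<le> K * norm q"
    using c norm_l2_restrict_le by (intro mult_left_mono) (auto simp: bounded_coefficient_def)
  finally show ?thesis .
qed

lemma bounded_linear_l2_multiply:
  assumes c: "bounded_coefficient U \<mu> c K"
  shows "bounded_linear (l2_multiply U \<mu> c)"
proof (intro bounded_linear.intro bounded_linear_axioms.intro exI allI)
  show "norm (l2_multiply U \<mu> c q) \<le> norm q * K" for q
    using norm_l2_multiply_le[OF c, of q] by (simp add: mult.commute)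
qed (rule linear_l2_multiply[OF c])

lemma bounded_linear_l2_restrict: "bounded_linear (l2_restrict U)"
proof -
  have "bounded_coefficient U scaleR (\<lambda>_. 1) 1"
    unfolding bounded_coefficient_def using U_sets by (simp add: bounded_bilinear_scaleR)
  from bounded_linear_l2_multiply[OF this] show ?thesis
    by (simp add: l2_multiply_def[abs_def] l2_restrict_def[abs_def])
qed

lemma closed_subspace_l2_supported:
  "subspace (l2_supported U :: ('a, 'b::euclidean_space) l2 set)"
  "closed (l2_supported U :: ('a, 'b) l2 set)"
proof -
  interpret restrict: bounded_linear "l2_restrict U :: ('a, 'b) l2 \<Rightarrow> _"
    by (rule bounded_linear_l2_restrict)
  show "subspace (l2_supported U :: ('a, 'b) l2 set)"
    by (intro subspaceI) (simp_all add: l2_supported_def restrict.zero restrict.add restrict.scaleR)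
  show "closed (l2_supported U :: ('a, 'b) l2 set)"
    unfolding l2_supported_def by (intro closed_Collect_eq restrict.continuous_on continuous_intros)
qed

lemma l2_class_supported: "L2v U F \<Longrightarrow> l2_class U F \<in> l2_supported U"
  by (simp add: l2_supported_def l2_restrict_class)

lemma l2_class_rep: "q \<in> l2_supported U \<Longrightarrow> l2_class U (rep_l2 q) = q"
  by (simp add: l2_supported_def l2_restrict_def)

lemma L2v_compact_support:
  fixes F :: "'a \<Rightarrow> 'b::euclidean_space"
  assumes F: "continuous_on UNIV F" and K: "compact K" "K \<subseteq> U" "\<And>x. x \<notin> K \<Longrightarrow> F x = 0"
  shows "L2v U F"
  unfolding L2v_def
proof
  show "F \<in> borel_measurable (lebesgue_on U)"
    using F
    by (intro measurable_restrict_space1 measurable_completion) (simp add: borel_measurable_continuous_onI)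
  have "integrable lborel (\<lambda>x. (norm (F x))\<^sup>2)"
    using K by (intro continuous_compact_support_integrable[OF _ K(1)] continuous_intros F) auto
  then have "integrable lebesgue (\<lambda>x. (norm (F x))\<^sup>2)" by (subst integrable_completion) auto
  then show "integrable (lebesgue_on U) (\<lambda>x. (norm (F x))\<^sup>2)"
    unfolding lebesgue_on_indicator(2)[OF U_sets] by (rule integrable_mult_indicator[OF U_sets])
qed

lemma
  assumes \<phi>: "test_fun U \<phi>"
  shows test_fun_L2v: "L2v U \<phi>" and test_fun_derivative_L2v: "L2v U (\<lambda>x. frechet_derivative \<phi> (at x) e)"
proof -
  obtain K where K: "compact K" "K \<subseteq> U" "\<forall>x. x \<notin> K \<longrightarrow> \<phi> x = 0" using test_fun_support[OF \<phi>] by blast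
  then show "L2v U \<phi>"
    using smooth_fun_continuous[OF test_fun_smooth[OF \<phi>]] by (intro L2v_compact_support) auto
  have "frechet_derivative \<phi> (at x) e = 0" if "x \<notin> K" for x
    using frechet_derivative_eq_zero_off_closed[OF compact_imp_closed[OF K(1)] _ that
        smooth_fun_has_derivative[OF test_fun_smooth[OF \<phi>]]] K(3) by simp
  then show "L2v U (\<lambda>x. frechet_derivative \<phi> (at x) e)"
    using smooth_fun_continuous_derivative[OF test_fun_smooth[OF \<phi>]] K(1,2)
    by (intro L2v_compact_support) auto
qed

theorem total_in_test_funs: "total_in (l2_supported U) (l2_class U ` Collect (test_fun U))"
  unfolding total_in_def
proof (intro conjI ballI impI)
  fix q :: "('a, real) l2"
  assume q: "q \<in> l2_supported U" and orthogonal: "\<forall>y\<in>l2_class U ` Collect (test_fun U). q \<bullet> y = 0"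
  have "AE x in lebesgue_on U. rep_l2 q x = 0"
  proof (rule fundamental_lemma[OF open_U L2v_sq_integrable[OF L2v_rep]])
    show "(\<integral>x. rep_l2 q x * \<phi> x \<partial>lebesgue_on U) = 0" if "test_fun U \<phi>" for \<phi>
      using orthogonal that inner_l2_class[OF L2v_rep test_fun_L2v[OF that], of q] l2_class_rep[OF q]
      by simp
  qed
  then have "l2_class U (rep_l2 q) = l2_class U (\<lambda>x. 0)" by (intro l2_class_eqI L2v_rep L2v_zero)
  then show "q = 0" by (simp add: l2_class_rep[OF q] l2_class_zero)
qed (auto intro: l2_class_supported test_fun_L2v)

corollary closure_test_funs: "closure (l2_class U ` Collect (test_fun U)) = l2_supported U"
proof
  let ?S = "l2_class U ` Collect (test_fun U)"
  show "closure ?S \<subseteq> l2_supported U"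
    by (intro closure_minimal closed_subspace_l2_supported image_subsetI l2_class_supported test_fun_L2v)
      simp
  have "subspace ?S"
    using subspace_image_of_function_space[of "test_fun U" "\<lambda>x. 0" "l2_class U"]
      l2_class_linear[OF test_fun_L2v test_fun_L2v]
    by (simp add: test_fun_zero test_fun_linear)
  then show "l2_supported U \<subseteq> closure ?S"
    by (intro subset_if_total_in[OF _ _ total_in_test_funs] closed_subspace_l2_supported
        closed_closure subspace_closure closure_subset)
qed

end

section \<open>Sobolev spaces as closed subspaces of a Hilbert space\<close>

type_synonym 'n sobolev_pair = "(real^'n, real) l2 \<times> (real^'n, real^'n) l2"

definition h1_class :: "(real^'n) set \<Rightarrow> (real^'n \<Rightarrow> real) \<Rightarrow> 'n sobolev_pair" where
  "h1_class U u = (l2_class U u, l2_class U (wgrad U u))"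

lemma fst_h1_class [simp]: "fst (h1_class U u) = l2_class U u"
  by (simp add: h1_class_def)

definition sobolev0 :: "(real^'n) set \<Rightarrow> 'n sobolev_pair set" where
  "sobolev0 U = closure (h1_class U ` Collect (test_fun U))"

definition weak_grad_graph :: "(real^'n) set \<Rightarrow> 'n sobolev_pair set" where
  "weak_grad_graph U = (l2_supported U \<times> l2_supported U) \<inter>
    {p. \<forall>\<phi> i. test_fun U \<phi> \<longrightarrow>
      fst p \<bullet> l2_class U (\<lambda>x. cgrad \<phi> x $ i) = - (snd p \<bullet> l2_class U (\<lambda>x. \<phi> x *\<^sub>R axis i 1))}"

lemma closure_image_sequential:
  fixes f :: "'a \<Rightarrow> 'b::metric_space"
  shows "x \<in> closure (f ` A) \<longleftrightarrow> (\<exists>a. (\<forall>k. a k \<in> A) \<and> (\<lambda>k. f (a k)) \<longlonglongrightarrow> x)"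
proof
  assume "x \<in> closure (f ` A)"
  then obtain X where X: "\<forall>k. X k \<in> f ` A" "X \<longlonglongrightarrow> x" unfolding closure_sequential by blast
  from X(1) have "\<forall>k. \<exists>a. a \<in> A \<and> X k = f a" by blast
  then obtain a where a: "\<forall>k. a k \<in> A \<and> X k = f (a k)" unfolding choice_iff ..
  then have "X = (\<lambda>k. f (a k))" by (simp add: fun_eq_iff)
  then show "\<exists>a. (\<forall>k. a k \<in> A) \<and> (\<lambda>k. f (a k)) \<longlonglongrightarrow> x" using a X(2) by (intro exI[of _ a]) simp
next
  assume "\<exists>a. (\<forall>k. a k \<in> A) \<and> (\<lambda>k. f (a k)) \<longlonglongrightarrow> x"
  then obtain a where "\<forall>k. a k \<in> A" "(\<lambda>k. f (a k)) \<longlonglongrightarrow> x" by blast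
  then show "x \<in> closure (f ` A)" unfolding closure_sequential by (intro exI[of _ "\<lambda>k. f (a k)"]) auto
qed

lemma cgrad_nth: "cgrad \<phi> x $ i = frechet_derivative \<phi> (at x) (axis i 1)"
  by (simp add: cgrad_def)


text \<open>Both integration by parts (\<open>f = 1\<close>, \<open>L = 0\<close>) and the estimates on \<open>div (b \<phi>)\<close> follow
  from this bound.\<close>
lemma lipschitz_product_bound:
  fixes \<phi> \<psi> :: "real^'n \<Rightarrow> real"
  assumes U: "open U" and f: "L-lipschitz_on U f" and \<phi>: "test_fun U \<phi>" and \<psi>: "test_fun U \<psi>"
  shows "\<bar>\<integral>x. f x * (\<phi> x * cgrad \<psi> x $ i + \<psi> x * cgrad \<phi> x $ i) \<partial>lebesgue_on U\<bar>
    \<le> L * (\<integral>x. \<bar>\<phi> x * \<psi> x\<bar> \<partial>lebesgue_on U)"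
proof -
  note smooth = test_fun_smooth[OF \<phi>] test_fun_smooth[OF \<psi>]
  let ?d = "\<lambda>x e. \<phi> x * frechet_derivative \<psi> (at x) e + frechet_derivative \<phi> (at x) e * \<psi> x"
  obtain K where K: "compact K" "K \<subseteq> U" "\<forall>x. x \<notin> K \<longrightarrow> \<phi> x = 0" using test_fun_support[OF \<phi>] by blast
  have "\<bar>\<integral>x. f x * ?d x (axis i 1) \<partial>lebesgue_on U\<bar>
      \<le> L * norm (axis i 1 :: real^'n) * (\<integral>x. \<bar>\<phi> x * \<psi> x\<bar> \<partial>lebesgue_on U)"
  proof (rule lipschitz_integral_bound[OF U f _ _ K(1,2)])
    show "((\<lambda>x. \<phi> x * \<psi> x) has_derivative ?d x) (at x)" for x
      by (intro has_derivative_mult smooth_fun_has_derivative smooth)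
    show "continuous_on UNIV (\<lambda>x. ?d x (axis i 1))"
      by (intro continuous_intros smooth_fun_continuous smooth_fun_continuous_derivative smooth)
    show "\<phi> x * \<psi> x = 0" if "x \<notin> K" for x using K(3) that by simp
  qed
  then show ?thesis by (simp add: cgrad_nth mult.commute)
qed

locale sobolev_domain = open_domain U for U :: "(real^'n) set"
begin

lemma L2v_nth:
  assumes G: "L2v U (G :: real^'n \<Rightarrow> real^'m)"
  shows "L2v U (\<lambda>x. G x $ i)"
proof -
  have "bounded_coefficient U (\<bullet>) (\<lambda>x. axis i 1 :: real^'m) 1"
    unfolding bounded_coefficient_def using U_sets
    by (simp add: bounded_bilinear_inner inner_axis' component_le_norm_cart)
  from L2v_multiply[OF this G] show ?thesis by (simp add: inner_axis')
qed

lemma L2v_scaleR_const: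
  assumes \<phi>: "L2v U \<phi>"
  shows "L2v U (\<lambda>x. \<phi> x *\<^sub>R (w::'b::euclidean_space))"
proof -
  have "bounded_coefficient U (\<lambda>w r. r *\<^sub>R w) (\<lambda>x. w) (norm w)"
    unfolding bounded_coefficient_def using U_sets
    by (simp add: bounded_bilinear.flip[OF bounded_bilinear_scaleR] mult.commute)
  from L2v_multiply[OF this \<phi>] show ?thesis .
qed

lemma test_fun_cgrad_nth_L2v: "test_fun U \<phi> \<Longrightarrow> L2v U (\<lambda>x. cgrad \<phi> x $ i)"
  by (simp add: cgrad_nth test_fun_derivative_L2v)

lemma test_fun_cgrad_L2v:
  assumes "test_fun U \<phi>"
  shows "L2v U (cgrad \<phi>)"
proof -
  have "L2v U (\<lambda>x. \<Sum>i\<in>I. (cgrad \<phi> x $ i) *\<^sub>R (axis i 1 :: real^'n))" if "finite I" for I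
    using that
  proof induction
    case (insert i I)
    from L2v_linear[OF insert.IH L2v_scaleR_const[OF test_fun_cgrad_nth_L2v[OF assms]], of 1 i "axis i 1"]
    show ?case using insert.hyps by (simp add: add.commute)
  qed (simp add: L2v_zero)
  from this[of UNIV] show ?thesis by (simp add: basis_expansion flip: scalar_mult_eq_scaleR)
qed

lemma weak_grad_iff_graph:
  assumes u: "L2v U u" and G: "L2v U G"
  shows "is_weak_grad U u G \<longleftrightarrow> (l2_class U u, l2_class U G) \<in> weak_grad_graph U"
proof -
  have "(\<integral>x. u x * cgrad \<phi> x $ i \<partial>lebesgue_on U) = l2_class U u \<bullet> l2_class U (\<lambda>x. cgrad \<phi> x $ i)"
    "(\<integral>x. G x $ i * \<phi> x \<partial>lebesgue_on U) = l2_class U G \<bullet> l2_class U (\<lambda>x. \<phi> x *\<^sub>R axis i 1)"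
    if \<phi>: "test_fun U \<phi>" for \<phi> i
    using inner_l2_class[OF u test_fun_cgrad_nth_L2v[OF \<phi>]]
      inner_l2_class[OF G L2v_scaleR_const[OF test_fun_L2v[OF \<phi>]]]
        by (simp_all add: inner_axis mult.commute)
  then show ?thesis
    unfolding is_weak_grad_def weak_grad_graph_def using l2_class_supported[OF u] l2_class_supported[OF G]
    by auto
qed

lemma closed_subspace_weak_grad_graph: "subspace (weak_grad_graph U)" "closed (weak_grad_graph U)"
proof -
  show "subspace (weak_grad_graph U)"
    unfolding weak_grad_graph_def
    by (intro subspace_inter subspace_Times closed_subspace_l2_supported subspaceI)
      (simp_all add: inner_add_left)
  show "closed (weak_grad_graph U)"
    unfolding weak_grad_graph_def
    by (intro closed_Int closed_Times closed_subspace_l2_supported closed_Collect_all closed_Collect_imp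
        closed_Collect_eq open_Collect_const continuous_intros)
qed

lemma weak_grad_graph_fst_inj:
  assumes "p \<in> weak_grad_graph U" "fst p = 0"
  shows "p = 0"
proof -
  have "AE x in lebesgue_on U. rep_l2 (snd p) x $ i = 0" for i
  proof (rule fundamental_lemma[OF open_U L2v_sq_integrable[OF L2v_nth[OF L2v_rep]]])
    fix \<phi> assume \<phi>: "test_fun U \<phi>"
    have "snd p \<bullet> l2_class U (\<lambda>x. \<phi> x *\<^sub>R axis i 1) = 0"
      using assms \<phi> unfolding weak_grad_graph_def by fastforce
    moreover have "l2_class U (rep_l2 (snd p)) = snd p"
      using assms(1) by (intro l2_class_rep) (auto simp: weak_grad_graph_def)
    ultimately show "(\<integral>x. rep_l2 (snd p) x $ i * \<phi> x \<partial>lebesgue_on U) = 0"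
      using inner_l2_class[OF L2v_rep L2v_scaleR_const[OF test_fun_L2v[OF \<phi>]], of "snd p" "axis i 1"]
      by (simp add: inner_axis mult.commute)
  qed
  then have "AE x in lebesgue_on U. \<forall>i\<in>UNIV. rep_l2 (snd p) x $ i = 0" by (subst AE_ball_countable) auto
  then have "l2_class U (rep_l2 (snd p)) = l2_class U (\<lambda>x. 0)"
    by (intro l2_class_eqI L2v_rep L2v_zero) (auto simp: vec_eq_iff elim: eventually_mono)
  then have "snd p = 0"
    using l2_class_rep[of "snd p"] assms(1) by (auto simp: weak_grad_graph_def l2_class_zero)
  then show ?thesis using assms(2) by (simp add: prod_eq_iff)
qed

lemma weak_grad_graph_eqI:
  assumes "p \<in> weak_grad_graph U" "q \<in> weak_grad_graph U" "fst p = fst q"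
  shows "p = q"
  using weak_grad_graph_fst_inj[OF subspace_diff[OF closed_subspace_weak_grad_graph(1) assms(1,2)]]
    assms(3)
  by simp

lemma
  assumes "H1 U u"
  shows H1_L2v: "L2v U u" and H1_wgrad_L2v: "L2v U (wgrad U u)"
    and H1_class_in_graph: "h1_class U u \<in> weak_grad_graph U"
proof -
  show u: "L2v U u" using assms by (simp add: H1_def L2_eq_L2v)
  have "\<exists>G. L2v U G \<and> is_weak_grad U u G" using assms by (simp add: H1_def)
  from someI_ex[OF this] have "L2v U (wgrad U u) \<and> is_weak_grad U u (wgrad U u)" by (simp add: wgrad_def)
  then show "L2v U (wgrad U u)" "h1_class U u \<in> weak_grad_graph U"
    using weak_grad_iff_graph[OF u] by (auto simp: h1_class_def)
qed

lemma
  assumes u: "L2v U u" and p: "p \<in> weak_grad_graph U" "l2_class U u = fst p"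
  shows H1I_graph: "H1 U u" and h1_class_eqI: "h1_class U u = p"
proof -
  have "l2_class U (rep_l2 (snd p)) = snd p"
    using p(1) by (intro l2_class_rep) (auto simp: weak_grad_graph_def)
  then have "is_weak_grad U u (rep_l2 (snd p))"
    unfolding weak_grad_iff_graph[OF u L2v_rep] using p by simp
  then show H1: "H1 U u" using u L2v_rep unfolding H1_def L2_eq_L2v by blast
  show "h1_class U u = p"
    using p by (intro weak_grad_graph_eqI H1_class_in_graph H1) (simp_all add: h1_class_def)
qed

lemma
  assumes u: "H1 U u" and w: "H1 U w"
  shows H1_linear: "H1 U (\<lambda>x. u x + c * w x)"
    and h1_class_linear: "h1_class U (\<lambda>x. u x + c * w x) = h1_class U u + c *\<^sub>R h1_class U w"
proof -
  have L2v: "L2v U (\<lambda>x. u x + c * w x)"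
    using L2v_linear[OF H1_L2v[OF u] H1_L2v[OF w], of c] by simp
  have graph: "h1_class U u + c *\<^sub>R h1_class U w \<in> weak_grad_graph U"
    by (intro subspace_add subspace_scale closed_subspace_weak_grad_graph H1_class_in_graph u w)
  have class_eq: "l2_class U (\<lambda>x. u x + c * w x) = fst (h1_class U u + c *\<^sub>R h1_class U w)"
    using l2_class_linear[OF H1_L2v[OF u] H1_L2v[OF w], of c] by (simp add: h1_class_def)
  show "H1 U (\<lambda>x. u x + c * w x)" by (rule H1I_graph[OF L2v graph class_eq])
  show "h1_class U (\<lambda>x. u x + c * w x) = h1_class U u + c *\<^sub>R h1_class U w"
    by (rule h1_class_eqI[OF L2v graph class_eq])
qed

lemma norm_h1_class: "H1 U u \<Longrightarrow> norm (h1_class U u) = H1norm U u"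
  using norm_sq_l2_class[OF H1_L2v, of u] norm_sq_l2_class[OF H1_wgrad_L2v, of u]
  by (simp add: h1_class_def norm_prod_def H1norm_def)

lemma norm_h1_class_diff:
  "H1 U u \<Longrightarrow> H1 U w \<Longrightarrow> norm (h1_class U u - h1_class U w) = H1norm U (\<lambda>x. u x - w x)"
  using norm_h1_class[OF H1_linear, of u w "-1"] h1_class_linear[of u w "-1"] by simp

lemma
  assumes \<phi>: "test_fun U \<phi>"
  shows test_fun_H1: "H1 U \<phi>" and h1_class_test_fun: "h1_class U \<phi> = (l2_class U \<phi>, l2_class U (cgrad \<phi>))"
proof -
  have "is_weak_grad U \<phi> (cgrad \<phi>)"
    unfolding is_weak_grad_def
  proof (intro allI impI)
    fix \<psi> i assume \<psi>: "test_fun U \<psi>"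
    have "0-lipschitz_on U (\<lambda>x. 1::real)" by (rule lipschitz_onI) auto
    from lipschitz_product_bound[OF open_U this \<phi> \<psi>, of i]
    have "(\<integral>x. \<phi> x * cgrad \<psi> x $ i + cgrad \<phi> x $ i * \<psi> x \<partial>lebesgue_on U) = 0" by (simp add: mult.commute)
    moreover have "integrable (lebesgue_on U) (\<lambda>x. \<phi> x * cgrad \<psi> x $ i)"
      "integrable (lebesgue_on U) (\<lambda>x. cgrad \<phi> x $ i * \<psi> x)"
      using L2v_inner_integrable[OF test_fun_L2v[OF \<phi>] test_fun_cgrad_nth_L2v[OF \<psi>]]
        L2v_inner_integrable[OF test_fun_cgrad_nth_L2v[OF \<phi>] test_fun_L2v[OF \<psi>]] by simp_all
    ultimately show "(\<integral>x. \<phi> x * cgrad \<psi> x $ i \<partial>lebesgue_on U) = - (\<integral>x. cgrad \<phi> x $ i * \<psi> x \<partial>lebesgue_on U)"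
      by (simp add: eq_neg_iff_add_eq_0)
  qed
  then have graph: "(l2_class U \<phi>, l2_class U (cgrad \<phi>)) \<in> weak_grad_graph U"
    using weak_grad_iff_graph[OF test_fun_L2v test_fun_cgrad_L2v, OF \<phi> \<phi>] by blast
  show "H1 U \<phi>" by (rule H1I_graph[OF test_fun_L2v[OF \<phi>] graph]) simp
  show "h1_class U \<phi> = (l2_class U \<phi>, l2_class U (cgrad \<phi>))"
    by (rule h1_class_eqI[OF test_fun_L2v[OF \<phi>] graph]) simp
qed

lemma closed_subspace_sobolev0: "subspace (sobolev0 U)" "closed (sobolev0 U)"
proof -
  have "subspace (h1_class U ` Collect (test_fun U))"
    using subspace_image_of_function_space[of "test_fun U" "\<lambda>x. 0" "h1_class U"]
    by (simp add: test_fun_zero test_fun_linear h1_class_linear test_fun_H1)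
  then show "subspace (sobolev0 U)" unfolding sobolev0_def by (rule subspace_closure)
  show "closed (sobolev0 U)" by (simp add: sobolev0_def)
qed

lemma sobolev0_subset_graph: "sobolev0 U \<subseteq> weak_grad_graph U"
  unfolding sobolev0_def using closed_subspace_weak_grad_graph
  by (intro closure_minimal image_subsetI H1_class_in_graph test_fun_H1) auto

lemma sobolev0_components_supported:
  assumes "p \<in> sobolev0 U"
  shows "fst p \<in> l2_supported U" "snd p \<in> l2_supported U"
  using assms sobolev0_subset_graph by (auto simp: weak_grad_graph_def)

lemma H10_iff: "H10 U u \<longleftrightarrow> H1 U u \<and> h1_class U u \<in> sobolev0 U"
proof (cases "H1 U u")
  case True
  have limit_iff: "(\<lambda>k. h1_class U (\<phi> k)) \<longlonglongrightarrow> h1_class U u \<longleftrightarrow> (\<lambda>k. H1norm U (\<lambda>x. u x - \<phi> k x)) \<longlonglongrightarrow> 0"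
    if "\<forall>k. test_fun U (\<phi> k)" for \<phi>
    unfolding tendsto_dist_iff[of "\<lambda>k. h1_class U (\<phi> k)"] dist_norm norm_minus_commute[of _ "h1_class U u"]
    using that by (simp add: norm_h1_class_diff True test_fun_H1)
  have "h1_class U u \<in> sobolev0 U
      \<longleftrightarrow> (\<exists>\<phi>. (\<forall>k. test_fun U (\<phi> k)) \<and> (\<lambda>k. h1_class U (\<phi> k)) \<longlonglongrightarrow> h1_class U u)"
    unfolding sobolev0_def closure_image_sequential by simp
  then show ?thesis unfolding H10_def using True limit_iff by auto
qed (simp add: H10_def)

lemma H10_H1: "H10 U u \<Longrightarrow> H1 U u"
  and H10_class_in_sobolev0: "H10 U u \<Longrightarrow> h1_class U u \<in> sobolev0 U"
  by (simp_all add: H10_iff)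

lemma test_fun_H10: "test_fun U \<phi> \<Longrightarrow> H10 U \<phi>"
  by (simp add: H10_iff test_fun_H1 sobolev0_def closure_subset[THEN subsetD])

lemma H10_linear: "H10 U u \<Longrightarrow> H10 U w \<Longrightarrow> H10 U (\<lambda>x. u x + c * w x)"
  by (simp add: H10_iff H1_linear h1_class_linear subspace_add subspace_scale closed_subspace_sobolev0)

lemma
  assumes p: "p \<in> sobolev0 U"
  shows sobolev0_rep: "H10 U (rep_l2 (fst p))" and h1_class_rep: "h1_class U (rep_l2 (fst p)) = p"
proof -
  have p_graph: "p \<in> weak_grad_graph U" using p sobolev0_subset_graph by blast
  have "l2_class U (rep_l2 (fst p)) = fst p"
    by (rule l2_class_rep[OF sobolev0_components_supported(1)[OF p]])
  note H1I_graph[OF L2v_rep p_graph this] h1_class_eqI[OF L2v_rep p_graph this]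
  then show "h1_class U (rep_l2 (fst p)) = p" "H10 U (rep_l2 (fst p))" using p by (simp_all add: H10_iff)
qed


lemma closure_fst_sobolev0: "closure (fst ` sobolev0 U) = l2_supported U"
proof
  show "closure (fst ` sobolev0 U) \<subseteq> l2_supported U"
    by (intro closure_minimal closed_subspace_l2_supported) (auto dest: sobolev0_components_supported)
  have "l2_class U ` Collect (test_fun U) \<subseteq> fst ` sobolev0 U"
    using imageI[OF H10_class_in_sobolev0[OF test_fun_H10], of _ fst] by auto
  then show "l2_supported U \<subseteq> closure (fst ` sobolev0 U)"
    unfolding closure_test_funs[symmetric] by (rule closure_mono)
qed

end

section \<open>The divergence of a Lipschitz multiple of a Sobolev function\<close>

lemma (in open_domain) integral_abs_mult_le:
  assumes "L2v U f" "L2v U g"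
  shows "(\<integral>x. \<bar>f x * g x\<bar> \<partial>lebesgue_on U) \<le> norm (l2_class U f) * norm (l2_class U g)"
proof -
  have abs_L2v: "L2v U (\<lambda>x. \<bar>h x\<bar>)" and norm_abs: "norm (l2_class U (\<lambda>x. \<bar>h x\<bar>)) = norm (l2_class U h)"
    if h: "L2v U h" for h :: "'a \<Rightarrow> real"
  proof -
    show abs_L2v: "L2v U (\<lambda>x. \<bar>h x\<bar>)" using h by (auto simp: L2v_def)
    show "norm (l2_class U (\<lambda>x. \<bar>h x\<bar>)) = norm (l2_class U h)"
      by (simp add: norm_l2_class abs_L2v h L2norm_def)
  qed
  have "(\<integral>x. \<bar>f x * g x\<bar> \<partial>lebesgue_on U) = l2_class U (\<lambda>x. \<bar>f x\<bar>) \<bullet> l2_class U (\<lambda>x. \<bar>g x\<bar>)"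
    using assms by (simp add: inner_l2_class abs_L2v abs_mult)
  also have "\<dots> \<le> norm (l2_class U (\<lambda>x. \<bar>f x\<bar>)) * norm (l2_class U (\<lambda>x. \<bar>g x\<bar>))"
    by (rule norm_cauchy_schwarz)
  finally show ?thesis by (simp add: norm_abs assms)
qed

locale lipschitz_field = sobolev_domain U for U :: "(real^'n) set" +
  fixes b :: "real^'n \<Rightarrow> real^'n" and L M :: real
  assumes b_lipschitz: "\<And>i. L-lipschitz_on U (\<lambda>x. b x $ i)" and b_bounded: "\<And>x. x \<in> U \<Longrightarrow> norm (b x) \<le> M"
    and M_nonneg: "M \<ge> 0"
begin

definition transport :: "'n sobolev_pair \<Rightarrow> (real^'n, real) l2" where
  "transport p = l2_multiply U (\<bullet>) b (snd p)"

definition divergence :: "'n sobolev_pair \<Rightarrow> (real^'n, real) l2" where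
  "divergence p = l2_class U (wdiv U (\<lambda>x. rep_l2 (fst p) x *\<^sub>R b x))"

lemma L_nonneg: "0 \<le> L"
  using lipschitz_on_nonneg[OF b_lipschitz] .

lemma b_coefficient: "bounded_coefficient U (\<bullet>) b M"
proof -
  have "continuous_on U (\<lambda>x. \<chi> i. b x $ i)"
    by (intro continuous_on_vec_lambda lipschitz_on_continuous_on[OF b_lipschitz])
  then have "(\<lambda>x. indicator U x *\<^sub>R b x) \<in> borel_measurable lebesgue"
    using open_U by (intro measurable_completion) (simp add: borel_measurable_continuous_on_indicator)
  moreover have "\<bar>b x \<bullet> y\<bar> \<le> M * norm y" if "x \<in> U" for x y
    using order_trans[OF Cauchy_Schwarz_ineq2 mult_right_mono[OF b_bounded[OF that] norm_ge_zero]] .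
  ultimately show ?thesis using M_nonneg by (simp add: bounded_coefficient_def bounded_bilinear_inner)
qed

lemma bounded_linear_transport: "bounded_linear transport"
  unfolding transport_def[abs_def]
  by (rule bounded_linear_compose[OF bounded_linear_l2_multiply[OF b_coefficient] bounded_linear_snd])

lemmas transport_continuous = bounded_linear.continuous_on[OF bounded_linear_transport]

lemma norm_transport_le: "norm (transport p) \<le> M * norm p"
  unfolding transport_def
  using norm_l2_multiply_le[OF b_coefficient, of "snd p"] norm_snd_le[of "snd p" "fst p"] M_nonneg
  by (simp add: order_trans[OF _ mult_left_mono])


lemma transport_test_fun: "test_fun U \<phi> \<Longrightarrow> transport (h1_class U \<phi>) = l2_class U (\<lambda>x. b x \<bullet> cgrad \<phi> x)"
  by (simp add: transport_def h1_class_test_fun l2_multiply_class[OF b_coefficient test_fun_cgrad_L2v])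

lemma transport_inner_test_funs:
  assumes \<phi>: "test_fun U \<phi>" and \<psi>: "test_fun U \<psi>"
  defines "f \<equiv> \<lambda>i x. b x $ i * (\<phi> x * cgrad \<psi> x $ i + \<psi> x * cgrad \<phi> x $ i)"
  shows "l2_class U \<phi> \<bullet> transport (h1_class U \<psi>) + l2_class U \<psi> \<bullet> transport (h1_class U \<phi>)
    = (\<Sum>i\<in>UNIV. \<integral>x. f i x \<partial>lebesgue_on U)"
proof -
  have b_nth_L2v: "L2v U (\<lambda>x. b x $ i * h x)" if "L2v U h" for h i
    using L2v_multiply[OF b_coefficient L2v_scaleR_const[OF that, of "axis i 1"]]
    by (simp add: inner_axis mult.commute)
  have f_integrable: "integrable (lebesgue_on U) (f i)" for i
  proof -
    have "integrable (lebesgue_on U)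
        (\<lambda>x. \<phi> x \<bullet> (b x $ i * cgrad \<psi> x $ i) + \<psi> x \<bullet> (b x $ i * cgrad \<phi> x $ i))"
      by (intro Bochner_Integration.integrable_add L2v_inner_integrable test_fun_L2v b_nth_L2v
          test_fun_cgrad_nth_L2v \<phi> \<psi>)
    then show ?thesis by (simp add: f_def algebra_simps)
  qed
  note b_grad_L2v = L2v_multiply[OF b_coefficient test_fun_cgrad_L2v]
  have "l2_class U \<phi> \<bullet> transport (h1_class U \<psi>) + l2_class U \<psi> \<bullet> transport (h1_class U \<phi>)
      = (\<integral>x. \<phi> x \<bullet> (b x \<bullet> cgrad \<psi> x) \<partial>lebesgue_on U) + (\<integral>x. \<psi> x \<bullet> (b x \<bullet> cgrad \<phi> x) \<partial>lebesgue_on U)"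
    by (simp add: transport_test_fun \<phi> \<psi> inner_l2_class test_fun_L2v b_grad_L2v)
  also have "\<dots> = (\<integral>x. \<phi> x \<bullet> (b x \<bullet> cgrad \<psi> x) + \<psi> x \<bullet> (b x \<bullet> cgrad \<phi> x) \<partial>lebesgue_on U)"
    by (intro Bochner_Integration.integral_add[symmetric] L2v_inner_integrable test_fun_L2v b_grad_L2v \<phi> \<psi>)
  also have "\<dots> = (\<integral>x. (\<Sum>i\<in>UNIV. f i x) \<partial>lebesgue_on U)"
    by (intro Bochner_Integration.integral_cong refl)
      (simp add: f_def inner_vec_def sum_distrib_left sum.distrib algebra_simps)
  also have "\<dots> = (\<Sum>i\<in>UNIV. \<integral>x. f i x \<partial>lebesgue_on U)"
    by (intro Bochner_Integration.integral_sum f_integrable)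
  finally show ?thesis .
qed

lemma transport_symmetric_bound_test_funs:
  assumes \<phi>: "test_fun U \<phi>" and \<psi>: "test_fun U \<psi>"
  shows "\<bar>l2_class U \<phi> \<bullet> transport (h1_class U \<psi>) + l2_class U \<psi> \<bullet> transport (h1_class U \<phi>)\<bar>
    \<le> real CARD('n) * L * norm (l2_class U \<phi>) * norm (l2_class U \<psi>)"
proof -
  let ?f = "\<lambda>i x. b x $ i * (\<phi> x * cgrad \<psi> x $ i + \<psi> x * cgrad \<phi> x $ i)"
  have "\<bar>\<integral>x. ?f i x \<partial>lebesgue_on U\<bar> \<le> L * (norm (l2_class U \<phi>) * norm (l2_class U \<psi>))" for i
    by (rule order_trans[OF lipschitz_product_bound[OF open_U b_lipschitz \<phi> \<psi>] mult_left_mono])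
      (auto intro: integral_abs_mult_le test_fun_L2v \<phi> \<psi> L_nonneg)
  then have "\<bar>\<Sum>i\<in>UNIV. \<integral>x. ?f i x \<partial>lebesgue_on U\<bar>
      \<le> (\<Sum>i\<in>(UNIV::'n set). L * (norm (l2_class U \<phi>) * norm (l2_class U \<psi>)))"
    by (intro order_trans[OF sum_abs sum_mono])
  then show ?thesis
    unfolding transport_inner_test_funs[OF \<phi> \<psi>] by (simp add: mult_ac)
qed

text \<open>Up to the Lipschitz constant, \<open>b \<cdot> \<nabla>\<close> is skew.\<close>
theorem transport_symmetric_bound:
  assumes p: "p \<in> sobolev0 U" and q: "q \<in> sobolev0 U"
  shows "\<bar>fst p \<bullet> transport q + fst q \<bullet> transport p\<bar> \<le> real CARD('n) * L * norm (fst p) * norm (fst q)"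
    (is "?P p q")
proof -
  note closed_bound = closed_Collect_le continuous_intros transport_continuous
  have "?P (h1_class U \<phi>) q" if \<phi>: "test_fun U \<phi>" for \<phi>
  proof -
    have "sobolev0 U \<subseteq> {q. ?P (h1_class U \<phi>) q}"
      unfolding sobolev0_def
    proof (rule closure_minimal)
      show "closed {q. ?P (h1_class U \<phi>) q}" by (intro closed_bound)
      show "h1_class U ` Collect (test_fun U) \<subseteq> {q. ?P (h1_class U \<phi>) q}"
        using transport_symmetric_bound_test_funs[OF \<phi>] by auto
    qed
    then show ?thesis using q by blast
  qed
  then have "sobolev0 U \<subseteq> {p. ?P p q}"
    unfolding sobolev0_def by (intro closure_minimal closed_bound) auto
  then show ?thesis using p by blast
qed

lemma weak_div_iff_transport:
  assumes u: "L2v U u" and d: "L2v U d"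
  shows "is_weak_div U (\<lambda>x. u x *\<^sub>R b x) d
    \<longleftrightarrow> (\<forall>\<psi>. test_fun U \<psi> \<longrightarrow> l2_class U d \<bullet> l2_class U \<psi> = - (l2_class U u \<bullet> transport (h1_class U \<psi>)))"
proof -
  have "(\<integral>x. d x * \<psi> x \<partial>lebesgue_on U) = l2_class U d \<bullet> l2_class U \<psi>"
    "(\<integral>x. (u x *\<^sub>R b x) \<bullet> cgrad \<psi> x \<partial>lebesgue_on U) = l2_class U u \<bullet> transport (h1_class U \<psi>)"
    if \<psi>: "test_fun U \<psi>" for \<psi>
    using inner_l2_class[OF d test_fun_L2v[OF \<psi>]]
      inner_l2_class[OF u L2v_multiply[OF b_coefficient test_fun_cgrad_L2v[OF \<psi>]]]
    by (simp_all add: transport_test_fun[OF \<psi>])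
  then show ?thesis unfolding is_weak_div_def by auto
qed

lemma transport_functional_bound:
  assumes p: "p \<in> sobolev0 U" and \<psi>: "test_fun U \<psi>"
  shows "\<bar>fst p \<bullet> transport (h1_class U \<psi>)\<bar> \<le> (real CARD('n) * L + M) * norm p * norm (l2_class U \<psi>)"
proof -
  have "\<bar>fst p \<bullet> transport (h1_class U \<psi>) + l2_class U \<psi> \<bullet> transport p\<bar>
      \<le> real CARD('n) * L * norm (fst p) * norm (l2_class U \<psi>)"
    using transport_symmetric_bound[OF p H10_class_in_sobolev0[OF test_fun_H10[OF \<psi>]]] by simp
  also have "\<dots> \<le> real CARD('n) * L * norm p * norm (l2_class U \<psi>)"
    using norm_fst_le[of "fst p" "snd p"] L_nonneg by (intro mult_right_mono mult_left_mono) auto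
  finally have symmetric_part: "\<bar>fst p \<bullet> transport (h1_class U \<psi>) + l2_class U \<psi> \<bullet> transport p\<bar>
      \<le> real CARD('n) * L * norm p * norm (l2_class U \<psi>)" .
  have "\<bar>l2_class U \<psi> \<bullet> transport p\<bar> \<le> norm (l2_class U \<psi>) * (M * norm p)"
    by (rule order_trans[OF Cauchy_Schwarz_ineq2 mult_left_mono[OF norm_transport_le norm_ge_zero]])
  then show ?thesis using symmetric_part by (simp add: algebra_simps)
qed

lemma weak_div_exists:
  assumes u: "H10 U u"
  shows "\<exists>d. L2 U d \<and> is_weak_div U (\<lambda>x. u x *\<^sub>R b x) d"
proof -
  interpret transport: bounded_linear transport by (rule bounded_linear_transport)
  note u_L2v = H1_L2v[OF H10_H1[OF u]]
  let ?F = "\<lambda>\<psi>. - (l2_class U u \<bullet> transport (h1_class U \<psi>))"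
  have "\<exists>z\<in>closure (l2_class U ` Collect (test_fun U)). \<forall>\<psi>. test_fun U \<psi> \<longrightarrow> ?F \<psi> = l2_class U \<psi> \<bullet> z"
  proof (rule riesz_representation_of_function_space[of _ "\<lambda>x. 0"])
    show "\<bar>?F \<psi>\<bar> \<le> (real CARD('n) * L + M) * norm (h1_class U u) * norm (l2_class U \<psi>)" if
      "test_fun U \<psi>" for \<psi>
      using transport_functional_bound[OF H10_class_in_sobolev0[OF u] that] by simp
    fix \<phi> \<psi> c assume \<phi>: "test_fun U \<phi>" and \<psi>: "test_fun U \<psi>"
    show "l2_class U (\<lambda>x. \<phi> x + c * \<psi> x) = l2_class U \<phi> + c *\<^sub>R l2_class U \<psi>"
      using l2_class_linear[OF test_fun_L2v[OF \<phi>] test_fun_L2v[OF \<psi>]] by simp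
    show "?F (\<lambda>x. \<phi> x + c * \<psi> x) = ?F \<phi> + c * ?F \<psi>"
      by (simp add: h1_class_linear test_fun_H1 \<phi> \<psi> transport.add transport.scaleR inner_add_right)
  qed (rule test_fun_zero test_fun_linear; assumption)+
  then obtain z where z: "z \<in> l2_supported U" "\<forall>\<psi>. test_fun U \<psi> \<longrightarrow> ?F \<psi> = l2_class U \<psi> \<bullet> z"
    unfolding closure_test_funs by blast
  from l2_class_rep[OF z(1)] have "is_weak_div U (\<lambda>x. u x *\<^sub>R b x) (rep_l2 z)"
    unfolding weak_div_iff_transport[OF u_L2v L2v_rep] using z(2) by (simp add: inner_commute)
  then show ?thesis using L2v_rep by (auto simp: L2_eq_L2v)
qed

lemma
  assumes u: "H10 U u"
  shows wdiv_L2v: "L2v U (wdiv U (\<lambda>x. u x *\<^sub>R b x))"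
    and wdiv_inner_test_fun: "test_fun U \<psi> \<Longrightarrow>
      l2_class U (wdiv U (\<lambda>x. u x *\<^sub>R b x)) \<bullet> l2_class U \<psi> = - (l2_class U u \<bullet> transport (h1_class U \<psi>))"
proof -
  have wdiv: "L2v U (wdiv U (\<lambda>x. u x *\<^sub>R b x))" "is_weak_div U (\<lambda>x. u x *\<^sub>R b x) (wdiv U (\<lambda>x. u x *\<^sub>R b x))"
    using someI_ex[OF weak_div_exists[OF u]] unfolding wdiv_def L2_eq_L2v by auto
  then show "L2v U (wdiv U (\<lambda>x. u x *\<^sub>R b x))" by simp
  show "test_fun U \<psi> \<Longrightarrow>
      l2_class U (wdiv U (\<lambda>x. u x *\<^sub>R b x)) \<bullet> l2_class U \<psi> = - (l2_class U u \<bullet> transport (h1_class U \<psi>))"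
    using wdiv(2) unfolding weak_div_iff_transport[OF H1_L2v[OF H10_H1[OF u]] wdiv(1)] by blast
qed

lemma divergence_supported: "p \<in> sobolev0 U \<Longrightarrow> divergence p \<in> l2_supported U"
  unfolding divergence_def by (intro l2_class_supported wdiv_L2v sobolev0_rep)

theorem divergence_inner:
  assumes p: "p \<in> sobolev0 U" and q: "q \<in> sobolev0 U"
  shows "divergence p \<bullet> fst q = - (fst p \<bullet> transport q)"
proof -
  have "sobolev0 U \<subseteq> {q. divergence p \<bullet> fst q = - (fst p \<bullet> transport q)}"
    unfolding sobolev0_def
  proof (rule closure_minimal)
    show "h1_class U ` Collect (test_fun U) \<subseteq> {q. divergence p \<bullet> fst q = - (fst p \<bullet> transport q)}"
      using wdiv_inner_test_fun[OF sobolev0_rep[OF p]]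
        l2_class_rep[OF sobolev0_components_supported(1)[OF p]]
      by (auto simp: divergence_def)
    show "closed {q. divergence p \<bullet> fst q = - (fst p \<bullet> transport q)}"
      by (intro closed_Collect_eq continuous_intros transport_continuous)
  qed
  then show ?thesis using q by blast
qed

lemma divergence_eqI:
  assumes p: "p \<in> sobolev0 U" and z: "z \<in> l2_supported U"
    and inner: "\<And>\<psi>. test_fun U \<psi> \<Longrightarrow> z \<bullet> l2_class U \<psi> = - (fst p \<bullet> transport (h1_class U \<psi>))"
  shows "divergence p = z"
proof (rule eq_if_inner_eq_on_total[OF closed_subspace_l2_supported(1) total_in_test_funs
      divergence_supported[OF p] z])
  show "divergence p \<bullet> y = z \<bullet> y" if "y \<in> l2_class U ` Collect (test_fun U)" for y
    using that inner divergence_inner[OF p H10_class_in_sobolev0[OF test_fun_H10]] by auto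
qed

lemma divergence_h1_class: "H10 U u \<Longrightarrow> divergence (h1_class U u) = l2_class U (wdiv U (\<lambda>x. u x *\<^sub>R b x))"
  by (rule divergence_eqI)
    (simp_all add: H10_class_in_sobolev0 l2_class_supported wdiv_L2v wdiv_inner_test_fun)

lemma linear_form_on_divergence: "linear_form_on (sobolev0 U) (\<lambda>p. h \<bullet> divergence p)"
proof (rule linear_form_onI)
  fix p q c assume p: "p \<in> sobolev0 U" and q: "q \<in> sobolev0 U"
  have "divergence (p + c *\<^sub>R q) = divergence p + c *\<^sub>R divergence q"
  proof (rule divergence_eqI)
    show "p + c *\<^sub>R q \<in> sobolev0 U" "divergence p + c *\<^sub>R divergence q \<in> l2_supported U"
      by (intro subspace_add subspace_scale closed_subspace_sobolev0 closed_subspace_l2_supported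
          divergence_supported p q)+
    show "(divergence p + c *\<^sub>R divergence q) \<bullet> l2_class U \<psi>
        = - (fst (p + c *\<^sub>R q) \<bullet> transport (h1_class U \<psi>))"
      if "test_fun U \<psi>" for \<psi>
      using divergence_inner[OF p H10_class_in_sobolev0[OF test_fun_H10[OF that]]]
        divergence_inner[OF q H10_class_in_sobolev0[OF test_fun_H10[OF that]]]
      by (simp add: inner_add_left)
  qed
  then show "h \<bullet> divergence (p + c *\<^sub>R q) = h \<bullet> divergence p + c * (h \<bullet> divergence q)"
    by (simp add: inner_add_right)
qed

lemma norm_divergence_le:
  assumes p: "p \<in> sobolev0 U"
  shows "norm (divergence p) \<le> (real CARD('n) * L + M) * norm p"
proof -
  let ?K = "(real CARD('n) * L + M) * norm p"
  have "closure (l2_class U ` Collect (test_fun U)) \<subseteq> {y. \<bar>divergence p \<bullet> y\<bar> \<le> ?K * norm y}"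
  proof (rule closure_minimal)
    show "closed {y. \<bar>divergence p \<bullet> y\<bar> \<le> ?K * norm y}" by (intro closed_Collect_le continuous_intros)
    show "l2_class U ` Collect (test_fun U) \<subseteq> {y. \<bar>divergence p \<bullet> y\<bar> \<le> ?K * norm y}"
      using transport_functional_bound[OF p] divergence_inner[OF p H10_class_in_sobolev0[OF test_fun_H10]]
      by auto
  qed
  then have "\<bar>divergence p \<bullet> divergence p\<bar> \<le> ?K * norm (divergence p)"
    using divergence_supported[OF p] unfolding closure_test_funs by blast
  then show ?thesis
    using L_nonneg M_nonneg
    by (intro norm_le_if_norm_sq_le_mult) (simp_all add: power2_norm_eq_inner flip: power2_eq_square)
qed

lemma divergence_skew:
  assumes p: "p \<in> sobolev0 U"
  shows "- (real CARD('n) * L) * (norm (fst p))\<^sup>2 \<le> 2 * (fst p \<bullet> divergence p)"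
  using transport_symmetric_bound[OF p p] divergence_inner[OF p p]
  by (simp add: inner_commute[of "divergence p"] power2_eq_square)

end

section \<open>The operators of the wave equation\<close>

subsection \<open>Measurability of integrals depending on a parameter\<close>

lemma lebesgue_borel_version:
  fixes f :: "'a::euclidean_space \<Rightarrow> 'b::euclidean_space"
  assumes S: "S \<in> sets lebesgue" and f: "f \<in> borel_measurable (lebesgue_on S)"
  shows "\<exists>f'. f' \<in> borel_measurable borel \<and> (AE z in lborel. z \<in> S \<longrightarrow> f z = f' z)"
proof -
  let ?f = "\<lambda>z. indicator S z *\<^sub>R f z"
  have f_measurable: "?f \<in> borel_measurable lebesgue" using f lebesgue_on_indicator(3)[OF S] by blast
  have "\<exists>F. F \<in> borel_measurable lborel \<and> (AE z in lborel. ?f z \<bullet> i = F z)" for i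
    using completion_ex_borel_measurable_real[OF
        borel_measurable_inner[OF f_measurable borel_measurable_const[of i]]]
    by blast
  then obtain F where F: "\<And>i. F i \<in> borel_measurable lborel" "\<And>i. AE z in lborel. ?f z \<bullet> i = F i z"
    by metis
  have "AE z in lborel. \<forall>i\<in>Basis. ?f z \<bullet> i = F i z" using F(2) by (intro AE_finite_allI) auto
  then have "AE z in lborel. z \<in> S \<longrightarrow> f z = (\<Sum>i\<in>Basis. F i z *\<^sub>R i)"
  proof eventually_elim
    case (elim z)
    have "f z = (\<Sum>i\<in>Basis. (f z \<bullet> i) *\<^sub>R i)" by (simp add: euclidean_representation)
    then show ?case using elim by (auto intro: sum.cong)
  qed
  moreover have "(\<lambda>z. \<Sum>i\<in>Basis. F i z *\<^sub>R i) \<in> borel_measurable borel"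
    using F(1) by (intro borel_measurable_sum borel_measurable_scaleR borel_measurable_const) simp
  ultimately show ?thesis by blast
qed

lemma borel_measurable_section:
  "k \<in> borel_measurable borel \<Longrightarrow> (\<lambda>x. k (t, x)) \<in> borel_measurable borel"
  by (rule measurable_compose[OF _ _, of "Pair t"])
    (auto intro!: borel_measurable_continuous_onI continuous_intros)

lemma borel_measurable_param_integral:
  fixes k :: "real \<times> 'a::euclidean_space \<Rightarrow> 'b::euclidean_space"
  assumes U: "open U" and k: "k \<in> borel_measurable borel" and h: "h \<in> borel_measurable (lebesgue_on U)"
  shows "(\<lambda>t. \<integral>x. k (t, x) \<bullet> h x \<partial>lebesgue_on U) \<in> borel_measurable borel"
proof -
  have U_sets: "U \<in> sets lebesgue" using U by auto
  obtain h' where h': "h' \<in> borel_measurable borel" "AE x in lborel. x \<in> U \<longrightarrow> h x = h' x"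
    using lebesgue_borel_version[OF U_sets h] by blast
  have [measurable]: "h' \<in> borel_measurable borel" "U \<in> sets borel" using h'(1) U by auto
  have k_pair[measurable]: "k \<in> borel_measurable (borel \<Otimes>\<^sub>M borel)" using k by (simp add: borel_prod)
  have [measurable]: "(\<lambda>x. k (t, x)) \<in> borel_measurable borel" for t
    by (rule borel_measurable_section[OF k])
  have "(\<integral>x. k (t, x) \<bullet> h x \<partial>lebesgue_on U) = (\<integral>x. indicator U x *\<^sub>R (k (t, x) \<bullet> h' x) \<partial>lborel)" for t
  proof -
    have "(\<integral>x. k (t, x) \<bullet> h x \<partial>lebesgue_on U) = (\<integral>x. k (t, x) \<bullet> h' x \<partial>lebesgue_on U)"
    proof (rule integral_cong_AE)
      have "AE x in lebesgue. x \<in> U \<longrightarrow> h x = h' x" using h'(2) by (rule AE_completion)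
      then show "AE x in lebesgue_on U. k (t, x) \<bullet> h x = k (t, x) \<bullet> h' x"
        using U_sets by (subst AE_restrict_space_iff) (auto elim: eventually_mono)
    qed (intro borel_measurable_inner h measurable_restrict_space1 measurable_completion; simp)+
    also have "\<dots> = (\<integral>x. indicator U x *\<^sub>R (k (t, x) \<bullet> h' x) \<partial>lebesgue)"
      by (rule lebesgue_on_indicator(1)[OF U_sets])
    also have "\<dots> = (\<integral>x. indicator U x *\<^sub>R (k (t, x) \<bullet> h' x) \<partial>lborel)"
      by (rule integral_completion) measurable
    finally show ?thesis .
  qed
  moreover have "(\<lambda>t. \<integral>x. indicator U x *\<^sub>R (k (t, x) \<bullet> h' x) \<partial>lborel) \<in> borel_measurable borel"
    by (rule lborel.borel_measurable_lebesgue_integral) measurable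
  ultimately show ?thesis by simp
qed

lemma borel_measurable_lebesgue_onI:
  "f \<in> borel_measurable borel \<Longrightarrow> f \<in> borel_measurable (lebesgue_on S)"
  by (intro measurable_restrict_space1 measurable_completion) simp

lemma norm_matrix_vector_le: "norm (A *v w) \<le> norm A * norm (w :: real^'n)" for A :: "real^'n^'m"
proof -
  have "norm (A *v w) = L2_set (\<lambda>i. norm (A $ i \<bullet> w)) UNIV" by (simp add: norm_vec_def matrix_mult_dot)
  also have "\<dots> \<le> L2_set (\<lambda>i. norm (A $ i) * norm w) UNIV"
    by (intro L2_set_mono) (auto simp: Cauchy_Schwarz_ineq2)
  also have "\<dots> = norm A * norm w" by (simp add: norm_vec_def L2_set_left_distrib)
  finally show ?thesis .
qed

lemma bounded_bilinear_matrix_vector: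
  "bounded_bilinear (matrix_vector_mult :: real^'n^'m \<Rightarrow> real^'n \<Rightarrow> real^'m)"
proof
  show "\<exists>K. \<forall>(A :: real^'n^'m) w. norm (A *v w) \<le> norm A * norm w * K"
    using norm_matrix_vector_le by (intro exI[of _ 1]) auto
qed (simp_all add: matrix_vector_mult_add_rdistrib matrix_vector_right_distrib scaleR_matrix_vector_assoc
    matrix_vector_mult_scaleR)

lemma (in open_domain) norm_l2_multiply_diff_le:
  assumes c: "bounded_coefficient U \<mu> c K" and d: "bounded_coefficient U \<mu> d K'"
    and diff: "0 \<le> \<delta>" "\<And>x y. x \<in> U \<Longrightarrow> norm (\<mu> (c x - d x) y) \<le> \<delta> * norm y"
  shows "norm (l2_multiply U \<mu> c q - l2_multiply U \<mu> d q) \<le> \<delta> * norm q"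
proof -
  interpret bounded_bilinear \<mu> using c by (simp add: bounded_coefficient_def)
  have "(\<lambda>x. indicator U x *\<^sub>R c x - indicator U x *\<^sub>R d x) \<in> borel_measurable lebesgue"
    using c d by (intro borel_measurable_diff) (simp_all add: bounded_coefficient_def)
  then have c_minus_d: "bounded_coefficient U \<mu> (\<lambda>x. c x - d x) \<delta>"
    using c diff by (simp add: bounded_coefficient_def scaleR_diff_right)
  have "l2_multiply U \<mu> (\<lambda>x. c x - d x) q = l2_multiply U \<mu> c q - l2_multiply U \<mu> d q"
    using l2_class_linear[OF L2v_multiply[OF c L2v_rep[of q]] L2v_multiply[OF d L2v_rep[of q]], of "-1"]
    by (simp add: l2_multiply_def diff_left)
  then show ?thesis using norm_l2_multiply_le[OF c_minus_d, of q] by simp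
qed

subsection \<open>The operators and their bounds\<close>

locale wave_data = sobolev_domain U for U :: "(real^'n) set" +
  fixes T :: real
    and B :: "real \<Rightarrow> real^'n \<Rightarrow> real^'n^'n" and b :: "real \<Rightarrow> real^'n \<Rightarrow> real^'n"
    and a :: "real \<times> (real^'n) \<Rightarrow> real^'n" and g :: "real \<times> (real^'n) \<Rightarrow> real"
    and v0 v1 :: "real^'n \<Rightarrow> real" and L\<^sub>B M\<^sub>B c\<^sub>B M\<^sub>a L\<^sub>b M\<^sub>b :: real
  assumes T_pos: "T > 0"
    and B_lipschitz: "\<And>t s x y. t \<in> {0..T} \<Longrightarrow> s \<in> {0..T} \<Longrightarrow> x \<in> U \<Longrightarrow> y \<in> U \<Longrightarrow>
      norm (B t x - B s y) \<le> L\<^sub>B * (\<bar>t - s\<bar> + norm (x - y))"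
    and B_bounded: "\<And>t x. t \<in> {0..T} \<Longrightarrow> x \<in> U \<Longrightarrow> norm (B t x) \<le> M\<^sub>B"
    and B_symmetric: "\<And>t x. t \<in> {0..T} \<Longrightarrow> x \<in> U \<Longrightarrow> transpose (B t x) = B t x"
    and B_elliptic: "\<And>t x w. t \<in> {0..T} \<Longrightarrow> x \<in> U \<Longrightarrow> c\<^sub>B * (norm w)\<^sup>2 \<le> (B t x *v w) \<bullet> w"
    and a_borel: "a \<in> borel_measurable borel" and a_bounded: "\<And>z. norm (a z) \<le> M\<^sub>a"
    and b_lipschitz: "\<And>t s x y. t \<in> {0..T} \<Longrightarrow> s \<in> {0..T} \<Longrightarrow> x \<in> U \<Longrightarrow> y \<in> U \<Longrightarrow>
      norm (b t x - b s y) \<le> L\<^sub>b * (\<bar>t - s\<bar> + norm (x - y))"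
    and b_bounded: "\<And>t x. t \<in> {0..T} \<Longrightarrow> x \<in> U \<Longrightarrow> norm (b t x) \<le> M\<^sub>b"
    and g_borel: "g \<in> borel_measurable borel" and g_L2: "(\<integral>\<^sup>+z. ennreal ((g z)\<^sup>2) \<partial>lborel) < \<infinity>"
    and v0: "H10 U v0" and v1: "L2v U v1"
    and constants_nonneg: "0 \<le> L\<^sub>B" "0 \<le> M\<^sub>B" "0 < c\<^sub>B" "0 \<le> M\<^sub>a" "0 \<le> L\<^sub>b" "0 \<le> M\<^sub>b"
begin

definition principal_part :: "real \<Rightarrow> 'n sobolev_pair \<Rightarrow> 'n sobolev_pair" where
  "principal_part t p = (fst p, l2_multiply U matrix_vector_mult (B t) (snd p))"

text \<open>The first component compensates the zeroth-order term that makes \<^const>\<open>principal_part\<close> coercive.\<close>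
definition convection :: "real \<Rightarrow> 'n sobolev_pair \<Rightarrow> 'n sobolev_pair" where
  "convection t p = (- fst p, l2_multiply U (\<lambda>w r. r *\<^sub>R w) (\<lambda>x. a (t, x)) (fst p))"

definition mixed :: "real \<Rightarrow> 'n sobolev_pair \<Rightarrow> (real^'n, real) l2" where
  "mixed t p = 2 *\<^sub>R lipschitz_field.divergence U (b t) p"

definition source :: "real \<Rightarrow> (real^'n, real) l2" where
  "source t = (if (\<integral>\<^sup>+x. ennreal ((g (t, x))\<^sup>2) \<partial>lborel) < \<infinity> then l2_class U (\<lambda>x. g (t, x)) else 0)"

definition operator_bound :: real where
  "operator_bound = (1 + M\<^sub>B) + L\<^sub>B + (1 + M\<^sub>a) + 2 * (real CARD('n) * L\<^sub>b + M\<^sub>b)"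

lemma B_coefficient:
  assumes t: "t \<in> {0..T}"
  shows "bounded_coefficient U matrix_vector_mult (B t) M\<^sub>B"
proof -
  have "L\<^sub>B-lipschitz_on U (B t)"
    using B_lipschitz[OF t t] constants_nonneg by (intro lipschitz_onI) (auto simp: dist_norm)
  then have "(\<lambda>x. indicator U x *\<^sub>R B t x) \<in> borel_measurable lebesgue"
    using open_U lipschitz_on_continuous_on[of L\<^sub>B U "B t"]
    by (intro measurable_completion) (simp add: borel_measurable_continuous_on_indicator)
  moreover have "norm (B t x *v w) \<le> M\<^sub>B * norm w" if "x \<in> U" for x w
    using order_trans[OF norm_matrix_vector_le mult_right_mono[OF B_bounded[OF t that] norm_ge_zero]] .
  ultimately show ?thesis
    using constants_nonneg by (simp add: bounded_coefficient_def bounded_bilinear_matrix_vector)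
qed

lemma a_coefficient: "bounded_coefficient U (\<lambda>w r. r *\<^sub>R w) (\<lambda>x. a (t, x)) M\<^sub>a"
proof -
  have "(\<lambda>x. indicator U x *\<^sub>R a (t, x)) \<in> borel_measurable lebesgue"
    using U_sets borel_measurable_section[OF a_borel]
    by (intro borel_measurable_scaleR borel_measurable_indicator measurable_completion) auto
  moreover have "\<bar>r\<bar> * norm (a (t, x)) \<le> M\<^sub>a * \<bar>r\<bar>" for x r
    using mult_right_mono[OF a_bounded abs_ge_zero, of "(t, x)" r] by (simp add: mult.commute)
  ultimately show ?thesis
    using constants_nonneg bounded_bilinear.flip[OF bounded_bilinear_scaleR]
    by (simp add: bounded_coefficient_def)
qed

lemma b_lipschitz_field:
  assumes t: "t \<in> {0..T}"
  shows "lipschitz_field U (b t) L\<^sub>b M\<^sub>b"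
proof
  show "L\<^sub>b-lipschitz_on U (\<lambda>x. b t x $ i)" for i
  proof (rule lipschitz_onI)
    fix x y assume "x \<in> U" "y \<in> U"
    then have "norm (b t x - b t y) \<le> L\<^sub>b * norm (x - y)" using b_lipschitz[OF t t, of x y] by simp
    then show "dist (b t x $ i) (b t y $ i) \<le> L\<^sub>b * dist x y"
      using component_le_norm_cart[of "b t x - b t y" i] by (simp add: dist_norm)
  qed (use constants_nonneg in simp)
qed (use b_bounded[OF t] constants_nonneg in auto)

lemma linear_principal_part:
  assumes t: "t \<in> {0..T}"
  shows "linear (principal_part t)"
  unfolding principal_part_def[abs_def]
  by (intro bounded_linear.linear bounded_linear_Pair bounded_linear_fst
      bounded_linear_compose[OF bounded_linear_l2_multiply[OF B_coefficient[OF t]] bounded_linear_snd])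

lemma norm_principal_part_le:
  assumes t: "t \<in> {0..T}"
  shows "norm (principal_part t p) \<le> (1 + M\<^sub>B) * norm p"
proof -
  have "norm (principal_part t p) \<le> norm (fst p) + norm (l2_multiply U matrix_vector_mult (B t) (snd p))"
    unfolding principal_part_def by (rule norm_Pair_le)
  also have "\<dots> \<le> norm p + M\<^sub>B * norm p"
    using norm_fst_le[of "fst p" "snd p"] norm_snd_le[of "snd p" "fst p"] constants_nonneg
    by (intro add_mono order_trans[OF norm_l2_multiply_le[OF B_coefficient[OF t]] mult_left_mono]) auto
  finally show ?thesis by (simp add: algebra_simps)
qed

lemma
  assumes t: "t \<in> {0..T}" and p: "p \<in> l2_supported U"
  shows inner_B_multiply: "p \<bullet> l2_multiply U matrix_vector_mult (B t) q
      = (\<integral>x. rep_l2 p x \<bullet> (B t x *v rep_l2 q x) \<partial>lebesgue_on U)"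
    and inner_B_integrable: "integrable (lebesgue_on U) (\<lambda>x. rep_l2 p x \<bullet> (B t x *v rep_l2 q x))"
  using inner_l2_class[OF L2v_rep[of p] L2v_multiply[OF B_coefficient[OF t] L2v_rep[of q]]]
    L2v_inner_integrable[OF L2v_rep[of p] L2v_multiply[OF B_coefficient[OF t] L2v_rep[of q]]]
      l2_class_rep[OF p]
  by (simp_all add: l2_multiply_def)

lemma principal_part_symmetric:
  assumes t: "t \<in> {0..T}" and p: "p \<in> sobolev0 U" and q: "q \<in> sobolev0 U"
  shows "p \<bullet> principal_part t q = q \<bullet> principal_part t p"
proof -
  have "w \<bullet> (B t x *v z) = z \<bullet> (B t x *v w)" if "x \<in> U" for x w z
  proof -
    have "w \<bullet> (B t x *v z) = (transpose (B t x) *v w) \<bullet> z" by (simp add: dot_lmul_matrix)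
    then show ?thesis by (simp only: B_symmetric[OF t that] inner_commute)
  qed
  then have "snd p \<bullet> l2_multiply U matrix_vector_mult (B t) (snd q)
      = snd q \<bullet> l2_multiply U matrix_vector_mult (B t) (snd p)"
    unfolding inner_B_multiply[OF t sobolev0_components_supported(2)[OF p]]
      inner_B_multiply[OF t sobolev0_components_supported(2)[OF q]]
    by (intro Bochner_Integration.integral_cong refl) auto
  then show ?thesis by (simp add: principal_part_def inner_prod_def inner_commute[of "fst p"])
qed

lemma principal_part_coercive:
  assumes t: "t \<in> {0..T}" and p: "p \<in> sobolev0 U"
  shows "min 1 c\<^sub>B * (norm p)\<^sup>2 \<le> p \<bullet> principal_part t p"
proof -
  note supported = sobolev0_components_supported(2)[OF p]
  have "c\<^sub>B * (norm (snd p))\<^sup>2 = (\<integral>x. c\<^sub>B * (norm (rep_l2 (snd p) x))\<^sup>2 \<partial>lebesgue_on U)"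
    using norm_sq_l2_class[OF L2v_rep[of "snd p"]] l2_class_rep[OF supported] by simp
  also have "\<dots> \<le> snd p \<bullet> l2_multiply U matrix_vector_mult (B t) (snd p)"
    unfolding inner_B_multiply[OF t supported]
    using B_elliptic[OF t] L2v_rep[of "snd p"] inner_B_integrable[OF t supported]
    by (intro integral_mono) (auto simp: L2v_def inner_commute)
  finally have elliptic: "c\<^sub>B * (norm (snd p))\<^sup>2 \<le> snd p \<bullet> l2_multiply U matrix_vector_mult (B t) (snd p)" .
  have "min 1 c\<^sub>B * (norm p)\<^sup>2 = min 1 c\<^sub>B * (norm (fst p))\<^sup>2 + min 1 c\<^sub>B * (norm (snd p))\<^sup>2"
    by (simp add: norm_prod_def distrib_left)
  also have "\<dots> \<le> 1 * (norm (fst p))\<^sup>2 + c\<^sub>B * (norm (snd p))\<^sup>2" by (intro add_mono mult_right_mono) auto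
  also have "\<dots> \<le> p \<bullet> principal_part t p"
    using elliptic by (simp add: principal_part_def inner_prod_def power2_norm_eq_inner)
  finally show ?thesis .
qed

lemma principal_part_lipschitz:
  assumes s: "s \<in> {0..T}" and t: "t \<in> {0..T}"
  shows "\<bar>p \<bullet> principal_part s q - p \<bullet> principal_part t q\<bar> \<le> L\<^sub>B * \<bar>s - t\<bar> * norm p * norm q"
proof -
  let ?B = "\<lambda>t. l2_multiply U matrix_vector_mult (B t) (snd q)"
  have "\<bar>p \<bullet> principal_part s q - p \<bullet> principal_part t q\<bar> = \<bar>snd p \<bullet> (?B s - ?B t)\<bar>"
    by (simp add: principal_part_def inner_prod_def inner_diff_right)
  also have "\<dots> \<le> norm (snd p) * norm (?B s - ?B t)" by (rule Cauchy_Schwarz_ineq2)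
  also have "\<dots> \<le> norm p * (L\<^sub>B * \<bar>s - t\<bar> * norm q)"
  proof (rule mult_mono)
    have "norm ((B s x - B t x) *v w) \<le> L\<^sub>B * \<bar>s - t\<bar> * norm w" if "x \<in> U" for x w
      using order_trans[OF norm_matrix_vector_le
        mult_right_mono[OF B_lipschitz[OF s t that that] norm_ge_zero]]
      by simp
    then have "norm (?B s - ?B t) \<le> L\<^sub>B * \<bar>s - t\<bar> * norm (snd q)"
      using constants_nonneg
      by (intro norm_l2_multiply_diff_le[OF B_coefficient[OF s] B_coefficient[OF t]]) auto
    also have "\<dots> \<le> L\<^sub>B * \<bar>s - t\<bar> * norm q"
      using constants_nonneg norm_snd_le[of "snd q" "fst q"] by (intro mult_left_mono) auto
    finally show "norm (?B s - ?B t) \<le> L\<^sub>B * \<bar>s - t\<bar> * norm q" .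
  qed (use norm_snd_le[of "snd p" "fst p"] in auto)
  finally show ?thesis by (simp add: mult_ac)
qed

lemma linear_convection: "linear (convection t)"
  unfolding convection_def[abs_def]
  by (intro bounded_linear.linear bounded_linear_Pair bounded_linear_minus bounded_linear_fst
      bounded_linear_compose[OF bounded_linear_l2_multiply[OF a_coefficient] bounded_linear_fst])

lemma norm_convection_le: "norm (convection t p) \<le> (1 + M\<^sub>a) * norm (fst p)"
proof -
  have "norm (convection t p)
      \<le> norm (- fst p) + norm (l2_multiply U (\<lambda>w r. r *\<^sub>R w) (\<lambda>x. a (t, x)) (fst p))"
    unfolding convection_def by (rule norm_Pair_le)
  also have "\<dots> \<le> norm (fst p) + M\<^sub>a * norm (fst p)"
    by (intro add_mono norm_l2_multiply_le[OF a_coefficient]) simp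
  finally show ?thesis by (simp add: algebra_simps)
qed

lemma convection_measurable:
  assumes p: "p \<in> sobolev0 U"
  shows "(\<lambda>t. p \<bullet> convection t q) \<in> borel_measurable borel"
proof -
  let ?P = "rep_l2 (snd p)" and ?q = "rep_l2 (fst q)"
  have "(\<lambda>x. ?q x *\<^sub>R ?P x) \<in> borel_measurable (lebesgue_on U)"
    using L2v_rep[of "snd p"] L2v_rep[of "fst q"] by (intro borel_measurable_scaleR) (auto simp: L2v_def)
  from borel_measurable_param_integral[OF open_U a_borel this]
  have "(\<lambda>t. - (fst p \<bullet> fst q) + (\<integral>x. a (t, x) \<bullet> (?q x *\<^sub>R ?P x) \<partial>lebesgue_on U)) \<in> borel_measurable borel"
    by (intro borel_measurable_add) auto
  moreover have "p \<bullet> convection t q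
      = - (fst p \<bullet> fst q) + (\<integral>x. a (t, x) \<bullet> (?q x *\<^sub>R ?P x) \<partial>lebesgue_on U)" for t
    using inner_l2_class[OF L2v_rep[of "snd p"] L2v_multiply[OF a_coefficient L2v_rep[of "fst q"]], of t]
      l2_class_rep[OF sobolev0_components_supported(2)[OF p]]
    by (simp add: convection_def inner_prod_def l2_multiply_def inner_commute[of "?P _"])
  ultimately show ?thesis by simp
qed

lemma linear_form_on_mixed:
  assumes t: "t \<in> {0..T}"
  shows "linear_form_on (sobolev0 U) (\<lambda>p. h \<bullet> mixed t p)"
  using linear_form_on_cmult[OF lipschitz_field.linear_form_on_divergence[OF b_lipschitz_field[OF t]],
      of 2 h]
  by (simp add: mixed_def)

lemma norm_mixed_le:
  assumes t: "t \<in> {0..T}" and p: "p \<in> sobolev0 U"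
  shows "norm (mixed t p) \<le> 2 * (real CARD('n) * L\<^sub>b + M\<^sub>b) * norm p"
  using lipschitz_field.norm_divergence_le[OF b_lipschitz_field[OF t] p]
  by (simp add: mixed_def mult.assoc del: distrib_left_numeral)

lemma mixed_skew:
  assumes t: "t \<in> {0..T}" and p: "p \<in> sobolev0 U"
  shows "- (real CARD('n) * L\<^sub>b) * (norm (fst p))\<^sup>2 \<le> fst p \<bullet> mixed t p"
  using lipschitz_field.divergence_skew[OF b_lipschitz_field[OF t] p] by (simp add: mixed_def)

lemma mixed_measurable:
  assumes p: "p \<in> sobolev0 U" and q: "q \<in> sobolev0 U"
  shows "(\<lambda>t. fst p \<bullet> mixed t q) \<in> borel_measurable (lebesgue_on {0..T})"
proof -
  let ?transport = "\<lambda>t. l2_multiply U (\<bullet>) (b t) (snd p)"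
  have mixed_eq: "fst p \<bullet> mixed t q = - 2 * (fst q \<bullet> ?transport t)" if t: "t \<in> {0..T}" for t
  proof -
    interpret lipschitz_field U "b t" L\<^sub>b M\<^sub>b by (rule b_lipschitz_field[OF t])
    show ?thesis using divergence_inner[OF q p] by (simp add: mixed_def transport_def inner_commute)
  qed
  have "norm (?transport t - ?transport s) \<le> L\<^sub>b * norm (snd p) * \<bar>t - s\<bar>" if
    t: "t \<in> {0..T}" "s \<in> {0..T}" for t s
  proof -
    note coefficients = lipschitz_field.b_coefficient[OF b_lipschitz_field[OF t(1)]]
      lipschitz_field.b_coefficient[OF b_lipschitz_field[OF t(2)]]
    have "\<bar>(b t x - b s x) \<bullet> w\<bar> \<le> L\<^sub>b * \<bar>t - s\<bar> * norm w" if "x \<in> U" for x w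
      using order_trans[OF Cauchy_Schwarz_ineq2
        mult_right_mono[OF b_lipschitz[OF t that that] norm_ge_zero]] by simp
    then have "norm (?transport t - ?transport s) \<le> L\<^sub>b * \<bar>t - s\<bar> * norm (snd p)"
      using constants_nonneg by (intro norm_l2_multiply_diff_le[OF coefficients]) auto
    then show ?thesis by (simp add: mult_ac)
  qed
  then have "(L\<^sub>b * norm (snd p))-lipschitz_on {0..T} ?transport"
    using constants_nonneg by (intro lipschitz_onI) (auto simp: dist_norm)
  then have "continuous_on {0..T} (\<lambda>t. - 2 * (fst q \<bullet> ?transport t))"
    by (intro continuous_intros lipschitz_on_continuous_on)
  then have "continuous_on {0..T} (\<lambda>t. fst p \<bullet> mixed t q)"
    by (rule continuous_on_eq) (simp add: mixed_eq)
  then show ?thesis by (rule continuous_imp_measurable_on_sets_lebesgue) simp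
qed

subsection \<open>The source term\<close>

lemma
  assumes finite: "(\<integral>\<^sup>+x. ennreal ((g (t, x))\<^sup>2) \<partial>lborel) < \<infinity>"
  shows source_section_L2v: "L2v U (\<lambda>x. g (t, x))"
    and norm_source_section_le: "ennreal ((norm (l2_class U (\<lambda>x. g (t, x))))\<^sup>2)
        \<le> (\<integral>\<^sup>+x. ennreal ((g (t, x))\<^sup>2) \<partial>lborel)"
proof -
  have section_borel[measurable]: "(\<lambda>x. g (t, x)) \<in> borel_measurable borel"
    by (rule borel_measurable_section[OF g_borel])
  have integrable: "integrable lborel (\<lambda>x. (g (t, x))\<^sup>2)" using finite by (intro integrableI_bounded) auto
  then have integrable_lebesgue: "integrable lebesgue (\<lambda>x. (g (t, x))\<^sup>2)"
    by (simp add: integrable_completion)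
  then show L2v: "L2v U (\<lambda>x. g (t, x))"
    unfolding L2v_def lebesgue_on_indicator(2)[OF U_sets]
    using integrable_mult_indicator[OF U_sets integrable_lebesgue]
      borel_measurable_lebesgue_onI[OF section_borel]
    by simp
  have "(norm (l2_class U (\<lambda>x. g (t, x))))\<^sup>2 = (\<integral>x. indicator U x *\<^sub>R (g (t, x))\<^sup>2 \<partial>lebesgue)"
    unfolding norm_sq_l2_class[OF L2v] lebesgue_on_indicator(1)[OF U_sets] by simp
  also have "\<dots> \<le> (\<integral>x. (g (t, x))\<^sup>2 \<partial>lebesgue)"
    using integrable_lebesgue U_sets
    by (intro integral_mono integrable_mult_indicator) (auto simp: indicator_def)
  also have "\<dots> = (\<integral>x. (g (t, x))\<^sup>2 \<partial>lborel)" by (rule integral_completion) simp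
  finally show "ennreal ((norm (l2_class U (\<lambda>x. g (t, x))))\<^sup>2) \<le> (\<integral>\<^sup>+x. ennreal ((g (t, x))\<^sup>2) \<partial>lborel)"
    using integrable by (simp add: nn_integral_eq_integral ennreal_leI)
qed

lemma g_section_nn_integral:
  "(\<lambda>t. \<integral>\<^sup>+x. ennreal ((g (t, x))\<^sup>2) \<partial>lborel) \<in> borel_measurable borel"
  "(\<integral>\<^sup>+t. \<integral>\<^sup>+x. ennreal ((g (t, x))\<^sup>2) \<partial>lborel \<partial>lborel) < \<infinity>"
proof -
  have [measurable]: "g \<in> borel_measurable (borel \<Otimes>\<^sub>M borel)" using g_borel by (simp add: borel_prod)
  show "(\<lambda>t. \<integral>\<^sup>+x. ennreal ((g (t, x))\<^sup>2) \<partial>lborel) \<in> borel_measurable borel"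
    by (rule lborel.borel_measurable_nn_integral) measurable
  have "(\<integral>\<^sup>+t. \<integral>\<^sup>+x. (\<lambda>z. ennreal ((g z)\<^sup>2)) (t, x) \<partial>lborel \<partial>lborel)
      = (\<integral>\<^sup>+z. ennreal ((g z)\<^sup>2) \<partial>(lborel \<Otimes>\<^sub>M lborel))"
    by (rule lborel.nn_integral_fst) measurable
  then show "(\<integral>\<^sup>+t. \<integral>\<^sup>+x. ennreal ((g (t, x))\<^sup>2) \<partial>lborel \<partial>lborel) < \<infinity>" using g_L2 by (simp add: lborel_prod)
qed

lemma source_borel:
  assumes k: "k \<in> borel_measurable borel" and h: "h \<in> borel_measurable (lebesgue_on U)"
    and F: "\<And>t. (\<integral>\<^sup>+x. ennreal ((g (t, x))\<^sup>2) \<partial>lborel) < \<infinity> \<Longrightarrow>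
      F (l2_class U (\<lambda>x. g (t, x))) = (\<integral>x. k (t, x) * h x \<partial>lebesgue_on U)" and F_zero: "F 0 = 0"
  shows "(\<lambda>t. F (source t) :: real) \<in> borel_measurable borel"
proof -
  have "(\<lambda>t. if (\<integral>\<^sup>+x. ennreal ((g (t, x))\<^sup>2) \<partial>lborel) < \<infinity> then \<integral>x. k (t, x) * h x \<partial>lebesgue_on U else 0)
      \<in> borel_measurable borel"
    using g_section_nn_integral(1) borel_measurable_param_integral[OF open_U k h] by simp
  moreover have "F (source t)
      = (if (\<integral>\<^sup>+x. ennreal ((g (t, x))\<^sup>2) \<partial>lborel) < \<infinity> then \<integral>x. k (t, x) * h x \<partial>lebesgue_on U else 0)" for t
    using F F_zero by (simp add: source_def)
  ultimately show ?thesis by simp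
qed

lemma source_inner_measurable:
  assumes q: "q \<in> l2_supported U"
  shows "(\<lambda>t. source t \<bullet> q) \<in> borel_measurable borel"
proof (rule source_borel[OF g_borel, of "rep_l2 q" "\<lambda>p. p \<bullet> q"])
  show "rep_l2 q \<in> borel_measurable (lebesgue_on U)" using L2v_rep[of q] by (simp add: L2v_def)
  show "l2_class U (\<lambda>x. g (t, x)) \<bullet> q = (\<integral>x. g (t, x) * rep_l2 q x \<partial>lebesgue_on U)"
    if "(\<integral>\<^sup>+x. ennreal ((g (t, x))\<^sup>2) \<partial>lborel) < \<infinity>" for t
    using inner_l2_class[OF source_section_L2v[OF that] L2v_rep[of q]] l2_class_rep[OF q] by simp
qed simp

lemma source_sq_integrable: "(\<lambda>t. (norm (source t))\<^sup>2) integrable_on {0..T}"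
proof -
  have "(\<lambda>t. (norm (source t))\<^sup>2) \<in> borel_measurable borel"
    by (rule source_borel[of "\<lambda>z. (g z)\<^sup>2" "\<lambda>x. 1"])
      (use g_borel in \<open>auto simp: norm_sq_l2_class source_section_L2v\<close>)
  then have measurable[measurable]: "(\<lambda>t. (norm (source t))\<^sup>2) \<in> borel_measurable lborel" by simp
  have "ennreal ((norm (source t))\<^sup>2) \<le> (\<integral>\<^sup>+x. ennreal ((g (t, x))\<^sup>2) \<partial>lborel)" for t
    using norm_source_section_le by (simp add: source_def)
  then have "(\<integral>\<^sup>+t. ennreal ((norm (source t))\<^sup>2) \<partial>lborel) < \<infinity>"
    by (intro le_less_trans[OF nn_integral_mono g_section_nn_integral(2)])
  then have "integrable lborel (\<lambda>t. (norm (source t))\<^sup>2)"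
    using measurable by (intro integrableI_bounded) auto
  then show ?thesis by (intro integrable_on_lborel[THEN integrable_on_subinterval]) auto
qed

theorem hyperbolic_system:
  "hyperbolic_system (sobolev0 U) fst principal_part convection mixed source T operator_bound (min 1 c\<^sub>B)
    (h1_class U v0) (l2_class U v1)"
proof
  have "0 \<le> real CARD('n) * L\<^sub>b" using constants_nonneg by simp
  then have bound_le: "1 + M\<^sub>B \<le> operator_bound" "L\<^sub>B \<le> operator_bound" "1 + M\<^sub>a \<le> operator_bound"
    "2 * (real CARD('n) * L\<^sub>b + M\<^sub>b) \<le> operator_bound" "real CARD('n) * L\<^sub>b \<le> operator_bound"
    unfolding operator_bound_def using constants_nonneg by auto
  show "0 \<le> operator_bound" using bound_le(2) constants_nonneg by simp
  show "norm (fst p) \<le> norm p" for p :: "'n sobolev_pair" using norm_fst_le[of "fst p" "snd p"] by simp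
  show "p \<in> sobolev0 U \<Longrightarrow> fst p = 0 \<Longrightarrow> p = 0" for p
    using weak_grad_graph_fst_inj sobolev0_subset_graph by blast
  show "l2_class U v1 \<in> closure (fst ` sobolev0 U)"
    unfolding closure_fst_sobolev0 by (rule l2_class_supported[OF v1])
  show "(\<lambda>t. (norm (source t))\<^sup>2) integrable_on {0..T}" by (rule source_sq_integrable)
  show "linear_form_on (sobolev0 U) (\<lambda>q. p \<bullet> principal_part t q)" if "t \<in> {0..T}" for t p
    by (rule linear_form_on_inner_linear(1)[OF linear_principal_part[OF that]])
  show "linear_form_on (sobolev0 U) (\<lambda>q. p \<bullet> convection t q)" for t p
    by (rule linear_form_on_inner_linear(1)[OF linear_convection])
  fix p q assume p: "p \<in> sobolev0 U" and q: "q \<in> sobolev0 U"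
  show "(\<lambda>t. p \<bullet> convection t q) \<in> borel_measurable (lebesgue_on {0..T})"
    by (rule borel_measurable_lebesgue_onI[OF convection_measurable[OF p]])
  show "(\<lambda>t. fst p \<bullet> mixed t q) \<in> borel_measurable (lebesgue_on {0..T})" by (rule mixed_measurable[OF p q])
  show "(\<lambda>t. source t \<bullet> fst p) \<in> borel_measurable (lebesgue_on {0..T})"
    by (intro borel_measurable_lebesgue_onI source_inner_measurable sobolev0_components_supported p)
  fix s t assume s: "s \<in> {0..T}" and t: "t \<in> {0..T}"
  show "norm (principal_part s p) \<le> operator_bound * norm p"
    by (rule order_trans[OF norm_principal_part_le[OF s] mult_right_mono[OF bound_le(1) norm_ge_zero]])
  show "norm (convection s p) \<le> operator_bound * norm (fst p)"
    by (rule order_trans[OF norm_convection_le mult_right_mono[OF bound_le(3) norm_ge_zero]])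
  show "norm (mixed s p) \<le> operator_bound * norm p"
    by (rule order_trans[OF norm_mixed_le[OF s p] mult_right_mono[OF bound_le(4) norm_ge_zero]])
  show "- operator_bound * (norm (fst p))\<^sup>2 \<le> fst p \<bullet> mixed s p"
    using mult_right_mono[OF bound_le(5), of "(norm (fst p))\<^sup>2"] mixed_skew[OF s p] by simp
  have "L\<^sub>B * \<bar>s - t\<bar> * norm p * norm q \<le> operator_bound * \<bar>s - t\<bar> * norm p * norm q"
    by (intro mult_right_mono bound_le) auto
  then show "\<bar>p \<bullet> principal_part s q - p \<bullet> principal_part t q\<bar>
      \<le> operator_bound * \<bar>s - t\<bar> * norm p * norm q"
    by (rule order_trans[OF principal_part_lipschitz[OF s t]])
qed (use T_pos constants_nonneg H10_class_in_sobolev0[OF v0] in \<open>auto intro: closed_subspace_sobolev0 linear_fst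
    principal_part_symmetric principal_part_coercive linear_form_on_mixed\<close>)

end

section \<open>Integration by parts in time\<close>

lemma test_fun_deriv:
  assumes \<phi>: "test_fun U (\<phi> :: real \<Rightarrow> real)"
  shows "(\<phi> has_real_derivative deriv \<phi> t) (at t)" "continuous_on UNIV (deriv \<phi>)"
proof -
  note smooth = test_fun_smooth[OF \<phi>]
  have deriv: "(\<phi> has_real_derivative deriv \<phi> t) (at t)" for t
    using smooth_fun_differentiable[OF smooth] by (simp add: DERIV_deriv_iff_real_differentiable)
  then show "(\<phi> has_real_derivative deriv \<phi> t) (at t)" .
  have "frechet_derivative \<phi> (at t) 1 = deriv \<phi> t" for t
    using fun_cong[OF frechet_derivative_at[OF deriv[unfolded has_field_derivative_def]], of t 1] by simp
  then show "continuous_on UNIV (deriv \<phi>)" using smooth_fun_continuous_derivative[OF smooth, of 1] by simp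
qed

lemma integral_lebesgue_on_indicator:
  fixes f :: "'a::euclidean_space \<Rightarrow> 'b::euclidean_space"
  assumes "S \<in> sets lebesgue" "A \<in> sets lebesgue"
  shows "(\<integral>x. indicator A x *\<^sub>R f x \<partial>lebesgue_on S) = integral\<^sup>L (lebesgue_on (S \<inter> A)) f"
  using assms
  by (simp add: lebesgue_on_indicator sets.Int indicator_inter_arith)

lemma integral_lebesgue_on_open_interval:
  fixes h :: "real \<Rightarrow> real"
  assumes h: "h \<in> borel_measurable (lebesgue_on {a..b})"
  shows "integral\<^sup>L (lebesgue_on {a<..<b}) h = integral\<^sup>L (lebesgue_on {a..b}) h"
proof -
  have "(\<integral>t. indicator {a<..<b} t *\<^sub>R h t \<partial>lebesgue) = (\<integral>t. indicator {a..b} t *\<^sub>R h t \<partial>lebesgue)"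
  proof (rule integral_cong_AE)
    have "h \<in> borel_measurable (lebesgue_on {a<..<b})" by (rule measurable_restrict_mono[OF h]) auto
    then show "(\<lambda>t. indicator {a<..<b} t *\<^sub>R h t) \<in> borel_measurable lebesgue"
      by (subst lebesgue_on_indicator(3)[symmetric]) auto
    show "(\<lambda>t. indicator {a..b} t *\<^sub>R h t) \<in> borel_measurable lebesgue"
      using h by (subst lebesgue_on_indicator(3)[symmetric]) auto
    have "AE t in lborel. indicator {a<..<b} t *\<^sub>R h t = indicator {a..b} t *\<^sub>R h t"
      using AE_lborel_singleton[of a] AE_lborel_singleton[of b]
      by eventually_elim (auto simp: indicator_def)
    then show "AE t in lebesgue. indicator {a<..<b} t *\<^sub>R h t = indicator {a..b} t *\<^sub>R h t"
      by (rule AE_completion)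
  qed
  then show ?thesis by (simp add: lebesgue_on_indicator)
qed

lemma Fubini_triangle:
  fixes f \<psi> :: "real \<Rightarrow> real"
  assumes f: "integrable (lebesgue_on {0..T}) f" and \<psi>: "continuous_on UNIV \<psi>"
  defines "\<mu> \<equiv> lebesgue_on {0..T}"
  shows "(\<integral>t. (\<integral>s. indicator {..t} s *\<^sub>R f s \<partial>\<mu>) * \<psi> t \<partial>\<mu>)
      = (\<integral>s. f s * (\<integral>t. indicator {s..} t *\<^sub>R \<psi> t \<partial>\<mu>) \<partial>\<mu>)"
proof -
  interpret finite_measure \<mu> unfolding \<mu>_def by (rule finite_measure_lebesgue_on) simp
  interpret pair_sigma_finite \<mu> \<mu> by standard
  have [measurable]: "f \<in> borel_measurable \<mu>" "\<psi> \<in> borel_measurable \<mu>" "(\<lambda>s. s) \<in> borel_measurable \<mu>"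
    using f \<psi> by (auto simp: \<mu>_def intro!: borel_measurable_lebesgue_onI borel_measurable_continuous_onI)
  have "bounded (\<psi> ` {0..T})"
    using continuous_on_subset[OF \<psi>] by (intro compact_imp_bounded compact_continuous_image) auto
  then obtain K where "\<forall>t\<in>{0..T}. \<bar>\<psi> t\<bar> \<le> K" unfolding bounded_iff by auto
  then have K: "\<bar>\<psi> t\<bar> \<le> \<bar>K\<bar>" if "t \<in> {0..T}" for t using that abs_ge_self[of K] order_trans by blast
  have space_\<mu>: "space \<mu> = {0..T}" by (simp add: \<mu>_def)
  let ?h = "\<lambda>(s, t). if s \<le> t then f s * \<psi> t else 0"
  have "integrable (\<mu> \<Otimes>\<^sub>M \<mu>) (\<lambda>(s, t). f s * K)"
    using f by (intro Fubini_integrable) (auto simp: \<mu>_def)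
  then have "integrable (\<mu> \<Otimes>\<^sub>M \<mu>) ?h"
  proof (rule Bochner_Integration.integrable_bound)
    show "AE z in \<mu> \<Otimes>\<^sub>M \<mu>. norm (?h z) \<le> norm ((\<lambda>(s, t). f s * K) z)"
      using K by (intro AE_I2) (auto simp: space_pair_measure space_\<mu> abs_mult intro!: mult_left_mono)
  qed measurable
  from Fubini_integral[OF this]
  have "(\<integral>t. (\<integral>s. ?h (s, t) \<partial>\<mu>) \<partial>\<mu>) = (\<integral>s. (\<integral>t. ?h (s, t) \<partial>\<mu>) \<partial>\<mu>)" by simp
  moreover have "(\<integral>s. ?h (s, t) \<partial>\<mu>) = (\<integral>s. indicator {..t} s *\<^sub>R f s \<partial>\<mu>) * \<psi> t" for t
    by (subst integral_mult_left_zero[symmetric]) (rule Bochner_Integration.integral_cong, simp_all)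
  moreover have "(\<integral>t. ?h (s, t) \<partial>\<mu>) = f s * (\<integral>t. indicator {s..} t *\<^sub>R \<psi> t \<partial>\<mu>)" for s
    by (subst integral_mult_right_zero[symmetric]) (rule Bochner_Integration.integral_cong, simp_all)
  ultimately show ?thesis by simp
qed

lemma integral_indicator_atMost:
  fixes f :: "real \<Rightarrow> real"
  assumes f: "f absolutely_integrable_on {0..T}" and t: "t \<in> {0..T}"
  shows "(\<integral>s. indicator {..t} s *\<^sub>R f s \<partial>lebesgue_on {0..T}) = integral {0..t} f"
proof -
  have "(\<integral>s. indicator {..t} s *\<^sub>R f s \<partial>lebesgue_on {0..T}) = integral\<^sup>L (lebesgue_on {0..t}) f"
    using integral_lebesgue_on_indicator[of "{0..T}" "{..t}" f] t by (simp add: min_absorb2)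
  also have "\<dots> = integral {0..t} f"
    using set_integrable_subset[OF f, of "{0..t}"] t
    by (intro lebesgue_integral_eq_integral absolutely_integrable_imp_integrable) auto
  finally show ?thesis .
qed

lemma integral_deriv_indicator_atLeast:
  fixes \<phi> :: "real \<Rightarrow> real"
  assumes \<phi>: "test_fun {0<..<T} \<phi>" and s: "s \<in> {0..T}"
  shows "(\<integral>t. indicator {s..} t *\<^sub>R deriv \<phi> t \<partial>lebesgue_on {0..T}) = - \<phi> s"
proof -
  have "(\<integral>t. indicator {s..} t *\<^sub>R deriv \<phi> t \<partial>lebesgue_on {0..T})
      = integral\<^sup>L (lebesgue_on {s..T}) (deriv \<phi>)"
    using integral_lebesgue_on_indicator[of "{0..T}" "{s..}" "deriv \<phi>"] s by (simp add: max_absorb2)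
  also have "\<dots> = integral {s..T} (deriv \<phi>)"
    using continuous_on_subset[OF test_fun_deriv(2)[OF \<phi>]]
    by (intro lebesgue_integral_eq_integral continuous_imp_integrable_real) auto
  also have "\<dots> = \<phi> T - \<phi> s"
    using s test_fun_deriv(1)[OF \<phi>]
    by (intro integral_unique fundamental_theorem_of_calculus)
      (auto simp: has_real_derivative_iff_has_vector_derivative[symmetric] intro: DERIV_subset)
  also have "\<phi> T = 0" using test_fun_support[OF \<phi>] by fastforce
  finally show ?thesis by simp
qed

lemma integral_deriv_test_fun:
  fixes \<phi> :: "real \<Rightarrow> real"
  assumes T: "0 < T" and \<phi>: "test_fun {0<..<T} \<phi>"
  shows "(\<integral>t. deriv \<phi> t \<partial>lebesgue_on {0..T}) = 0"
proof -
  have "(\<integral>t. deriv \<phi> t \<partial>lebesgue_on {0..T})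
      = (\<integral>t. indicator {0..} t *\<^sub>R deriv \<phi> t \<partial>lebesgue_on {0..T})"
    by (intro Bochner_Integration.integral_cong refl) simp
  also have "\<dots> = - \<phi> 0" using integral_deriv_indicator_atLeast[OF \<phi>] T by simp
  also have "\<phi> 0 = 0" using test_fun_support[OF \<phi>] by fastforce
  finally show ?thesis by simp
qed

text \<open>The indefinite integral \<open>F\<close> is only absolutely continuous, so the product rule is not available;
  both sides are integrals of \<open>f s * deriv \<phi> t\<close> over the triangle \<open>s \<le> t\<close>.\<close>
theorem weak_time_derivative:
  fixes f F :: "real \<Rightarrow> real"
  assumes T: "0 < T" and f: "f absolutely_integrable_on {0..T}"
    and F: "\<And>t. t \<in> {0..T} \<Longrightarrow> (f has_integral (F t - F 0)) {0..t}" and \<phi>: "test_fun {0<..<T} \<phi>"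
  shows "(\<integral>t. f t * \<phi> t \<partial>lebesgue_on {0<..<T}) = - (\<integral>t. F t * deriv \<phi> t \<partial>lebesgue_on {0<..<T})"
proof -
  define \<mu> where "\<mu> = lebesgue_on {0..T}"
  have space_\<mu>: "space \<mu> = {0..T}" by (simp add: \<mu>_def)
  have f_integrable: "integrable \<mu> f"
    unfolding \<mu>_def by (rule absolutely_integrable_imp_integrable[OF f]) simp
  note deriv_integral = integral_deriv_indicator_atLeast[OF \<phi>, folded \<mu>_def]
  note deriv_cont = test_fun_deriv(2)[OF \<phi>]
  have "continuous_on {0..T} (\<lambda>t. F 0 + integral {0..t} f)"
    using absolutely_integrable_on_def f by (intro continuous_intros indefinite_integral_continuous_1) auto
  then have "continuous_on {0..T} F"
    by (rule continuous_on_eq) (simp add: integral_unique[OF F])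
  then have F_deriv_cont: "continuous_on {0..T} (\<lambda>t. F t * deriv \<phi> t)"
    using continuous_on_subset[OF deriv_cont] by (intro continuous_intros) auto
  have deriv_integrable: "integrable \<mu> (deriv \<phi>)"
    unfolding \<mu>_def using continuous_on_subset[OF deriv_cont]
    by (intro continuous_imp_integrable_real) auto
  have "(\<integral>t. f t * \<phi> t \<partial>\<mu>) = - (\<integral>s. f s * (\<integral>t. indicator {s..} t *\<^sub>R deriv \<phi> t \<partial>\<mu>) \<partial>\<mu>)"
    unfolding Bochner_Integration.integral_minus[symmetric]
    by (intro Bochner_Integration.integral_cong refl) (subst deriv_integral, simp_all add: space_\<mu>)
  also have "\<dots> = - (\<integral>t. (\<integral>s. indicator {..t} s *\<^sub>R f s \<partial>\<mu>) * deriv \<phi> t \<partial>\<mu>)"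
    using Fubini_triangle[OF f_integrable[unfolded \<mu>_def] deriv_cont] by (simp add: \<mu>_def)
  also have "\<dots> = - (\<integral>t. F t * deriv \<phi> t - F 0 * deriv \<phi> t \<partial>\<mu>)"
    by (intro arg_cong[of _ _ uminus] Bochner_Integration.integral_cong refl)
      (simp only: space_\<mu> integral_indicator_atMost[OF f, folded \<mu>_def] integral_unique[OF F]
        left_diff_distrib)
  also have "\<dots> = - (\<integral>t. F t * deriv \<phi> t \<partial>\<mu>)"
    using continuous_imp_integrable_real[OF F_deriv_cont] deriv_integrable integral_deriv_test_fun[OF T \<phi>]
    by (simp add: Bochner_Integration.integral_diff flip: \<mu>_def)
  finally have "(\<integral>t. f t * \<phi> t \<partial>\<mu>) = - (\<integral>t. F t * deriv \<phi> t \<partial>\<mu>)" .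
  moreover have "(\<lambda>t. f t * \<phi> t) \<in> borel_measurable \<mu>"
    using smooth_fun_continuous[OF test_fun_smooth[OF \<phi>]] unfolding \<mu>_def
    by (intro borel_measurable_times[OF borel_measurable_integrable[OF f_integrable[unfolded \<mu>_def]]]
        borel_measurable_lebesgue_onI borel_measurable_continuous_onI)
  moreover have "(\<lambda>t. F t * deriv \<phi> t) \<in> borel_measurable \<mu>"
    unfolding \<mu>_def by (rule continuous_imp_measurable_on_sets_lebesgue[OF F_deriv_cont]) simp
  ultimately show ?thesis by (simp add: integral_lebesgue_on_open_interval \<mu>_def)
qed

section \<open>From the abstract solution to a strong-weak solution\<close>

context hyperbolic_system
begin

lemma position_lipschitz:
  assumes solution: "integrated_solution (\<lambda>t. t) u w" and st: "s \<in> {0..T}" "t \<in> {0..T}"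
  shows "norm (\<iota> (u s) - \<iota> (u t)) \<le> sol_bound * \<bar>s - t\<bar>"
proof -
  define h where "h = \<iota> (u s) - \<iota> (u t)"
  have sol_bound_nonneg: "0 \<le> sol_bound"
    using order_trans[OF norm_ge_zero integrated_solutionD(2)[OF solution st(1)]] .
  have "\<bar>\<iota> (u s) \<bullet> h - \<iota> (u t) \<bullet> h\<bar>
      \<le> \<bar>integral {0..s} (\<lambda>_. sol_bound * norm h) - integral {0..t} (\<lambda>_. sol_bound * norm h)\<bar>"
  proof (rule increment_le_integral_majorant[where \<theta> = "\<lambda>t. t" and I = "{0..T}",
        OF integrated_solutionD(5)[OF solution]])
    show "\<bar>w r \<bullet> h\<bar> \<le> sol_bound * norm h" if "r \<in> {0..T}" for r
      using integrated_solutionD(4)[OF solution that]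
      by (intro order_trans[OF Cauchy_Schwarz_ineq2 mult_right_mono]) auto
  qed (use st in auto)
  also have "\<dots> = \<bar>(s - t) * (sol_bound * norm h)\<bar>" using st by (simp add: algebra_simps)
  also have "\<dots> = sol_bound * \<bar>s - t\<bar> * norm h" using sol_bound_nonneg by (simp add: abs_mult mult_ac)
  finally have "norm h * norm h \<le> sol_bound * \<bar>s - t\<bar> * norm h"
    by (simp add: h_def power2_norm_eq_inner flip: inner_diff_left power2_eq_square)
  then show ?thesis using sol_bound_nonneg unfolding h_def by (intro norm_le_if_norm_sq_le_mult) auto
qed

lemma velocity_increment_le:
  assumes solution: "integrated_solution (\<lambda>t. t) u w" and st: "s \<in> {0..T}" "t \<in> {0..T}" and y: "y \<in> V"
  shows "\<bar>w s \<bullet> \<iota> y - w t \<bullet> \<iota> y\<bar>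
    \<le> \<bar>integral {0..s} flux_majorant - integral {0..t} flux_majorant\<bar> * norm y"
proof -
  have "\<bar>w s \<bullet> \<iota> y - w t \<bullet> \<iota> y\<bar>
      \<le> \<bar>integral {0..s} (\<lambda>r. flux_majorant r * norm y) - integral {0..t} (\<lambda>r. flux_majorant r * norm y)\<bar>"
  proof (rule increment_le_integral_majorant[where \<theta> = "\<lambda>t. t" and I = "{0..T}",
        OF integrated_solutionD(6)[OF solution _ y]])
    show "\<bar>- flux (u r) (w r) y r\<bar> \<le> flux_majorant r * norm y" if "r \<in> {0..T}" for r
      unfolding abs_minus_cancel
      by (intro flux_le_majorant integrated_solutionD[OF solution] that y)
  qed (use st flux_majorant_integrable in auto)
  also have "\<dots> = \<bar>integral {0..s} flux_majorant - integral {0..t} flux_majorant\<bar> * norm y"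
    by (simp add: abs_mult flip: left_diff_distrib)
  finally show ?thesis .
qed

end

lemma nn_integral_interval_finite:
  fixes f k :: "real \<Rightarrow> real"
  assumes k: "k integrable_on {a..b}" "\<And>t. t \<in> {a..b} \<Longrightarrow> 0 \<le> k t" and f_le: "\<And>t. t \<in> {a..b} \<Longrightarrow> f t \<le> k t"
  shows "(\<integral>\<^sup>+t. ennreal (f t) \<partial>lebesgue_on {a..b}) < \<infinity>"
proof -
  have "k absolutely_integrable_on {a..b}" by (rule nonnegative_absolutely_integrable_1[OF k])
  then have k_integrable: "integrable (lebesgue_on {a..b}) k"
    by (rule absolutely_integrable_imp_integrable) simp
  have "(\<integral>\<^sup>+t. ennreal (f t) \<partial>lebesgue_on {a..b}) \<le> (\<integral>\<^sup>+t. ennreal (k t) \<partial>lebesgue_on {a..b})"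
    using f_le by (intro nn_integral_mono ennreal_leI) auto
  also have "\<dots> = ennreal (integral\<^sup>L (lebesgue_on {a..b}) k)"
    using k(2) by (intro nn_integral_eq_integral k_integrable AE_I2) auto
  finally show ?thesis by (rule order_le_less_trans) simp
qed

lemma (in open_domain) integral_lebesgue_on_cong_AE:
  fixes f h :: "'a \<Rightarrow> real"
  assumes f: "f \<in> borel_measurable (lebesgue_on U)" and f_eq: "AE x in lebesgue_on U. f x = h x"
  shows "integral\<^sup>L (lebesgue_on U) f = integral\<^sup>L (lebesgue_on U) h"
proof -
  have indicator_eq: "AE x in lebesgue. indicator U x *\<^sub>R f x = indicator U x *\<^sub>R h x"
    using f_eq unfolding AE_lebesgue_on_iff by eventually_elim (simp add: indicator_def)
  have indicator_f: "(\<lambda>x. indicator U x *\<^sub>R f x) \<in> borel_measurable lebesgue"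
    using f unfolding lebesgue_on_indicator(3)[OF U_sets] .
  show ?thesis
    unfolding lebesgue_on_indicator(1)[OF U_sets]
    by (rule integral_cong_AE[OF indicator_f borel_measurable_AE[OF indicator_f indicator_eq] indicator_eq])
qed

subsection \<open>The dual space\<close>

context sobolev_domain
begin

lemma l2pair_eq_inner: "L2v U f \<Longrightarrow> L2v U h \<Longrightarrow> l2pair U f h = l2_class U f \<bullet> l2_class U h"
  using inner_l2_class[of f h] by (simp add: l2pair_def)

lemma H10_L2v: "H10 U u \<Longrightarrow> L2v U u"
  by (rule H1_L2v[OF H10_H1])


lemma
  assumes C: "0 \<le> C" "\<And>u. H10 U u \<Longrightarrow> \<bar>F u\<bar> \<le> C * H1norm U u"
  shows Hm1norm_nonneg: "0 \<le> Hm1norm U F" and Hm1norm_le: "Hm1norm U F \<le> C"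
proof -
  let ?S = "{\<bar>F u\<bar> | u. H10 U u \<and> H1norm U u \<le> 1}"
  have "norm (h1_class U (\<lambda>x. 0) - h1_class U (\<lambda>x. 0)) = H1norm U (\<lambda>x. 0)"
    using norm_h1_class_diff[OF test_fun_H1 test_fun_H1, OF test_fun_zero test_fun_zero] by simp
  then have zero_in: "\<bar>F (\<lambda>x. 0)\<bar> \<in> ?S" using test_fun_H10[OF test_fun_zero] by auto
  have bound: "x \<le> C" if "x \<in> ?S" for x
  proof -
    obtain u where u: "x = \<bar>F u\<bar>" "H10 U u" "H1norm U u \<le> 1" using \<open>x \<in> ?S\<close> by auto
    have "x \<le> C * H1norm U u" using C(2)[OF u(2)] u(1) by simp
    also have "\<dots> \<le> C * 1" by (rule mult_left_mono[OF u(3) C(1)])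
    finally show ?thesis by simp
  qed
  show "Hm1norm U F \<le> C" unfolding Hm1norm_def using zero_in bound by (intro cSup_least) auto
  have "bdd_above ?S" by (rule bdd_aboveI[of _ C]) (rule bound)
  then have "\<bar>F (\<lambda>x. 0)\<bar> \<le> Hm1norm U F" unfolding Hm1norm_def by (intro cSup_upper zero_in)
  then show "0 \<le> Hm1norm U F" using abs_ge_zero order_trans by blast
qed

lemma Hm1_l2pair:
  assumes f: "L2v U f"
  shows "Hm1 U (l2pair U f)"
  unfolding Hm1_def
proof (intro conjI exI allI impI)
  fix u assume u: "H10 U u"
  have "\<bar>l2pair U f u\<bar> \<le> norm (l2_class U f) * norm (l2_class U u)"
    unfolding l2pair_eq_inner[OF f H10_L2v[OF u]] by (rule Cauchy_Schwarz_ineq2)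
  also have "\<dots> \<le> norm (l2_class U f) * norm (h1_class U u)"
    unfolding h1_class_def by (intro mult_left_mono norm_fst_le) simp
  finally show "\<bar>l2pair U f u\<bar> \<le> norm (l2_class U f) * H1norm U u"
    by (simp add: norm_h1_class H10_H1[OF u])
  fix w c assume w: "H10 U w"
  show "l2pair U f (\<lambda>x. u x + c * w x) = l2pair U f u + c * l2pair U f w"
    using l2_class_linear[OF H10_L2v[OF u] H10_L2v[OF w], of c] f H10_linear[OF u w, of c] u w
    by (simp add: l2pair_eq_inner H10_L2v inner_add_right)
qed

lemma Hm1_riesz:
  assumes \<Lambda>: "Hm1 U \<Lambda>"
  shows "\<exists>z. \<forall>u. H10 U u \<longrightarrow> \<Lambda> u = h1_class U u \<bullet> z"
proof -
  obtain C where C: "\<forall>u. H10 U u \<longrightarrow> \<bar>\<Lambda> u\<bar> \<le> C * H1norm U u" using \<Lambda> by (auto simp: Hm1_def)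
  have "\<exists>z\<in>closure (h1_class U ` Collect (H10 U)). \<forall>u. H10 U u \<longrightarrow> \<Lambda> u = h1_class U u \<bullet> z"
  proof (rule riesz_representation_of_function_space[where \<phi>\<^sub>0 = "\<lambda>x. 0"])
    show "\<bar>\<Lambda> u\<bar> \<le> C * norm (h1_class U u)" if "H10 U u" for u
      using C that by (simp add: norm_h1_class H10_H1)
    show "\<Lambda> (\<lambda>x. u x + c * w x) = \<Lambda> u + c * \<Lambda> w" if "H10 U u" "H10 U w" for u w c
      using \<Lambda> that by (simp add: Hm1_def)
  qed (simp_all add: H10_linear h1_class_linear H10_H1 test_fun_H10[OF test_fun_zero])
  then show ?thesis by blast
qed

end

subsection \<open>The properties of the solution\<close>

sublocale wave_data \<subseteq> system: hyperbolic_system "sobolev0 U" fst principal_part convection mixed source T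
    operator_bound "min 1 c\<^sub>B" "h1_class U v0" "l2_class U v1"
  by (rule hyperbolic_system)

locale wave_solution = wave_data U T B b a g v0 v1 L\<^sub>B M\<^sub>B c\<^sub>B M\<^sub>a L\<^sub>b M\<^sub>b
  for U :: "(real^'n) set" and T B b a g v0 v1 L\<^sub>B M\<^sub>B c\<^sub>B M\<^sub>a L\<^sub>b M\<^sub>b +
  fixes u :: "real \<Rightarrow> 'n sobolev_pair" and w :: "real \<Rightarrow> (real^'n, real) l2"
  assumes solution: "system.integrated_solution (\<lambda>t. t) u w"
begin

definition position :: "real \<Rightarrow> real^'n \<Rightarrow> real" where
  "position t = rep_l2 (fst (u t))"

definition velocity :: "real \<Rightarrow> real^'n \<Rightarrow> real" where
  "velocity t = rep_l2 (w t)"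

definition acceleration :: "real \<Rightarrow> (real^'n \<Rightarrow> real) \<Rightarrow> real" where
  "acceleration t \<phi> = - system.flux (u t) (w t) (h1_class U \<phi>) t"

lemmas initial = system.integrated_solution_initial[OF solution]

lemmas
  u_in = system.integrated_solutionD(1)[OF solution] and
  u_bound = system.integrated_solutionD(2)[OF solution] and
  w_in = system.integrated_solutionD(3)[OF solution, unfolded closure_fst_sobolev0] and
  w_bound = system.integrated_solutionD(4)[OF solution]

lemma T_nonneg [simp]: "0 \<le> T"
  using T_pos by simp

lemma sol_bound_nonneg: "0 \<le> system.sol_bound"
  using order_trans[OF norm_ge_zero u_bound[of 0]] by simp

lemma position_H10: "t \<in> {0..T} \<Longrightarrow> H10 U (position t)"
  unfolding position_def by (rule sobolev0_rep[OF u_in])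

lemma h1_class_position: "t \<in> {0..T} \<Longrightarrow> h1_class U (position t) = u t"
  unfolding position_def by (rule h1_class_rep[OF u_in])

lemma l2_class_position: "t \<in> {0..T} \<Longrightarrow> l2_class U (position t) = fst (u t)"
  by (simp flip: fst_h1_class add: h1_class_position)

lemma position_L2v: "L2v U (position t)"
  unfolding position_def by (rule L2v_rep)

lemma velocity_L2v: "L2v U (velocity t)"
  unfolding velocity_def by (rule L2v_rep)

lemma l2_class_velocity: "t \<in> {0..T} \<Longrightarrow> l2_class U (velocity t) = w t"
  unfolding velocity_def by (rule l2_class_rep[OF w_in])

lemma l2pair_position: "t \<in> {0..T} \<Longrightarrow> L2v U \<psi> \<Longrightarrow> l2pair U (position t) \<psi> = fst (u t) \<bullet> l2_class U \<psi>"
  by (simp add: l2pair_eq_inner position_L2v l2_class_position)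

lemma l2pair_velocity: "t \<in> {0..T} \<Longrightarrow> L2v U \<psi> \<Longrightarrow> l2pair U (velocity t) \<psi> = w t \<bullet> l2_class U \<psi>"
  by (simp add: l2pair_eq_inner velocity_L2v l2_class_velocity)

lemma velocity_pairing_continuous: "L2v U \<psi> \<Longrightarrow> continuous_on {0..T} (\<lambda>t. l2pair U (velocity t) \<psi>)"
  by (rule continuous_on_eq[OF system.velocity_weakly_continuous[OF solution]]) (simp add: l2pair_velocity)

lemma position_integral:
  assumes t: "t \<in> {0..T}" and \<psi>: "L2v U \<psi>"
  shows "((\<lambda>s. l2pair U (velocity s) \<psi>)
    has_integral (l2pair U (position t) \<psi> - l2pair U (position 0) \<psi>)) {0..t}"
proof (rule has_integral_eq)
  show "((\<lambda>s. w s \<bullet> l2_class U \<psi>) has_integral (l2pair U (position t) \<psi> - l2pair U (position 0) \<psi>)) {0..t}"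
    using system.integrated_solutionD(5)[OF solution t, of "l2_class U \<psi>"]
    by (simp add: l2pair_position[OF t \<psi>] l2pair_position[OF _ \<psi>, of 0] initial)
qed (use t \<psi> in \<open>simp add: l2pair_velocity\<close>)

lemma velocity_integral:
  assumes t: "t \<in> {0..T}" and \<psi>: "H10 U \<psi>"
  shows "((\<lambda>s. acceleration s \<psi>) has_integral (l2pair U (velocity t) \<psi> - l2pair U (velocity 0) \<psi>)) {0..t}"
  using system.integrated_solutionD(6)[OF solution t H10_class_in_sobolev0[OF \<psi>]]
  by (simp add: acceleration_def l2pair_velocity[OF t] l2pair_velocity[of 0] H10_L2v[OF \<psi>] initial)

lemma acceleration_bound:
  assumes "t \<in> {0..T}" "H10 U \<psi>"
  shows "\<bar>acceleration t \<psi>\<bar> \<le> (3 * operator_bound * system.sol_bound + norm (source t)) * H1norm U \<psi>"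
  using system.flux_bound[OF assms(1) H10_class_in_sobolev0[OF assms(2)] u_bound[OF assms(1)]
    w_bound[OF assms(1)]]
  by (simp add: acceleration_def norm_h1_class H10_H1[OF assms(2)])

lemma acceleration_absolutely_integrable:
  assumes \<psi>: "H10 U \<psi>"
  shows "(\<lambda>t. acceleration t \<psi>) absolutely_integrable_on {0..T}"
proof (rule absolutely_integrable_integrable_bound[OF _ _ system.flux_majorant_integrable])
  show "norm (acceleration t \<psi>) \<le> system.flux_majorant t * norm (h1_class U \<psi>)" if "t \<in> {0..T}" for t
    using system.flux_le_majorant[OF that H10_class_in_sobolev0[OF \<psi>] u_bound[OF that] w_bound[OF that]]
    by (simp add: acceleration_def)
  show "(\<lambda>t. acceleration t \<psi>) integrable_on {0..T}"
    using velocity_integral[OF _ \<psi>, of T] T_pos by (auto intro: has_integral_integrable)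
qed

lemma Hm1_acceleration:
  assumes t: "t \<in> {0..T}"
  shows "Hm1 U (acceleration t)"
  unfolding Hm1_def
proof (intro conjI exI allI impI)
  fix \<phi> \<psi> c assume \<phi>: "H10 U \<phi>" and \<psi>: "H10 U \<psi>"
  show "acceleration t (\<lambda>x. \<phi> x + c * \<psi> x) = acceleration t \<phi> + c * acceleration t \<psi>"
    using linear_form_onD[OF system.flux_linear[OF t] H10_class_in_sobolev0[OF \<phi>]
      H10_class_in_sobolev0[OF \<psi>]]
    by (simp add: acceleration_def h1_class_linear H10_H1 \<phi> \<psi>)
qed (rule acceleration_bound[OF t])

lemma L2_H10_position: "L2_H10 T U position"
  unfolding L2_H10_def
proof (intro conjI allI impI)
  show "AE t in lebesgue_on {0..T}. H10 U (position t)" by (rule AE_I2) (simp add: position_H10)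
  fix \<psi> and \<Psi> :: "real^'n \<Rightarrow> real^'n" assume "L2 U \<psi>" and \<Psi>: "L2v U \<Psi>"
  then have \<psi>: "L2v U \<psi>" by (simp add: L2_eq_L2v)
  have "continuous_on {0..T}
      (\<lambda>t. l2pair U (position t) \<psi> + (\<integral>x. wgrad U (position t) x \<bullet> \<Psi> x \<partial>lebesgue_on U))"
  proof (rule continuous_on_eq[OF system.position_weakly_continuous[OF solution,
          of "(l2_class U \<psi>, l2_class U \<Psi>)"]])
    fix t assume t: "t \<in> {0..T}"
    have "snd (u t) = l2_class U (wgrad U (position t))"
      unfolding h1_class_position[OF t, symmetric] by (simp add: h1_class_def)
    then show "u t \<bullet> (l2_class U \<psi>, l2_class U \<Psi>)
        = l2pair U (position t) \<psi> + (\<integral>x. wgrad U (position t) x \<bullet> \<Psi> x \<partial>lebesgue_on U)"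
      using inner_l2_class[OF H1_wgrad_L2v[OF H10_H1[OF position_H10[OF t]]] \<Psi>]
      by (simp add: inner_prod_def l2pair_position[OF t \<psi>])
  qed
  then show "(\<lambda>t. l2pair U (position t) \<psi> + (\<integral>x. wgrad U (position t) x \<bullet> \<Psi> x \<partial>lebesgue_on U))
      \<in> borel_measurable (lebesgue_on {0..T})"
    by (rule continuous_imp_measurable_on_sets_lebesgue) simp
next
  show "(\<integral>\<^sup>+t. ennreal ((H1norm U (position t))\<^sup>2) \<partial>lebesgue_on {0..T}) < \<infinity>"
  proof (rule nn_integral_interval_finite[where k = "\<lambda>_. system.sol_bound\<^sup>2"])
    show "(H1norm U (position t))\<^sup>2 \<le> system.sol_bound\<^sup>2" if t: "t \<in> {0..T}" for t
      unfolding norm_h1_class[OF H10_H1[OF position_H10[OF t]], symmetric] h1_class_position[OF t]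
      by (intro power_mono u_bound t norm_ge_zero)
  qed auto
qed

lemma time_deriv_L2_position: "time_deriv_L2 T U position velocity"
  unfolding time_deriv_L2_def
proof (intro allI impI)
  fix \<phi> \<psi> assume \<phi>: "test_fun {0<..<T} \<phi>" and "L2 U \<psi>"
  then have \<psi>: "L2v U \<psi>" by (simp add: L2_eq_L2v)
  from weak_time_derivative[OF T_pos absolutely_integrable_continuous_real[OF velocity_pairing_continuous[OF \<psi>]]
      position_integral[OF _ \<psi>] \<phi>]
  show "(\<integral>t. l2pair U (position t) \<psi> * deriv \<phi> t \<partial>lebesgue_on {0<..<T})
      = - (\<integral>t. l2pair U (velocity t) \<psi> * \<phi> t \<partial>lebesgue_on {0<..<T})" by simp
qed

lemma L2_L2_velocity: "L2_L2 T U velocity"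
  unfolding L2_L2_def
proof (intro conjI allI impI)
  show "AE t in lebesgue_on {0..T}. L2 U (velocity t)" by (rule AE_I2) (simp add: L2_eq_L2v velocity_L2v)
  show "(\<lambda>t. l2pair U (velocity t) \<psi>) \<in> borel_measurable (lebesgue_on {0..T})" if "L2 U \<psi>" for \<psi>
    using that
    by (intro continuous_imp_measurable_on_sets_lebesgue velocity_pairing_continuous)
      (simp_all add: L2_eq_L2v)
  show "(\<integral>\<^sup>+t. ennreal ((L2norm U (velocity t))\<^sup>2) \<partial>lebesgue_on {0..T}) < \<infinity>"
  proof (rule nn_integral_interval_finite[where k = "\<lambda>_. system.sol_bound\<^sup>2"])
    show "(L2norm U (velocity t))\<^sup>2 \<le> system.sol_bound\<^sup>2" if "t \<in> {0..T}" for t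
      unfolding norm_l2_class[OF velocity_L2v, symmetric] l2_class_velocity[OF that]
      by (intro power_mono w_bound that norm_ge_zero)
  qed auto
qed

lemma time_deriv_Hm1_velocity: "time_deriv_Hm1 T U velocity acceleration"
  unfolding time_deriv_Hm1_def
  using weak_time_derivative[OF T_pos acceleration_absolutely_integrable velocity_integral] by blast

lemma L2_Hm1_acceleration: "L2_Hm1 T U acceleration"
  unfolding L2_Hm1_def
proof (intro conjI allI impI)
  show "AE t in lebesgue_on {0..T}. Hm1 U (acceleration t)" by (rule AE_I2) (simp add: Hm1_acceleration)
  show "(\<lambda>t. acceleration t \<psi>) \<in> borel_measurable (lebesgue_on {0..T})" if "H10 U \<psi>" for \<psi>
    by (intro borel_measurable_integrable absolutely_integrable_imp_integrable
        acceleration_absolutely_integrable that) simp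
  let ?c = "3 * operator_bound * system.sol_bound"
  let ?k = "\<lambda>t. 2 * ?c\<^sup>2 + (norm (source t))\<^sup>2 * 2"
  show "(\<integral>\<^sup>+t. ennreal ((Hm1norm U (acceleration t))\<^sup>2) \<partial>lebesgue_on {0..T}) < \<infinity>"
  proof (rule nn_integral_interval_finite)
    show "?k integrable_on {0..T}"
      by (intro integrable_add integrable_const_ivl integrable_on_mult_left source_sq_integrable)
    fix t assume t: "t \<in> {0..T}"
    have "0 \<le> ?c + norm (source t)" using system.M_nonneg sol_bound_nonneg by simp
    note Hm1norm_nonneg[OF this acceleration_bound[OF t]] Hm1norm_le[OF this acceleration_bound[OF t]]
    then have "(Hm1norm U (acceleration t))\<^sup>2 \<le> (?c + norm (source t))\<^sup>2" by (intro power_mono)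
    also have "\<dots> \<le> ?k t"
      using zero_le_power2[of "?c - norm (source t)"] by (simp add: power2_eq_square algebra_simps)
    finally show "(Hm1norm U (acceleration t))\<^sup>2 \<le> ?k t" .
  qed simp
qed

lemma position_strongly_continuous:
  assumes t: "t \<in> {0..T}"
  shows "((\<lambda>s. L2norm U (\<lambda>x. position s x - position t x)) \<longlongrightarrow> 0) (at t within {0..T})"
proof (rule Lim_null_comparison)
  have "norm (L2norm U (\<lambda>x. position s x - position t x)) \<le> system.sol_bound * \<bar>s - t\<bar>" if
    s: "s \<in> {0..T}" for s
  proof -
    have "L2norm U (\<lambda>x. position s x - position t x) = norm (fst (u s) - fst (u t))"
      using norm_l2_class[OF L2v_linear[OF position_L2v position_L2v], of s "-1" t]
        l2_class_linear[OF position_L2v position_L2v, of s "-1" t] l2_class_position[OF s]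
          l2_class_position[OF t]
      by simp
    then show ?thesis using system.position_lipschitz[OF solution s t] by simp
  qed
  then show "\<forall>\<^sub>F s in at t within {0..T}.
      norm (L2norm U (\<lambda>x. position s x - position t x)) \<le> system.sol_bound * \<bar>s - t\<bar>"
    unfolding eventually_at_filter by (intro always_eventually) simp
  have "((\<lambda>s. system.sol_bound * \<bar>s - t\<bar>) \<longlongrightarrow> system.sol_bound * \<bar>t - t\<bar>) (at t within {0..T})"
    by (intro tendsto_intros)
  then show "((\<lambda>s. system.sol_bound * \<bar>s - t\<bar>) \<longlongrightarrow> 0) (at t within {0..T})" by simp
qed

lemma velocity_strongly_continuous:
  assumes t: "t \<in> {0..T}"
  shows "((\<lambda>s. Hm1norm U (l2pair U (\<lambda>x. velocity s x - velocity t x))) \<longlongrightarrow> 0) (at t within {0..T})"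
proof (rule Lim_null_comparison)
  define K where "K t = integral {0..t} system.flux_majorant" for t
  have "norm (Hm1norm U (l2pair U (\<lambda>x. velocity s x - velocity t x))) \<le> \<bar>K s - K t\<bar>" if
    s: "s \<in> {0..T}" for s
  proof -
    have "\<bar>l2pair U (\<lambda>x. velocity s x - velocity t x) \<psi>\<bar> \<le> \<bar>K s - K t\<bar> * H1norm U \<psi>" if \<psi>: "H10 U \<psi>" for \<psi>
      using system.velocity_increment_le[OF solution s t H10_class_in_sobolev0[OF \<psi>]]
        l2pair_eq_inner[OF L2v_linear[OF velocity_L2v velocity_L2v] H10_L2v[OF \<psi>], of s "-1" t]
        l2_class_linear[OF velocity_L2v velocity_L2v, of s "-1" t]
      by (simp add: K_def l2_class_velocity[OF s] l2_class_velocity[OF t] inner_diff_left norm_h1_class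
          H10_H1[OF \<psi>])
    from Hm1norm_nonneg[OF abs_ge_zero this] Hm1norm_le[OF abs_ge_zero this] show ?thesis by simp
  qed
  then show "\<forall>\<^sub>F s in at t within {0..T}.
      norm (Hm1norm U (l2pair U (\<lambda>x. velocity s x - velocity t x))) \<le> \<bar>K s - K t\<bar>"
    unfolding eventually_at_filter by (intro always_eventually) simp
  have "continuous_on {0..T} K"
    unfolding K_def using system.flux_majorant_integrable[of 1]
    by (intro indefinite_integral_continuous_1) simp
  then have "(K \<longlongrightarrow> K t) (at t within {0..T})" using t by (simp add: continuous_on)
  then have "((\<lambda>s. \<bar>K s - K t\<bar>) \<longlongrightarrow> \<bar>K t - K t\<bar>) (at t within {0..T})" by (intro tendsto_intros)
  then show "((\<lambda>s. \<bar>K s - K t\<bar>) \<longlongrightarrow> 0) (at t within {0..T})" by simp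
qed

lemma position_initial: "AE x in lebesgue_on U. position 0 x = v0 x"
proof -
  have "l2_class U (position 0) = l2_class U v0" by (simp add: l2_class_position initial)
  then show ?thesis unfolding l2_class_eq_iff[OF position_L2v H10_L2v[OF v0]] .
qed

lemma velocity_initial: "H10 U \<psi> \<Longrightarrow> l2pair U (velocity 0) \<psi> = l2pair U v1 \<psi>"
  by (simp add: l2pair_velocity l2pair_eq_inner initial H10_L2v v1)

lemma weakly_cont_H10_position: "weakly_cont_H10 T U position"
  unfolding weakly_cont_H10_def
proof (intro conjI ballI allI impI)
  fix \<Lambda> assume "Hm1 U \<Lambda>"
  then obtain z where z: "\<forall>u. H10 U u \<longrightarrow> \<Lambda> u = h1_class U u \<bullet> z" using Hm1_riesz by blast
  show "continuous_on {0..T} (\<lambda>t. \<Lambda> (position t))"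
    by (rule continuous_on_eq[OF system.position_weakly_continuous[OF solution, of z]])
      (simp add: z position_H10 h1_class_position)
qed (rule position_H10)

lemma weakly_cont_L2_velocity: "weakly_cont_L2 T U velocity"
  by (simp add: weakly_cont_L2_def L2_eq_L2v velocity_L2v velocity_pairing_continuous)

end

subsection \<open>The equation\<close>

context wave_data
begin

lemma principal_part_h1_class:
  assumes t: "t \<in> {0..T}" and v: "H10 U v" and \<phi>: "H10 U \<phi>"
  shows "h1_class U v \<bullet> principal_part t (h1_class U \<phi>)
    = l2_class U v \<bullet> l2_class U \<phi> + (\<integral>x. (B t x *v wgrad U v x) \<bullet> wgrad U \<phi> x \<partial>lebesgue_on U)"
proof -
  note grad_v = H1_wgrad_L2v[OF H10_H1[OF v]] and grad_\<phi> = H1_wgrad_L2v[OF H10_H1[OF \<phi>]]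
  have "h1_class U v \<bullet> principal_part t (h1_class U \<phi>) = h1_class U \<phi> \<bullet> principal_part t (h1_class U v)"
    by (intro principal_part_symmetric t H10_class_in_sobolev0 v \<phi>)
  also have "\<dots> = l2_class U \<phi> \<bullet> l2_class U v
      + l2_class U (wgrad U \<phi>) \<bullet> l2_class U (\<lambda>x. B t x *v wgrad U v x)"
    by (simp add: principal_part_def h1_class_def l2_multiply_class[OF B_coefficient[OF t] grad_v])
  finally show ?thesis
    using inner_l2_class[OF grad_\<phi> L2v_multiply[OF B_coefficient[OF t] grad_v]]
    by (simp add: inner_commute)
qed

lemma convection_h1_class:
  assumes v: "H10 U v" and \<phi>: "H10 U \<phi>"
  shows "h1_class U v \<bullet> convection t (h1_class U \<phi>)
      = - (l2_class U v \<bullet> l2_class U \<phi>) + (\<integral>x. (a (t, x) \<bullet> wgrad U v x) * \<phi> x \<partial>lebesgue_on U)"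
    and convection_integrable: "integrable (lebesgue_on U) (\<lambda>x. (a (t, x) \<bullet> wgrad U v x) * \<phi> x)"
proof -
  note grad_v = H1_wgrad_L2v[OF H10_H1[OF v]]
  have integrand: "(\<lambda>x. wgrad U v x \<bullet> (\<phi> x *\<^sub>R a (t, x))) = (\<lambda>x. (a (t, x) \<bullet> wgrad U v x) * \<phi> x)"
    by (simp add: fun_eq_iff inner_commute)
  note multiply_L2v = L2v_multiply[OF a_coefficient H10_L2v[OF \<phi>], of t]
  show "h1_class U v \<bullet> convection t (h1_class U \<phi>)
      = - (l2_class U v \<bullet> l2_class U \<phi>) + (\<integral>x. (a (t, x) \<bullet> wgrad U v x) * \<phi> x \<partial>lebesgue_on U)"
    using inner_l2_class[OF grad_v multiply_L2v] unfolding integrand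
    by (simp add: convection_def h1_class_def l2_multiply_class[OF a_coefficient H10_L2v[OF \<phi>]])
  show "integrable (lebesgue_on U) (\<lambda>x. (a (t, x) \<bullet> wgrad U v x) * \<phi> x)"
    using L2v_inner_integrable[OF grad_v multiply_L2v] unfolding integrand .
qed

lemma mixed_h1_class:
  assumes t: "t \<in> {0..T}" and w: "L2v U w" and \<phi>: "H10 U \<phi>"
  shows "l2_class U w \<bullet> mixed t (h1_class U \<phi>) = 2 * l2pair U w (wdiv U (\<lambda>x. \<phi> x *\<^sub>R b t x))"
proof -
  interpret lipschitz_field U "b t" L\<^sub>b M\<^sub>b by (rule b_lipschitz_field[OF t])
  show ?thesis by (simp add: mixed_def divergence_h1_class \<phi> l2pair_eq_inner w wdiv_L2v)
qed

lemma flux_h1_class: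
  assumes "t \<in> {0..T}" "H10 U v" "L2v U w" "H10 U \<phi>"
  shows "system.flux (h1_class U v) (l2_class U w) (h1_class U \<phi>) t
    = (\<integral>x. (B t x *v wgrad U v x) \<bullet> wgrad U \<phi> x \<partial>lebesgue_on U)
      + (\<integral>x. (a (t, x) \<bullet> wgrad U v x) * \<phi> x \<partial>lebesgue_on U)
      + 2 * l2pair U w (wdiv U (\<lambda>x. \<phi> x *\<^sub>R b t x)) - source t \<bullet> l2_class U \<phi>"
  using assms by (simp add: system.flux_def principal_part_h1_class convection_h1_class mixed_h1_class)

lemma AE_source_eq:
  "AE t in lebesgue_on {0..T}. L2v U (\<lambda>x. g (t, x)) \<and> source t = l2_class U (\<lambda>x. g (t, x))"
proof -
  have "AE t in lborel. (\<integral>\<^sup>+x. ennreal ((g (t, x))\<^sup>2) \<partial>lborel) \<noteq> \<infinity>"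
    using g_section_nn_integral by (intro nn_integral_noteq_infinite) auto
  then have "AE t in lebesgue. (\<integral>\<^sup>+x. ennreal ((g (t, x))\<^sup>2) \<partial>lborel) < \<infinity>"
    by (intro AE_completion) (simp add: less_top)
  then have "AE t in lebesgue. L2v U (\<lambda>x. g (t, x)) \<and> source t = l2_class U (\<lambda>x. g (t, x))"
    by eventually_elim (simp add: source_section_L2v source_def)
  then show ?thesis by (subst AE_restrict_space_iff) (auto elim: eventually_mono)
qed

end

context wave_solution
begin

lemma equation:
  assumes coefficients:
    "AE t in lebesgue_on {0..T}. AE x in lebesgue_on U. a' t x = a (t, x) \<and> g' t x = g (t, x)"
  shows "AE t in lebesgue_on {0..T}. \<forall>\<phi>. H10 U \<phi> \<longrightarrow>
    acceleration t \<phi>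
    + (\<integral>x. (B t x *v wgrad U (position t) x) \<bullet> wgrad U \<phi> x \<partial>lebesgue_on U)
    + (\<integral>x. (a' t x \<bullet> wgrad U (position t) x) * \<phi> x \<partial>lebesgue_on U)
    + 2 * l2pair U (velocity t) (wdiv U (\<lambda>x. \<phi> x *\<^sub>R b t x))
    = l2pair U (g' t) \<phi>"
  using coefficients AE_source_eq AE_space
proof eventually_elim
  case (elim t)
  then have t: "t \<in> {0..T}" by simp
  show ?case
  proof (intro allI impI)
    fix \<phi> assume \<phi>: "H10 U \<phi>"
    have "(\<integral>x. (a (t, x) \<bullet> wgrad U (position t) x) * \<phi> x \<partial>lebesgue_on U)
        = (\<integral>x. (a' t x \<bullet> wgrad U (position t) x) * \<phi> x \<partial>lebesgue_on U)"
      using elim(1)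
      by (intro integral_lebesgue_on_cong_AE borel_measurable_integrable convection_integrable position_H10
          t \<phi>)
        (auto elim: eventually_mono)
    moreover have "source t \<bullet> l2_class U \<phi> = l2pair U (g' t) \<phi>"
    proof -
      have "source t \<bullet> l2_class U \<phi> = (\<integral>x. g (t, x) * \<phi> x \<partial>lebesgue_on U)"
        using elim(2) inner_l2_class[OF _ H10_L2v[OF \<phi>]] by simp
      also have "\<dots> = l2pair U (g' t) \<phi>"
        unfolding l2pair_def using elim(1,2) H10_L2v[OF \<phi>]
        by (intro integral_lebesgue_on_cong_AE borel_measurable_times)
          (auto simp: L2v_def elim: eventually_mono)
      finally show ?thesis .
    qed
    ultimately show "acceleration t \<phi>
        + (\<integral>x. (B t x *v wgrad U (position t) x) \<bullet> wgrad U \<phi> x \<partial>lebesgue_on U)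
        + (\<integral>x. (a' t x \<bullet> wgrad U (position t) x) * \<phi> x \<partial>lebesgue_on U)
        + 2 * l2pair U (velocity t) (wdiv U (\<lambda>x. \<phi> x *\<^sub>R b t x))
        = l2pair U (g' t) \<phi>"
      using flux_h1_class[OF t position_H10[OF t] velocity_L2v[of t] \<phi>]
      unfolding h1_class_position[OF t] l2_class_velocity[OF t] acceleration_def by simp
  qed
qed

theorem strong_weak_solution:
  assumes "AE t in lebesgue_on {0..T}. AE x in lebesgue_on U. a' t x = a (t, x) \<and> g' t x = g (t, x)"
  shows "strong_weak_solution_with T U B a' b g' v0 v1 position velocity acceleration"
  unfolding strong_weak_solution_with_def
  by (intro conjI ballI allI impI L2_H10_position time_deriv_L2_position L2_L2_velocity
      time_deriv_Hm1_velocity L2_Hm1_acceleration position_strongly_continuous position_initial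
      Hm1_l2pair velocity_L2v velocity_strongly_continuous velocity_initial equation[OF assms])
    (simp add: L2_eq_L2v position_L2v)

end

section \<open>Reduction to Borel data\<close>

lemma (in open_domain) AE_lborel_slices:
  fixes P :: "real \<times> 'a \<Rightarrow> bool"
  assumes P: "AE z in lborel. z \<in> {0<..<T} \<times> U \<longrightarrow> P z"
  shows "AE t in lebesgue_on {0..T}. AE x in lebesgue_on U. P (t, x)"
proof -
  have "AE z in lborel \<Otimes>\<^sub>M lborel. z \<in> {0<..<T} \<times> U \<longrightarrow> P z" using P by (simp only: lborel_prod)
  then have "AE t in lborel. AE x in lborel. (t, x) \<in> {0<..<T} \<times> U \<longrightarrow> P (t, x)"
    by (rule lborel_pair.AE_pair)
  then have "AE t in lborel. t \<in> {0..T} \<longrightarrow> (AE x in lebesgue_on U. P (t, x))"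
    using AE_lborel_singleton[of 0] AE_lborel_singleton[of T]
  proof eventually_elim
    case (elim t)
    show ?case
    proof
      assume "t \<in> {0..T}"
      then have t: "t \<in> {0<..<T}" using elim(2,3) by auto
      have "AE x in lborel. x \<in> U \<longrightarrow> P (t, x)" using elim(1) by eventually_elim (use t in simp)
      then show "AE x in lebesgue_on U. P (t, x)" unfolding AE_lebesgue_on_iff by (rule AE_completion)
    qed
  qed
  then have "AE t in lebesgue. t \<in> {0..T} \<longrightarrow> (AE x in lebesgue_on U. P (t, x))" by (rule AE_completion)
  then show ?thesis by (subst AE_restrict_space_iff) auto
qed

lemma bounded_borel_version:
  fixes f :: "'a::euclidean_space \<Rightarrow> 'b::euclidean_space"
  assumes S: "S \<in> sets lebesgue" and f: "f \<in> borel_measurable (lebesgue_on S)"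
    and M: "AE z in lebesgue_on S. norm (f z) \<le> M"
  shows "\<exists>f' C. f' \<in> borel_measurable borel \<and> 0 \<le> C \<and> (\<forall>z. norm (f' z) \<le> C)
    \<and> (AE z in lborel. z \<in> S \<longrightarrow> f z = f' z)"
proof -
  obtain h where h: "h \<in> borel_measurable borel" "AE z in lborel. z \<in> S \<longrightarrow> f z = h z"
    using lebesgue_borel_version[OF S f] by blast
  define C where "C = max 0 M"
  define f' where "f' z = (if norm (h z) \<le> C then h z else 0)" for z
  have "f' \<in> borel_measurable borel" unfolding f'_def[abs_def] using h(1) by measurable
  moreover have "0 \<le> C" "norm (f' z) \<le> C" for z by (simp_all add: C_def f'_def)
  moreover have "AE z in lebesgue. z \<in> S \<longrightarrow> norm (f z) \<le> M" using M S by (simp add: AE_restrict_space_iff)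
  then have "AE z in lborel. z \<in> S \<longrightarrow> norm (f z) \<le> M" by (simp only: AE_completion_iff)
  with h(2) have "AE z in lborel. z \<in> S \<longrightarrow> f z = f' z" by eventually_elim (auto simp: f'_def C_def)
  ultimately show ?thesis by blast
qed

lemma L2_borel_version:
  fixes f :: "'a::euclidean_space \<Rightarrow> real"
  assumes S: "open S" and f: "L2 S f"
  shows "\<exists>f'. f' \<in> borel_measurable borel \<and> (\<integral>\<^sup>+z. ennreal ((f' z)\<^sup>2) \<partial>lborel) < \<infinity>
    \<and> (AE z in lborel. z \<in> S \<longrightarrow> f z = f' z)"
proof -
  have S_sets: "S \<in> sets lebesgue" using S by auto
  obtain h where h: "h \<in> borel_measurable borel" "AE z in lborel. z \<in> S \<longrightarrow> f z = h z"
    using lebesgue_borel_version[OF S_sets, of f] f by (auto simp: L2_def)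
  have square_integrable: "integrable lebesgue (\<lambda>z. indicator S z *\<^sub>R (f z)\<^sup>2)"
    using f by (simp add: L2_def lebesgue_on_indicator(2)[OF S_sets])
  have "(\<integral>\<^sup>+z. ennreal ((indicator S z * h z)\<^sup>2) \<partial>lborel) = (\<integral>\<^sup>+z. ennreal (indicator S z *\<^sub>R (f z)\<^sup>2) \<partial>lborel)"
    by (rule nn_integral_cong_AE) (use h(2) in \<open>eventually_elim, auto simp: indicator_def\<close>)
  also have "\<dots> = (\<integral>\<^sup>+z. ennreal (indicator S z *\<^sub>R (f z)\<^sup>2) \<partial>lebesgue)"
    by (rule nn_integral_completion[symmetric])
  also have "\<dots> = ennreal (\<integral>z. indicator S z *\<^sub>R (f z)\<^sup>2 \<partial>lebesgue)"
    by (rule nn_integral_eq_integral[OF square_integrable]) simp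
  finally have "(\<integral>\<^sup>+z. ennreal ((indicator S z * h z)\<^sup>2) \<partial>lborel) < \<infinity>" by simp
  moreover have "(\<lambda>z. indicator S z * h z) \<in> borel_measurable borel"
    using h(1) S by (intro borel_measurable_times borel_measurable_indicator) auto
  moreover have "AE z in lborel. z \<in> S \<longrightarrow> f z = indicator S z * h z" using h(2) by eventually_elim auto
  ultimately show ?thesis by blast
qed

lemma lipschitz_coefficient_bounds:
  fixes F :: "real \<Rightarrow> 'a::euclidean_space \<Rightarrow> 'b::real_normed_vector"
  assumes U: "bounded U" and F: "L-lipschitz_on ({0..T} \<times> closure U) (\<lambda>(t, y). F t y)"
  shows "0 \<le> L"
    and "t \<in> {0..T} \<Longrightarrow> s \<in> {0..T} \<Longrightarrow> x \<in> U \<Longrightarrow> y \<in> U \<Longrightarrow>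
      norm (F t x - F s y) \<le> L * (\<bar>t - s\<bar> + norm (x - y))"
    and "\<exists>C\<ge>0. \<forall>t\<in>{0..T}. \<forall>x\<in>U. norm (F t x) \<le> C"
proof -
  let ?S = "{0..T} \<times> closure U"
  have in_domain: "(t, x) \<in> ?S" if "t \<in> {0..T}" "x \<in> U" for t x using that closure_subset[of U] by auto
  show L: "0 \<le> L" by (rule lipschitz_on_nonneg[OF F])
  show "norm (F t x - F s y) \<le> L * (\<bar>t - s\<bar> + norm (x - y))"
    if "t \<in> {0..T}" "s \<in> {0..T}" "x \<in> U" "y \<in> U" for t s x y
  proof -
    have "norm (F t x - F s y) \<le> L * dist (t, x) (s, y)"
      using lipschitz_onD[OF F in_domain in_domain] that by (simp add: dist_norm)
    also have "\<dots> \<le> L * (\<bar>t - s\<bar> + norm (x - y))"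
      using norm_Pair_le[of "t - s" "x - y"] L by (intro mult_left_mono) (simp_all add: dist_norm)
    finally show ?thesis .
  qed
  have "bounded ((\<lambda>(t, y). F t y) ` ?S)"
    using U
    by (intro compact_imp_bounded compact_continuous_image lipschitz_on_continuous_on[OF F] compact_Times)
      auto
  then obtain C where "\<And>z. z \<in> ?S \<Longrightarrow> norm ((\<lambda>(t, y). F t y) z) \<le> C" unfolding bounded_iff by blast
  then show "\<exists>C\<ge>0. \<forall>t\<in>{0..T}. \<forall>x\<in>U. norm (F t x) \<le> C"
    using in_domain by (intro exI[of _ "max 0 C"]) (force intro: max.coboundedI2)
qed

lemma wave_data_exists:
  fixes U :: "(real^'n) set"
  assumes U: "open U" "bounded U" and T: "T > 0"
    and B: "\<exists>L. L-lipschitz_on ({0..T} \<times> closure U) (\<lambda>(t, y). B t y)"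
    and symmetric: "\<forall>t\<in>{0..T}. \<forall>y\<in>closure U. transpose (B t y) = B t y"
    and elliptic: "\<exists>c>0. \<forall>t\<in>{0..T}. \<forall>y\<in>closure U. \<forall>w. (B t y *v w) \<bullet> w \<ge> c * (norm w)\<^sup>2"
    and a: "(\<lambda>(t, y). a t y) \<in> borel_measurable (lebesgue_on ({0..T} \<times> closure U))"
      "\<exists>M. AE z in lebesgue_on ({0..T} \<times> closure U). norm ((\<lambda>(t, y). a t y) z) \<le> M"
    and b: "\<exists>L. L-lipschitz_on ({0..T} \<times> closure U) (\<lambda>(t, y). b t y)"
    and g: "L2 ({0<..<T} \<times> U) (\<lambda>(t, y). g t y)" and v: "H10 U v0" "L2 U v1"
  shows "\<exists>a' g' L\<^sub>B M\<^sub>B c\<^sub>B M\<^sub>a L\<^sub>b M\<^sub>b. wave_data U T B b a' g' v0 v1 L\<^sub>B M\<^sub>B c\<^sub>B M\<^sub>a L\<^sub>b M\<^sub>b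
    \<and> (AE t in lebesgue_on {0..T}. AE x in lebesgue_on U. a t x = a' (t, x) \<and> g t x = g' (t, x))"
proof -
  interpret sobolev_domain U by standard (rule U)
  let ?S = "{0..T} \<times> closure U" and ?Q = "{0<..<T} \<times> U"
  note in_closure = subsetD[OF closure_subset[of U]]
  obtain L\<^sub>B where B: "L\<^sub>B-lipschitz_on ?S (\<lambda>(t, y). B t y)" using B by blast
  note B_bounds = lipschitz_coefficient_bounds[OF U(2) B]
  obtain M\<^sub>B where M\<^sub>B: "0 \<le> M\<^sub>B" "\<forall>t\<in>{0..T}. \<forall>x\<in>U. norm (B t x) \<le> M\<^sub>B" using B_bounds(3) by blast
  obtain L\<^sub>b where b: "L\<^sub>b-lipschitz_on ?S (\<lambda>(t, y). b t y)" using b by blast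
  note b_bounds = lipschitz_coefficient_bounds[OF U(2) b]
  obtain M\<^sub>b where M\<^sub>b: "0 \<le> M\<^sub>b" "\<forall>t\<in>{0..T}. \<forall>x\<in>U. norm (b t x) \<le> M\<^sub>b" using b_bounds(3) by blast
  obtain c\<^sub>B where c\<^sub>B: "c\<^sub>B > 0" "\<forall>t\<in>{0..T}. \<forall>y\<in>closure U. \<forall>w. (B t y *v w) \<bullet> w \<ge> c\<^sub>B * (norm w)\<^sup>2"
    using elliptic by blast
  have "closed ?S" by (intro closed_Times) auto
  then have S_sets: "?S \<in> sets lebesgue" by (intro sets_completionI_sets) simp
  obtain M where M: "AE z in lebesgue_on ?S. norm ((\<lambda>(t, y). a t y) z) \<le> M" using a(2) by blast
  obtain a' M\<^sub>a where a': "a' \<in> borel_measurable borel" "0 \<le> M\<^sub>a" "\<forall>z. norm (a' z) \<le> M\<^sub>a"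
    "AE z in lborel. z \<in> ?S \<longrightarrow> (\<lambda>(t, y). a t y) z = a' z"
    using bounded_borel_version[OF S_sets a(1) M] by blast
  have "open ?Q" using U by (intro open_Times) auto
  then obtain g' where g': "g' \<in> borel_measurable borel" "(\<integral>\<^sup>+z. ennreal ((g' z)\<^sup>2) \<partial>lborel) < \<infinity>"
    "AE z in lborel. z \<in> ?Q \<longrightarrow> (\<lambda>(t, y). g t y) z = g' z"
    using L2_borel_version[OF _ g] by blast
  have "wave_data U T B b a' g' v0 v1 L\<^sub>B M\<^sub>B c\<^sub>B M\<^sub>a L\<^sub>b M\<^sub>b"
    by standard (use T B_bounds(1,2) M\<^sub>B symmetric c\<^sub>B a' b_bounds(1,2) M\<^sub>b g' v in_closure in
        \<open>auto simp: L2_eq_L2v\<close>)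
  moreover have "AE z in lborel. z \<in> ?Q \<longrightarrow> a (fst z) (snd z) = a' z \<and> g (fst z) (snd z) = g' z"
    using a'(4) g'(3)
  proof eventually_elim
    case (elim z)
    have "z \<in> ?S" if "z \<in> ?Q" using that in_closure by (auto simp: mem_Times_iff)
    then show ?case using elim by (simp add: split_beta)
  qed
  from AE_lborel_slices[OF this]
  have "AE t in lebesgue_on {0..T}. AE x in lebesgue_on U. a t x = a' (t, x) \<and> g t x = g' (t, x)" by simp
  ultimately show ?thesis by blast
qed

theorem theorem3p2:
  fixes U :: "(real^'n) set" and T :: real
    and B :: "real \<Rightarrow> real^'n \<Rightarrow> real^'n^'n"
    and a b :: "real \<Rightarrow> real^'n \<Rightarrow> real^'n"
    and g :: "real \<Rightarrow> real^'n \<Rightarrow> real"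
    and v0 v1 :: "real^'n \<Rightarrow> real"
  assumes "U \<noteq> {}" and "open U" and "bounded U" and "lipschitz_boundary U"
    and "T > 0"
    and "\<exists>L. L-lipschitz_on ({0..T} \<times> closure U) (\<lambda>(t, y). B t y)"
    and "\<forall>t\<in>{0..T}. \<forall>y\<in>closure U. transpose (B t y) = B t y"
    and "\<exists>cB>0. \<forall>t\<in>{0..T}. \<forall>y\<in>closure U. \<forall>w. (B t y *v w) \<bullet> w \<ge> cB * (norm w)^2"
    and "(\<lambda>(t, y). a t y) \<in> borel_measurable (lebesgue_on ({0..T} \<times> closure U))"
    and "\<exists>M. AE z in lebesgue_on ({0..T} \<times> closure U). norm ((\<lambda>(t, y). a t y) z) \<le> M"
    and "\<exists>L. L-lipschitz_on ({0..T} \<times> closure U) (\<lambda>(t, y). b t y)"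
    and "L2 ({0<..<T} \<times> U) (\<lambda>(t, y). g t y)"
    and "H10 U v0"
    and "L2 U v1"
  shows "\<exists>v vd vdd. strong_weak_solution_with T U B a b g v0 v1 v vd vdd
           \<and> weakly_cont_H10 T U v \<and> weakly_cont_L2 T U vd"
proof -
  obtain a' g' L\<^sub>B M\<^sub>B c\<^sub>B M\<^sub>a L\<^sub>b M\<^sub>b
    where data: "wave_data U T B b a' g' v0 v1 L\<^sub>B M\<^sub>B c\<^sub>B M\<^sub>a L\<^sub>b M\<^sub>b"
      and coefficients:
        "AE t in lebesgue_on {0..T}. AE x in lebesgue_on U. a t x = a' (t, x) \<and> g t x = g' (t, x)"
    using wave_data_exists[OF assms(2,3,5-14)] by blast
  interpret wave_data U T B b a' g' v0 v1 L\<^sub>B M\<^sub>B c\<^sub>B M\<^sub>a L\<^sub>b M\<^sub>b by (rule data)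
  obtain u w where "system.integrated_solution (\<lambda>t. t) u w"
    using system.integrated_solution_exists by blast
  then interpret wave_solution U T B b a' g' v0 v1 L\<^sub>B M\<^sub>B c\<^sub>B M\<^sub>a L\<^sub>b M\<^sub>b u w by unfold_locales
  show ?thesis
    using strong_weak_solution[OF coefficients] weakly_cont_H10_position weakly_cont_L2_velocity by blast
qed

end
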